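(* Let $H(K)$ be a separable reproducing kernel Hilbert space on a domain $D\subset\mathbb{R}^d$ with a positive semidefinite kernel $K$ such that $\sup_{\mathbf{x}\in D}K(\mathbf{x},\mathbf{x})<\infty$, and let $\varrho_D$ be a probability measure on $D$. Let $\mu_D$ be a measure on $D$ such that $L_1(D,\varrho_D)\hookrightarrow L_1(D,\mu_D)$, and denote by $$C_{\varrho,\mu}:=\|\mathrm{Id}:L_1(D,\varrho_D)\to L_1(D,\mu_D)\|<\infty$$ the norm of the embedding. Let $0<\delta<1$ and $m,n\in\mathbb{N}$, $m\ge2$, be such that $$N(m)\le\frac{n}{48(\sqrt2\log(2n)-\log\delta)}.$$ If the $n$ nodes of $\mathbf{X}=(\mathbf{x}^1,\dots,\mathbf{x}^n)$ are drawn i.i.d. according to $\varrho_D$, then $$\mathbb{P}\left(\sup_{\|f\|_{H(K)}\le1}\Big|\int_Df\,\mathrm{d}\mu_D-\mathrm{Q}^m_{\mathbf{X}}f\Big|^2\le\frac{29\,C_{\varrho,\mu}^2}{\delta}\max\Big\{\sigma_m^2,\frac{\log(8n)}{n}T(m)\Big\}\right)\ge1-3\delta.$$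
   Context: $\log$ is the natural logarithm. $H(K)$ is the Hilbert space with $f(\mathbf{x})=\langle f,K(\cdot,\mathbf{x})\rangle_{H(K)}$; its elements are assumed measurable so that the embedding $\mathrm{Id}:H(K)\to L_2(D,\varrho_D)$ is defined (it is compact under the assumptions). Standing assumption: $H(K)$ is infinite dimensional. $\lambda_1\ge\lambda_2\ge\dots>0$ denote the positive eigenvalues of $\mathrm{Id}^*\circ\mathrm{Id}:H(K)\to H(K)$ (an infinite sequence, as in the paper's notation), $(e_k)_{k\in\mathbb{N}}$ the corresponding eigenfunctions, orthonormal in $H(K)$, and $\sigma_k:=\sqrt{\lambda_k}$. Put $\eta_k:=\lambda_k^{-1/2}e_k$ (orthonormal in $L_2(D,\varrho_D)$), $N(m):=\sup_{\mathbf{x}\in D}\sum_{k=1}^{m-1}|\eta_k(\mathbf{x})|^2$ and $T(m):=\sup_{\mathbf{x}\in D}\sum_{k=m}^\infty|e_k(\mathbf{x})|^2$. Cubature rule: for nodes $\mathbf{X}$ let $\mathbf{L}_m:=(\eta_k(\mathbf{x}^j))_{j=1,\dots,n;\,k=1,\dots,m-1}\in\mathbb{C}^{n\times(m-1)}$. If $\mathbf{L}_m$ has full column rank, put $\boldsymbol{b}:=(\int_D\eta_k\,\mathrm{d}\mu_D)_{k=1}^{m-1}$, $\boldsymbol{q}:=\overline{\mathbf{L}_m}\,\overline{(\mathbf{L}_m^*\mathbf{L}_m)^{-1}}\,\boldsymbol{b}\in\mathbb{C}^n$ and $\mathrm{Q}^m_{\mathbf{X}}f:=\sum_{j=1}^nq_jf(\mathbf{x}^j)$.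 The event in the probability is understood to include that $\mathbf{L}_m$ has full column rank. *)

theory Defs
  imports
    "HOL-Probability.Probability"
    "HOL-Library.Function_Algebras"
    "Jordan_Normal_Form.DL_Rank"
    "Jordan_Normal_Form.Gauss_Jordan_Elimination"
    "Jordan_Normal_Form.Schur_Decomposition"
begin

text \<open>
  Spaces of complex-valued functions on \<open>D\<close> are sets of functions on the ambient type that vanish
  outside \<open>D\<close>, with pointwise vector space operations. Inner products are linear in the first
  argument.
\<close>

definition cscale :: "complex \<Rightarrow> ('a \<Rightarrow> complex) \<Rightarrow> 'a \<Rightarrow> complex" where
  "cscale c f = (\<lambda>x. c * f x)"

global_interpretation cfun: vector_space "cscale :: complex \<Rightarrow> ('a \<Rightarrow> complex) \<Rightarrow> 'a \<Rightarrow> complex"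
  by unfold_locales (auto simp: cscale_def fun_eq_iff algebra_simps)

definition hnorm :: "(('a \<Rightarrow> complex) \<Rightarrow> ('a \<Rightarrow> complex) \<Rightarrow> complex) \<Rightarrow> ('a \<Rightarrow> complex) \<Rightarrow> real" where
  "hnorm ip f = sqrt (Re (ip f f))"

locale function_hilbert_space =
  fixes H :: "('a \<Rightarrow> complex) set"
    and ip :: "('a \<Rightarrow> complex) \<Rightarrow> ('a \<Rightarrow> complex) \<Rightarrow> complex"
  assumes subspace_H: "cfun.subspace H"
    and ip_add_left: "\<lbrakk>f \<in> H; g \<in> H; h \<in> H\<rbrakk> \<Longrightarrow> ip (f + g) h = ip f h + ip g h"
    and ip_scale_left: "\<lbrakk>f \<in> H; g \<in> H\<rbrakk> \<Longrightarrow> ip (cscale c f) g = c * ip f g"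
    and ip_commute: "\<lbrakk>f \<in> H; g \<in> H\<rbrakk> \<Longrightarrow> ip g f = cnj (ip f g)"
    and ip_nonneg: "f \<in> H \<Longrightarrow> 0 \<le> Re (ip f f)"
    and ip_eq_zero: "\<lbrakk>f \<in> H; ip f f = 0\<rbrakk> \<Longrightarrow> f = 0"
    and complete_H:
      "\<lbrakk>\<And>i. u i \<in> H; \<And>\<epsilon>. \<epsilon> > 0 \<Longrightarrow> \<exists>N. \<forall>p\<ge>N. \<forall>q\<ge>N. hnorm ip (u p - u q) < \<epsilon>\<rbrakk>
        \<Longrightarrow> \<exists>f\<in>H. (\<lambda>i. hnorm ip (u i - f)) \<longlonglongrightarrow> 0"

locale rkhs = function_hilbert_space H ip
  for D :: "'a set"
    and K :: "'a \<Rightarrow> 'a \<Rightarrow> complex"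
    and H :: "('a \<Rightarrow> complex) set"
    and ip :: "('a \<Rightarrow> complex) \<Rightarrow> ('a \<Rightarrow> complex) \<Rightarrow> complex" +
  assumes zero_outside: "\<lbrakk>f \<in> H; x \<notin> D\<rbrakk> \<Longrightarrow> f x = 0"
    and kernel_mem: "x \<in> D \<Longrightarrow> (\<lambda>y. if y \<in> D then K y x else 0) \<in> H"
    and reproducing:
      "\<lbrakk>f \<in> H; x \<in> D\<rbrakk> \<Longrightarrow> f x = ip f (\<lambda>y. if y \<in> D then K y x else 0)"

definition psd_kernel :: "'a set \<Rightarrow> ('a \<Rightarrow> 'a \<Rightarrow> complex) \<Rightarrow> bool" where
  "psd_kernel D K \<longleftrightarrow>
    (\<forall>x\<in>D. \<forall>y\<in>D. K y x = cnj (K x y)) \<and>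
    (\<forall>A c. finite A \<and> A \<subseteq> D \<longrightarrow> 0 \<le> Re (\<Sum>x\<in>A. \<Sum>y\<in>A. c x * cnj (c y) * K x y))"

definition hseparable ::
  "('a \<Rightarrow> complex) set \<Rightarrow> (('a \<Rightarrow> complex) \<Rightarrow> ('a \<Rightarrow> complex) \<Rightarrow> complex) \<Rightarrow> bool" where
  "hseparable H ip \<longleftrightarrow>
    (\<exists>S. countable S \<and> S \<subseteq> H \<and> (\<forall>f\<in>H. \<forall>\<epsilon>>0. \<exists>g\<in>S. hnorm ip (f - g) < \<epsilon>))"

definition infinite_dimensional :: "('a \<Rightarrow> complex) set \<Rightarrow> bool" where
  "infinite_dimensional H \<longleftrightarrow> \<not> (\<exists>B. finite B \<and> B \<subseteq> H \<and> H \<subseteq> cfun.span B)"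

definition L2_inner :: "'a measure \<Rightarrow> ('a \<Rightarrow> complex) \<Rightarrow> ('a \<Rightarrow> complex) \<Rightarrow> complex" where
  "L2_inner \<rho> f g = (\<integral>x. f x * cnj (g x) \<partial>\<rho>)"

text \<open>
  The adjoint of \<open>Id : H \<rightarrow> L\<^sub>2(\<rho>)\<close>, on representatives: the Riesz representer in \<open>H\<close> of
  the functional \<open>f \<mapsto> \<langle>f, g\<rangle>\<close> on \<open>L\<^sub>2(\<rho>)\<close>.
\<close>

definition Id_adjoint :: "'a measure \<Rightarrow> ('a \<Rightarrow> complex) set \<Rightarrow>
    (('a \<Rightarrow> complex) \<Rightarrow> ('a \<Rightarrow> complex) \<Rightarrow> complex) \<Rightarrow> ('a \<Rightarrow> complex) \<Rightarrow> 'a \<Rightarrow> complex" where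
  "Id_adjoint \<rho> H ip g = (THE h. h \<in> H \<and> (\<forall>f\<in>H. ip f h = L2_inner \<rho> f g))"

text \<open>
  \<open>lam 1 \<ge> lam 2 \<ge> \<dots> > 0\<close> lists all positive eigenvalues of \<open>Id\<^sup>* \<circ> Id\<close> with their
  multiplicities, and \<open>e 1, e 2, \<dots>\<close> are corresponding eigenfunctions, orthonormal in \<open>H\<close>; index
  \<open>0\<close> is unused. The last conjunct says that nothing is missing: each eigenspace for a positive
  eigenvalue \<open>t\<close> (finite-dimensional, by compactness) is spanned by the \<open>e k\<close> with \<open>lam k = t\<close>.
\<close>

definition eigensystem :: "'a measure \<Rightarrow> ('a \<Rightarrow> complex) set \<Rightarrow>
    (('a \<Rightarrow> complex) \<Rightarrow> ('a \<Rightarrow> complex) \<Rightarrow> complex) \<Rightarrow>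
    (nat \<Rightarrow> real) \<Rightarrow> (nat \<Rightarrow> 'a \<Rightarrow> complex) \<Rightarrow> bool" where
  "eigensystem \<rho> H ip lam e \<longleftrightarrow>
    (\<forall>k\<ge>1. 0 < lam k \<and> lam (Suc k) \<le> lam k) \<and>
    (\<forall>k\<ge>1. e k \<in> H \<and> Id_adjoint \<rho> H ip (e k) = cscale (of_real (lam k)) (e k)) \<and>
    (\<forall>j\<ge>1. \<forall>k\<ge>1. ip (e j) (e k) = (if j = k then 1 else 0)) \<and>
    (\<forall>t>0. \<forall>f\<in>H. Id_adjoint \<rho> H ip f = cscale (of_real t) f \<longrightarrow>
      f \<in> cfun.span {e k |k. k \<ge> 1 \<and> lam k = t})"

definition eta :: "(nat \<Rightarrow> real) \<Rightarrow> (nat \<Rightarrow> 'a \<Rightarrow> complex) \<Rightarrow> nat \<Rightarrow> 'a \<Rightarrow> complex" where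
  "eta lam e k x = of_real (lam k powr (-1/2)) * e k x"

definition spectral_N ::
  "'a set \<Rightarrow> (nat \<Rightarrow> real) \<Rightarrow> (nat \<Rightarrow> 'a \<Rightarrow> complex) \<Rightarrow> nat \<Rightarrow> real" where
  "spectral_N D lam e m = (SUP x\<in>D. \<Sum>k=1..m-1. (cmod (eta lam e k x))\<^sup>2)"

definition spectral_T :: "'a set \<Rightarrow> (nat \<Rightarrow> 'a \<Rightarrow> complex) \<Rightarrow> nat \<Rightarrow> real" where
  "spectral_T D e m = (SUP x\<in>D. \<Sum>\<^sub>\<infinity>k\<in>{m..}. (cmod (e k x))\<^sup>2)"

text \<open>
  That the embedding is well defined on classes modulo null sets is part of the norm bound.
\<close>

definition L1_embeds :: "'a measure \<Rightarrow> 'a measure \<Rightarrow> bool" where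
  "L1_embeds \<rho> \<mu> \<longleftrightarrow>
    (\<forall>f :: 'a \<Rightarrow> complex. integrable \<rho> f \<longrightarrow> integrable \<mu> f) \<and>
    (\<exists>C. \<forall>f :: 'a \<Rightarrow> complex. integrable \<rho> f \<longrightarrow>
      (\<integral>x. cmod (f x) \<partial>\<mu>) \<le> C * (\<integral>x. cmod (f x) \<partial>\<rho>))"

definition L1_embedding_norm :: "'a measure \<Rightarrow> 'a measure \<Rightarrow> real" where
  "L1_embedding_norm \<rho> \<mu> =
    (SUP f \<in> {f :: 'a \<Rightarrow> complex. integrable \<rho> f \<and> (\<integral>x. cmod (f x) \<partial>\<rho>) \<le> 1}.
      \<integral>x. cmod (f x) \<partial>\<mu>)"

text \<open>
  Matrix and vector entries are indexed from \<open>0\<close>, so column \<open>k\<close> belongs to \<open>\<eta>\<close> with index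
  \<open>k + 1\<close>; the nodes are \<open>X 0, \<dots>, X (n - 1)\<close>.
\<close>

definition L_mat :: "(nat \<Rightarrow> real) \<Rightarrow> (nat \<Rightarrow> 'a \<Rightarrow> complex) \<Rightarrow> nat \<Rightarrow> nat \<Rightarrow> (nat \<Rightarrow> 'a) \<Rightarrow>
    complex Matrix.mat" where
  "L_mat lam e m n X = Matrix.mat n (m - 1) (\<lambda>(j, k). eta lam e (k + 1) (X j))"

definition full_column_rank :: "complex Matrix.mat \<Rightarrow> bool" where
  "full_column_rank A \<longleftrightarrow> vec_space.rank (dim_row A) A = dim_col A"

definition cubature_weights :: "'a measure \<Rightarrow> (nat \<Rightarrow> real) \<Rightarrow> (nat \<Rightarrow> 'a \<Rightarrow> complex) \<Rightarrow>
    nat \<Rightarrow> nat \<Rightarrow> (nat \<Rightarrow> 'a) \<Rightarrow> complex Matrix.vec" where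
  "cubature_weights \<mu> lam e m n X =
    (let L = L_mat lam e m n X;
         b = Matrix.vec (m - 1) (\<lambda>k. \<integral>x. eta lam e (k + 1) x \<partial>\<mu>)
     in (map_mat cnj L * map_mat cnj (the (mat_inverse (mat_adjoint L * L)))) *\<^sub>v b)"

definition cubature :: "'a measure \<Rightarrow> (nat \<Rightarrow> real) \<Rightarrow> (nat \<Rightarrow> 'a \<Rightarrow> complex) \<Rightarrow>
    nat \<Rightarrow> nat \<Rightarrow> (nat \<Rightarrow> 'a) \<Rightarrow> ('a \<Rightarrow> complex) \<Rightarrow> complex" where
  "cubature \<mu> lam e m n X f =
    (\<Sum>j<n. Matrix.vec_index (cubature_weights \<mu> lam e m n X) j * f (X j))"

definition worst_case_sq_error :: "('a \<Rightarrow> complex) set \<Rightarrow>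
    (('a \<Rightarrow> complex) \<Rightarrow> ('a \<Rightarrow> complex) \<Rightarrow> complex) \<Rightarrow> 'a measure \<Rightarrow>
    (('a \<Rightarrow> complex) \<Rightarrow> complex) \<Rightarrow> real" where
  "worst_case_sq_error H ip \<mu> Q =
    (SUP f \<in> {f \<in> H. hnorm ip f \<le> 1}. (cmod ((\<integral>x. f x \<partial>\<mu>) - Q f))\<^sup>2)"

end

theory Submission
  imports Defs "HOL-Library.Diagonal_Subsequence"
begin

text \<open>
  Why the theorem holds. The cubature rule is the \<open>\<mu>\<close>-integral of the least squares fit \<open>g\<close> of
  \<open>f\<close> in the span of \<open>\<eta>\<^sub>1, \<dots>, \<eta>\<^bsub>m-1\<^esub>\<close> (\<open>cubature_least_squares\<close>). Hence the squared error is at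
  most \<open>C\<^sup>2\<close> times the squared \<open>L\<^sub>2(\<rho>)\<close> norm of \<open>f - g\<close>. Let \<open>f2\<close> be the part of \<open>f\<close> orthogonal
  to \<open>e\<^sub>1, \<dots>, e\<^bsub>m-1\<^esub>\<close>. The fit reproduces the other part, so \<open>f - g\<close> is \<open>f2\<close> minus the fit of
  \<open>f2\<close>, and these two are orthogonal in \<open>L\<^sub>2(\<rho>)\<close>. The first contributes at most \<open>lam m\<close>. The second
  contributes at most \<open>2/n \<Sum> \<bar>f2 (X j)\<bar>\<^sup>2\<close> as soon as the Gram matrix of the \<open>\<eta>\<^sub>k\<close> at the nodes is
  bounded below by \<open>n/2\<close>. This deterministic part is \<open>cubature_error\<close>.

  Probability enters through two tail bounds for sums \<open>S\<close> of independent random positive operators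
  of rank one: the Gram matrix is bounded below (\<open>lower_tail\<close>), and the node values of \<open>f2\<close> are
  bounded above by \<open>14 n M / \<delta>\<close>, where \<open>M\<close> is the maximum in the theorem (\<open>upper_tail\<close>).
  The potential is the trace of \<open>(c - S)\<^sup>p\<close> or of \<open>(c + S)\<^sup>p\<close>; telescoping
  expresses its change under a rank-one update \<open>A \<mapsto> A \<plusminus> v v\<^sup>*\<close> by the moments
  \<open>\<langle>A\<^sup>j v, v\<rangle>\<close>, and log-convexity of these moments in \<open>j\<close> compares every product that occurs with
  the single moment of order \<open>p - 1\<close> (\<open>op_trace_update_minus\<close>, \<open>op_trace_update_plus\<close>). The
  expectation of that moment is again a trace, so one more sample multiplies the conditional
  expectation of the potential by at most a fixed factor, and Markov's inequality finishes. In
  the upper tail the trace is taken relative to its value at \<open>S = 0\<close>; the bound then depends on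
  the second moment of the vector and not on the dimension, so the truncation of the eigenfunction
  expansion can be removed at the end (\<open>decreasing_sets_Inter\<close>).

  Two facts connect this with the Hilbert space. An \<open>f\<close> orthogonal to \<open>e\<^sub>1, \<dots>, e\<^bsub>m-1\<^esub>\<close> satisfies
  \<open>\<parallel>f\<parallel>\<^sup>2 \<le> lam m \<parallel>f\<parallel>\<^sub>H\<^sup>2\<close> in \<open>L\<^sub>2(\<rho>)\<close>, for otherwise compactness would produce an eigenfunction missing
  from the eigensystem (\<open>L2_sq_le_lam\<close>). And at almost every point the eigenfunction expansion
  represents all elements of \<open>H\<close> at once, by separability (\<open>AE_expansion\<close>).

  The event itself has to be measurable. The supremum over the unit ball is replaced by
  countably many conditions (\<open>worst_case_sq_error_le_iff\<close>), and the weights are rational functions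
  of the matrix entries.
\<close>

section \<open>Positive semidefinite sesquilinear forms\<close>

text \<open>
  One locale serves the inner product of \<open>H\<close>, the \<open>L\<^sub>2\<close> form on \<open>H\<close>, the forms \<open>\<langle>A u, v\<rangle>\<close> of
  positive operators, and the form \<open>t \<langle>f, g\<rangle> - \<langle>f, g\<rangle>\<^bsub>L2\<^esub>\<close> whose nonnegativity says that \<open>t\<close> bounds
  the Rayleigh quotient. In general only the first is definite.
\<close>

locale psd_form =
  fixes V :: "('a \<Rightarrow> complex) set" and q :: "('a \<Rightarrow> complex) \<Rightarrow> ('a \<Rightarrow> complex) \<Rightarrow> complex"
  assumes subspace_V: "cfun.subspace V"
    and add_left: "\<lbrakk>f \<in> V; g \<in> V; h \<in> V\<rbrakk> \<Longrightarrow> q (f + g) h = q f h + q g h"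
    and scale_left: "\<lbrakk>f \<in> V; g \<in> V\<rbrakk> \<Longrightarrow> q (cscale c f) g = c * q f g"
    and commute: "\<lbrakk>f \<in> V; g \<in> V\<rbrakk> \<Longrightarrow> q g f = cnj (q f g)"
    and nonneg: "f \<in> V \<Longrightarrow> 0 \<le> Re (q f f)"
begin

abbreviation sq :: "('a \<Rightarrow> complex) \<Rightarrow> real" where "sq f \<equiv> Re (q f f)"

lemma zero_mem [simp]: "0 \<in> V" by (rule cfun.subspace_0[OF subspace_V])
lemma add_mem [simp]: "f \<in> V \<Longrightarrow> g \<in> V \<Longrightarrow> f + g \<in> V" by (rule cfun.subspace_add[OF subspace_V])
lemma diff_mem [simp]: "f \<in> V \<Longrightarrow> g \<in> V \<Longrightarrow> f - g \<in> V" by (rule cfun.subspace_diff[OF subspace_V])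
lemma scale_mem [simp]: "f \<in> V \<Longrightarrow> cscale c f \<in> V" by (rule cfun.subspace_scale[OF subspace_V])
lemma sum_mem: "(\<And>i. i \<in> A \<Longrightarrow> f i \<in> V) \<Longrightarrow> sum f A \<in> V" by (rule cfun.subspace_sum[OF subspace_V])

lemma diff_eq: "f - g = f + cscale (- 1) (g :: 'a \<Rightarrow> complex)"
  by (rule ext) (simp add: cscale_def)

lemma add_right:
  assumes "f \<in> V" "g \<in> V" "h \<in> V"
  shows "q h (f + g) = q h f + q h g"
  unfolding commute[OF add_mem[OF assms(1,2)] assms(3)] add_left[OF assms]
    commute[OF assms(1,3)] commute[OF assms(2,3)]
  by simp

lemma scale_right:
  assumes "f \<in> V" "g \<in> V"
  shows "q g (cscale c f) = cnj c * q g f"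
  unfolding commute[OF scale_mem[OF assms(1)] assms(2)] scale_left[OF assms] commute[OF assms]
  by simp

lemma diff_left: "f \<in> V \<Longrightarrow> g \<in> V \<Longrightarrow> h \<in> V \<Longrightarrow> q (f - g) h = q f h - q g h"
  by (simp only: diff_eq add_left scale_left scale_mem) simp

lemma diff_right: "f \<in> V \<Longrightarrow> g \<in> V \<Longrightarrow> h \<in> V \<Longrightarrow> q h (f - g) = q h f - q h g"
  by (simp only: diff_eq add_right scale_right scale_mem) simp

lemma zero_left [simp]: "g \<in> V \<Longrightarrow> q 0 g = 0"
  using diff_left[of g g g] unfolding diff_self by simp

lemma zero_right [simp]: "g \<in> V \<Longrightarrow> q g 0 = 0"
  using diff_right[of g g g] unfolding diff_self by simp

lemma sum_left:
  assumes "\<And>i. i \<in> A \<Longrightarrow> f i \<in> V" "g \<in> V"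
  shows "q (sum f A) g = (\<Sum>i\<in>A. q (f i) g)"
  using assms(1)
proof (induction A rule: infinite_finite_induct)
  case (insert x A)
  have "q (f x + sum f A) g = q (f x) g + q (sum f A) g"
    using insert.prems assms(2) by (intro add_left sum_mem) auto
  moreover have "q (sum f A) g = (\<Sum>i\<in>A. q (f i) g)" using insert.prems by (intro insert.IH) simp
  ultimately show ?case by (simp only: sum.insert[OF insert.hyps(1,2)])
qed (use assms(2) in auto)

lemma real_form:
  assumes "f \<in> V"
  shows "q f f = of_real (sq f)"
proof -
  have "Im (q f f) = - Im (q f f)" using arg_cong[OF commute[OF assms assms], of Im] by (simp only: cnj.sel)
  then have "Im (q f f) = 0" by linarith
  then show ?thesis by (intro complex_eqI) simp_all
qed

lemma sq_line:
  assumes "f \<in> V" "g \<in> V"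
  shows "sq (f + cscale c g) = sq f + 2 * Re (cnj c * q f g) + (cmod c)\<^sup>2 * sq g"
proof -
  have "q (f + cscale c g) (f + cscale c g)
      = q f f + cnj c * q f g + c * q g f + (c * cnj c) * q g g"
  proof -
    note mem = assms scale_mem[OF assms(2)] add_mem[OF assms(1) scale_mem[OF assms(2)]]
    have "q (f + cscale c g) (f + cscale c g) = q f f + q f (cscale c g) + (q (cscale c g) f
        + q (cscale c g) (cscale c g))"
      by (simp only: add_left add_right mem add.assoc) simp
    then show ?thesis by (simp only: scale_left scale_right mem) (simp add: algebra_simps)
  qed
  moreover have "Re (c * q g f) = Re (cnj c * q f g)"
    unfolding commute[OF assms] by simp
  moreover have "Re (c * cnj c * q g g) = (cmod c)\<^sup>2 * sq g"
  proof -
    have "c * cnj c * q g g = of_real ((cmod c)\<^sup>2 * sq g)"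
      by (simp only: complex_norm_square[symmetric] of_real_mult real_form[OF assms(2), symmetric])
    then show ?thesis by (simp only: Re_complex_of_real)
  qed
  ultimately show ?thesis by simp
qed

lemma sq_scale: "f \<in> V \<Longrightarrow> sq (cscale c f) = (cmod c)\<^sup>2 * sq f"
  using sq_line[of 0 f c] by simp

lemma sq_diff_commute: "f \<in> V \<Longrightarrow> g \<in> V \<Longrightarrow> sq (f - g) = sq (g - f)"
  by (simp add: diff_left diff_right)

lemma parallelogram:
  "\<lbrakk>f \<in> V; g \<in> V\<rbrakk> \<Longrightarrow> sq (f + g) + sq (f - g) = 2 * sq f + 2 * sq g"
  by (simp add: diff_left diff_right add_left add_right)

lemma CS:
  assumes "f \<in> V" "g \<in> V"
  shows "(cmod (q f g))\<^sup>2 \<le> sq f * sq g"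
proof -
  define z where "z = q f g"
  have line: "0 \<le> sq f - 2 * s * (cmod z)\<^sup>2 + s\<^sup>2 * (cmod z)\<^sup>2 * sq g" for s :: real
  proof -
    have "0 \<le> sq (f + cscale (- of_real s * z) g)" using assms by (intro nonneg) simp
    also have "\<dots> = sq f - 2 * s * (cmod z)\<^sup>2 + s\<^sup>2 * (cmod z)\<^sup>2 * sq g"
    proof -
      have "Re (cnj (- of_real s * z) * q f g) = - s * Re (z * cnj z)"
        by (simp add: z_def algebra_simps)
      also have "z * cnj z = of_real ((cmod z)\<^sup>2)" by (rule complex_norm_square[symmetric])
      finally show ?thesis
        using sq_line[OF assms, of "- of_real s * z"]
        by (simp add: norm_mult power_mult_distrib del: of_real_power)
    qed
    finally show ?thesis .
  qed
  have "(cmod z)\<^sup>2 \<le> sq f * sq g"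
  proof (cases "sq g = 0")
    case True
    have "(cmod z)\<^sup>2 = 0"
    proof (rule ccontr)
      assume "(cmod z)\<^sup>2 \<noteq> 0"
      then show False
        using line[of "(sq f + 1) / (2 * (cmod z)\<^sup>2)"] True nonneg[OF assms(1)] by simp
    qed
    then show ?thesis using True by simp
  next
    case False
    then have "sq g > 0" using nonneg[OF assms(2)] by simp
    then show ?thesis using line[of "1 / sq g"] by (simp add: field_simps power2_eq_square)
  qed
  then show ?thesis by (simp add: z_def)
qed

lemma CS_sqrt: "f \<in> V \<Longrightarrow> g \<in> V \<Longrightarrow> cmod (q f g) \<le> sqrt (sq f) * sqrt (sq g)"
  using real_sqrt_le_mono[OF CS[of f g]] by (simp add: real_sqrt_mult)

lemma norm_triangle:
  assumes "f \<in> V" "g \<in> V"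
  shows "sqrt (sq (f + g)) \<le> sqrt (sq f) + sqrt (sq g)"
proof (rule real_le_lsqrt)
  have "Re (q f g) \<le> sqrt (sq f) * sqrt (sq g)"
    using CS_sqrt[OF assms] complex_Re_le_cmod[of "q f g"] by linarith
  moreover have "sq (f + g) = sq f + 2 * Re (q f g) + sq g"
    using sq_line[OF assms, of 1] by (simp add: cscale_def)
  ultimately show "sq (f + g) \<le> (sqrt (sq f) + sqrt (sq g))\<^sup>2"
    using nonneg[OF assms(1)] nonneg[OF assms(2)] by (simp add: power2_sum)
qed (use nonneg assms in auto)

lemma tendsto_left:
  assumes "\<And>i. u i \<in> V" "f \<in> V" "g \<in> V" "(\<lambda>i. sqrt (sq (u i - f))) \<longlonglongrightarrow> 0"
  shows "(\<lambda>i. q (u i) g) \<longlonglongrightarrow> q f g"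
proof (rule LIM_zero_cancel, rule Lim_null_comparison)
  show "\<forall>\<^sub>F i in sequentially. cmod (q (u i) g - q f g) \<le> sqrt (sq (u i - f)) * sqrt (sq g)"
    using CS_sqrt[of "u _ - f" g] assms by (intro always_eventually allI) (simp add: diff_left)
  show "(\<lambda>i. sqrt (sq (u i - f)) * sqrt (sq g)) \<longlonglongrightarrow> 0"
    using tendsto_mult_right[OF assms(4), of "sqrt (sq g)"] by simp
qed

lemma tendsto_sq:
  assumes "\<And>i. u i \<in> V" "f \<in> V" "(\<lambda>i. sqrt (sq (u i - f))) \<longlonglongrightarrow> 0"
  shows "(\<lambda>i. sq (u i)) \<longlonglongrightarrow> sq f"
proof -
  have "(\<lambda>i. sqrt (sq (u i)) - sqrt (sq f)) \<longlonglongrightarrow> 0"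
  proof (rule Lim_null_comparison[OF always_eventually assms(3)], rule allI)
    fix i
    have "sqrt (sq (u i)) \<le> sqrt (sq (u i - f)) + sqrt (sq f)"
      using norm_triangle[OF diff_mem[OF assms(1)[of i] assms(2)] assms(2)] by (simp only: diff_add_cancel)
    moreover have "sqrt (sq f) \<le> sqrt (sq (u i - f)) + sqrt (sq (u i))"
      using norm_triangle[OF diff_mem[OF assms(2) assms(1)[of i]] assms(1)[of i]]
      by (simp only: diff_add_cancel sq_diff_commute[OF assms(2) assms(1)[of i]])
    ultimately show "norm (sqrt (sq (u i)) - sqrt (sq f)) \<le> sqrt (sq (u i - f))"
      unfolding real_norm_def by linarith
  qed
  then have "(\<lambda>i. (sqrt (sq (u i)))\<^sup>2) \<longlonglongrightarrow> (sqrt (sq f))\<^sup>2"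
    by (rule tendsto_power[OF LIM_zero_cancel])
  then show ?thesis using nonneg assms by simp
qed

end

section \<open>Log-convex sequences\<close>

locale log_convex_seq =
  fixes a :: "nat \<Rightarrow> real"
  assumes nonneg: "0 \<le> a j"
    and log_convex: "(a (Suc j))\<^sup>2 \<le> a j * a (Suc (Suc j))"
begin

lemma ratio_mono: "i \<le> j \<Longrightarrow> a (Suc i) * a j \<le> a i * a (Suc j)"
proof (induction j rule: dec_induct)
  case base
  then show ?case by simp
next
  case (step j)
  show ?case
  proof (cases "a (Suc j) = 0")
    case True
    then show ?thesis using nonneg by simp
  next
    case False
    then have pos: "a (Suc j) > 0" using nonneg[of "Suc j"] by simp
    have "a (Suc i) * a (Suc j) * a (Suc j) = a (Suc i) * (a (Suc j))\<^sup>2"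
      by (simp add: power2_eq_square)
    also have "\<dots> \<le> a (Suc i) * (a j * a (Suc (Suc j)))"
      by (intro mult_left_mono log_convex nonneg)
    also have "\<dots> = (a (Suc i) * a j) * a (Suc (Suc j))" by simp
    also have "\<dots> \<le> (a i * a (Suc j)) * a (Suc (Suc j))"
      by (intro mult_right_mono step.IH nonneg)
    finally have "a (Suc i) * a (Suc j) * a (Suc j) \<le> a i * a (Suc (Suc j)) * a (Suc j)"
      by (simp add: mult_ac)
    then show ?thesis using pos by simp
  qed
qed

text \<open>
  This is Chebyshev's association inequality for the spectral measure when \<open>a j\<close> are the moments
  \<open>\<langle>A\<^sup>j v, v\<rangle>\<close>. Here it is derived from log-convexity of the moments.
\<close>

lemma mult_le: "a i * a j \<le> a 0 * a (i + j)"
proof -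
  have *: "i \<le> j \<Longrightarrow> a i * a j \<le> a 0 * a (i + j)" for i j
  proof (induction i arbitrary: j)
    case 0
    then show ?case by simp
  next
    case (Suc i)
    have "a (Suc i) * a j \<le> a i * a (Suc j)" using ratio_mono[of i j] Suc by simp
    also have "\<dots> \<le> a 0 * a (i + Suc j)" using Suc.prems by (intro Suc.IH) simp
    finally show ?case by simp
  qed
  show ?thesis using *[of i j] *[of j i] by (cases "i \<le> j") (simp_all add: mult.commute add.commute)
qed

lemma growth_step:
  assumes "0 \<le> c" "c * a 0 \<le> a 1"
  shows "c * a j \<le> a (Suc j)"
proof (cases "a 0 = 0")
  case True
  have "a j * a j \<le> 0" using mult_le[of j j] True by simp
  then have "a j = 0" by (metis mult_eq_0_iff antisym zero_le_square)
  then show ?thesis using nonneg by simp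
next
  case False
  then have pos: "a 0 > 0" using nonneg[of 0] by simp
  have "a 0 * (c * a j) \<le> a 1 * a j"
    using mult_right_mono[OF assms(2) nonneg[of j]] by (simp add: mult_ac)
  also have "\<dots> \<le> a 0 * a (Suc j)" using mult_le[of 1 j] by simp
  finally show ?thesis using pos by simp
qed

lemma growth_power:
  assumes "0 \<le> c" "c * a 0 \<le> a 1"
  shows "c ^ p * a 0 \<le> a p"
proof (induction p)
  case 0
  then show ?case by simp
next
  case (Suc p)
  have "c ^ Suc p * a 0 = c * (c ^ p * a 0)" by simp
  also have "\<dots> \<le> c * a p" using Suc assms by (intro mult_left_mono)
  also have "\<dots> \<le> a (Suc p)" by (rule growth_step[OF assms])
  finally show ?case .
qed

end

section \<open>Symmetric operators on a finite-dimensional space\<close>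

definition cip :: "'i set \<Rightarrow> ('i \<Rightarrow> complex) \<Rightarrow> ('i \<Rightarrow> complex) \<Rightarrow> complex" where
  "cip I u v = (\<Sum>i\<in>I. u i * cnj (v i))"

definition sqn :: "'i set \<Rightarrow> ('i \<Rightarrow> complex) \<Rightarrow> real" where
  "sqn I u = (\<Sum>i\<in>I. (cmod (u i))\<^sup>2)"

definition basis_vec :: "'i \<Rightarrow> 'i \<Rightarrow> complex" where
  "basis_vec i = (\<lambda>j. if j = i then 1 else 0)"

text \<open>
  Operators are plain functions; linearity on the coordinates in \<open>I\<close> is a consequence of symmetry,
  since \<open>A u i = \<langle>u, A (basis_vec i)\<rangle>\<close>.
\<close>

definition sym_op :: "'i set \<Rightarrow> (('i \<Rightarrow> complex) \<Rightarrow> ('i \<Rightarrow> complex)) \<Rightarrow> bool" where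
  "sym_op I A \<longleftrightarrow> finite I \<and> (\<forall>u v. cip I (A u) v = cip I u (A v))"

definition qform :: "'i set \<Rightarrow> (('i \<Rightarrow> complex) \<Rightarrow> ('i \<Rightarrow> complex)) \<Rightarrow> ('i \<Rightarrow> complex) \<Rightarrow> real" where
  "qform I A u = Re (cip I (A u) u)"

definition op_trace :: "'i set \<Rightarrow> (('i \<Rightarrow> complex) \<Rightarrow> ('i \<Rightarrow> complex)) \<Rightarrow> real" where
  "op_trace I A = (\<Sum>i\<in>I. qform I A (basis_vec i))"

definition rank_one_update :: "'i set \<Rightarrow> real \<Rightarrow> ('i \<Rightarrow> complex) \<Rightarrow>
    (('i \<Rightarrow> complex) \<Rightarrow> ('i \<Rightarrow> complex)) \<Rightarrow> ('i \<Rightarrow> complex) \<Rightarrow> ('i \<Rightarrow> complex)" where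
  "rank_one_update I s v A u = (\<lambda>i. A u i + of_real s * cip I u v * v i)"

lemma mult_cnj_self: "z * cnj z = of_real ((cmod z)\<^sup>2)"
  by (rule complex_norm_square[symmetric])

lemma cip_cnj: "cip I v u = cnj (cip I u v)"
  by (simp add: cip_def mult.commute)

lemma cip_add_left: "cip I (\<lambda>i. u i + w i) v = cip I u v + cip I w v"
  by (simp add: cip_def sum.distrib algebra_simps)

lemma cip_add_right: "cip I v (\<lambda>i. u i + w i) = cip I v u + cip I v w"
  by (simp add: cip_def sum.distrib algebra_simps)

lemma cip_scale_left: "cip I (\<lambda>i. c * u i) v = c * cip I u v"
  by (simp add: cip_def sum_distrib_left algebra_simps)

lemma cip_scale_right: "cip I v (\<lambda>i. c * u i) = cnj c * cip I v u"
  by (simp add: cip_def sum_distrib_left algebra_simps)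

lemma cip_scale_right': "cip I v (\<lambda>i. c * u * w i) = cnj (c * u) * cip I v w"
  using cip_scale_right[of I v "c * u" w] by simp

lemma cip_self: "cip I u u = of_real (sqn I u)"
  by (simp add: cip_def sqn_def mult_cnj_self del: of_real_power)

lemma sqn_nonneg: "0 \<le> sqn I u"
  by (simp add: sqn_def sum_nonneg)

lemma cip_basis_vec: "finite I \<Longrightarrow> i \<in> I \<Longrightarrow> cip I u (basis_vec i) = u i"
  by (simp add: cip_def basis_vec_def if_distrib sum.delta cong: if_cong)

lemma sym_opD: "sym_op I A \<Longrightarrow> cip I (A u) v = cip I u (A v)"
  by (simp add: sym_op_def)

lemma sym_op_finite: "sym_op I A \<Longrightarrow> finite I"
  by (simp add: sym_op_def)

lemma sym_op_real: "sym_op I A \<Longrightarrow> cip I (A u) u = of_real (qform I A u)"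
  using cip_cnj[of I "A u" u] sym_opD[of I A u u] by (simp add: qform_def complex_eq_iff)

lemma sym_op_funpow: "sym_op I A \<Longrightarrow> sym_op I (A ^^ j)"
  unfolding sym_op_def by (induction j) (auto simp: funpow_swap1)

lemma sym_op_rank_one_update: "sym_op I A \<Longrightarrow> sym_op I (rank_one_update I s v A)"
  unfolding sym_op_def rank_one_update_def
  by (auto simp: cip_add_left cip_add_right cip_scale_left cip_scale_right' cip_cnj[of I v])

lemma qform_rank_one_update:
  "qform I (rank_one_update I s v A) u = qform I A u + s * (cmod (cip I u v))\<^sup>2"
  by (simp add: qform_def rank_one_update_def cip_add_left cip_scale_left cip_cnj[of I v u]
      mult.assoc mult_cnj_self del: of_real_power flip: of_real_mult)

lemma cip_funpow_funpow:
  assumes "sym_op I A"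
  shows "cip I ((A ^^ i) u) ((A ^^ j) v) = cip I ((A ^^ (i + j)) u) v"
  using sym_opD[OF sym_op_funpow[OF assms, of j], of "(A ^^ i) u" v]
  by (simp add: funpow_add add.commute[of i])

lemma psd_form_qform:
  assumes A: "sym_op I A" "\<And>u. 0 \<le> qform I A u"
  shows "psd_form UNIV (\<lambda>u. cip I (A u))"
proof
  show "cfun.subspace UNIV" by (rule cfun.subspace_UNIV)
  show "cip I (A (f + g)) h = cip I (A f) h + cip I (A g) h" for f g h
    unfolding sym_opD[OF A(1)] by (simp add: cip_def distrib_right sum.distrib)
  show "cip I (A (cscale c f)) g = c * cip I (A f) g" for c f g
    unfolding sym_opD[OF A(1)] by (simp add: cip_def cscale_def sum_distrib_left mult.assoc)
  show "cip I (A g) f = cnj (cip I (A f) g)" for f g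
    unfolding sym_opD[OF A(1), of g f] by (rule cip_cnj)
  show "0 \<le> Re (cip I (A f) f)" for f using A(2)[of f] by (simp add: qform_def)
qed

lemma qform_CS:
  assumes "sym_op I A" "\<And>u. 0 \<le> qform I A u"
  shows "(cmod (cip I (A u) v))\<^sup>2 \<le> qform I A u * qform I A v"
  unfolding qform_def by (rule psd_form.CS[OF psd_form_qform[OF assms]]) auto

text \<open>
  Expand \<open>u\<close> in basis vectors and apply the Cauchy-Schwarz inequality of the form to each term.
\<close>

lemma qform_le_trace:
  assumes A: "sym_op I A" "\<And>u. 0 \<le> qform I A u"
  shows "qform I A u \<le> op_trace I A * sqn I u"
proof (cases "qform I A u = 0")
  case True
  have "0 \<le> op_trace I A" unfolding op_trace_def by (intro sum_nonneg A)
  then show ?thesis using True sqn_nonneg[of I u] by simp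
next
  case False
  then have pos: "qform I A u > 0" using A(2)[of u] by simp
  have fin: "finite I" by (rule sym_op_finite[OF A(1)])
  have "qform I A u = cmod (cip I u (A u))"
    using pos by (simp only: sym_opD[OF A(1), of u u, symmetric] sym_op_real[OF A(1)] norm_of_real)
  also have "\<dots> = cmod (\<Sum>i\<in>I. u i * cip I (A (basis_vec i)) u)"
  proof -
    have "cnj (A u i) = cip I (A (basis_vec i)) u" if "i \<in> I" for i
      using cip_basis_vec[OF fin that, of "A u"] cip_cnj[of I "basis_vec i" "A u"]
        sym_opD[OF A(1), of "basis_vec i" u] by simp
    then show ?thesis by (simp add: cip_def[of I u "A u"])
  qed
  also have "\<dots> \<le> (\<Sum>i\<in>I. cmod (u i) * cmod (cip I (A (basis_vec i)) u))"
    by (rule order_trans[OF norm_sum]) (simp add: norm_mult)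
  finally have "(qform I A u)\<^sup>2 \<le> (\<Sum>i\<in>I. cmod (u i) * cmod (cip I (A (basis_vec i)) u))\<^sup>2"
    using pos by (intro power_mono) auto
  also have "\<dots> \<le> (\<Sum>i\<in>I. (cmod (u i))\<^sup>2) * (\<Sum>i\<in>I. (cmod (cip I (A (basis_vec i)) u))\<^sup>2)"
    by (rule Cauchy_Schwarz_ineq_sum)
  also have "\<dots> \<le> sqn I u * (\<Sum>i\<in>I. qform I A (basis_vec i) * qform I A u)"
    unfolding sqn_def by (intro mult_left_mono sum_mono qform_CS[OF A] sum_nonneg) auto
  also have "\<dots> = op_trace I A * sqn I u * qform I A u"
    by (simp add: op_trace_def sum_distrib_right sum_distrib_left mult_ac)
  finally show ?thesis using pos by (simp add: power2_eq_square)
qed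

text \<open>
  Powers of a positive operator are positive because an even power is a square and an odd power is
  \<open>A\<close> between two equal powers. Log-convexity is Cauchy-Schwarz for the form of \<open>A\<^sup>j\<close> at \<open>v\<close> and \<open>A v\<close>.
\<close>

lemma qform_funpow_log_convex:
  assumes A: "sym_op I A" "\<And>u. 0 \<le> qform I A u"
  shows "log_convex_seq (\<lambda>j. qform I (A ^^ j) u)"
proof
  have nn: "0 \<le> qform I (A ^^ j) u" for j u
  proof (cases "even j")
    case True
    then obtain l where l: "j = l + l" by (metis evenE mult_2)
    have "cip I ((A ^^ j) u) u = of_real (sqn I ((A ^^ l) u))"
      using cip_funpow_funpow[OF A(1), of l u l u] by (simp add: l cip_self)
    then show ?thesis by (simp add: qform_def sqn_nonneg)
  next
    case False
    then obtain l where l: "j = Suc l + l" by (metis oddE mult_2 Suc_eq_plus1 add_Suc)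
    have "cip I ((A ^^ j) u) u = cip I (A ((A ^^ l) u)) ((A ^^ l) u)"
      using cip_funpow_funpow[OF A(1), of "Suc l" u l u] by (simp add: l)
    then show ?thesis using A(2)[of "(A ^^ l) u"] by (simp add: qform_def)
  qed
  show "0 \<le> qform I (A ^^ j) u" for j by (rule nn)
  show "(qform I (A ^^ Suc j) u)\<^sup>2 \<le> qform I (A ^^ j) u * qform I (A ^^ Suc (Suc j)) u" for j
  proof -
    have 1: "cip I ((A ^^ j) u) (A u) = of_real (qform I (A ^^ Suc j) u)"
      using cip_funpow_funpow[OF A(1), of j u 1 u] sym_op_real[OF sym_op_funpow[OF A(1)], of "Suc j" u]
      by simp
    have 2: "qform I (A ^^ j) (A u) = qform I (A ^^ Suc (Suc j)) u"
      using cip_funpow_funpow[OF A(1), of "Suc j" u 1 u] by (simp add: qform_def funpow_swap1)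
    show ?thesis
      using qform_CS[OF sym_op_funpow[OF A(1), of j] nn, of u "A u"] unfolding 1 2
      by (simp only: norm_of_real power2_abs)
  qed
qed

section \<open>Rank-one updates and traces of powers\<close>

text \<open>
  Moving one factor \<open>B = A + s v v\<^sup>*\<close> across the inner product replaces it by \<open>A\<close> at the price of the
  product \<open>s \<langle>B\<^sup>i v, v\<rangle> \<langle>v, A\<^sup>j v\<rangle>\<close>. Iterating reduces mixed moments to pure ones.
\<close>

lemma cip_update_funpow:
  assumes A: "sym_op I A" and B: "B = rank_one_update I s v A"
  shows "cip I ((B ^^ i) v) ((A ^^ j) v)
    = of_real (qform I (A ^^ (i + j)) v
        + s * (\<Sum>l<i. qform I (B ^^ l) v * qform I (A ^^ (i + j - 1 - l)) v))"
proof (induction i arbitrary: j)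
  case 0
  show ?case
    using sym_op_real[OF sym_op_funpow[OF A], of j v] sym_opD[OF sym_op_funpow[OF A, of j], of v v]
    by simp
next
  case (Suc i)
  have sB: "sym_op I B" unfolding B by (rule sym_op_rank_one_update[OF A])
  have "cip I ((B ^^ Suc i) v) ((A ^^ j) v)
      = cip I (A ((B ^^ i) v)) ((A ^^ j) v) + s * cip I ((B ^^ i) v) v * cip I v ((A ^^ j) v)"
    by (simp add: B rank_one_update_def cip_add_left cip_scale_left)
  also have "cip I (A ((B ^^ i) v)) ((A ^^ j) v) = cip I ((B ^^ i) v) ((A ^^ Suc j) v)"
    by (simp add: sym_opD[OF A])
  also have "cip I v ((A ^^ j) v) = of_real (qform I (A ^^ j) v)"
    using sym_op_real[OF sym_op_funpow[OF A], of j v] sym_opD[OF sym_op_funpow[OF A, of j], of v v]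
    by simp
  also have "cip I ((B ^^ i) v) v = of_real (qform I (B ^^ i) v)"
    by (rule sym_op_real[OF sym_op_funpow[OF sB]])
  finally show ?case
    by (simp only: Suc.IH[of "Suc j"]) (simp add: algebra_simps del: funpow.simps)
qed

text \<open>
  Telescoping \<open>B\<^sup>p - A\<^sup>p\<close> into the terms \<open>B\<^sup>i (B - A) A\<^bsup>p-1-i\<^esup>\<close>, each of which has rank one.
\<close>

lemma op_trace_update_funpow:
  assumes A: "sym_op I A" and B: "B = rank_one_update I s v A"
  shows "op_trace I (B ^^ p) - op_trace I (A ^^ p)
    = s * (\<Sum>i<p. Re (cip I ((B ^^ i) v) ((A ^^ (p - 1 - i)) v)))"
proof -
  have fin: "finite I" by (rule sym_op_finite[OF A])
  have sB: "sym_op I B" unfolding B by (rule sym_op_rank_one_update[OF A])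
  have step: "op_trace I ((B ^^ Suc i) \<circ> (A ^^ j)) - op_trace I ((B ^^ i) \<circ> (A ^^ Suc j))
      = s * Re (cip I ((B ^^ i) v) ((A ^^ j) v))" for i j
  proof -
    have term1: "cip I ((B ^^ Suc i) ((A ^^ j) (basis_vec k))) (basis_vec k)
        - cip I ((B ^^ i) ((A ^^ Suc j) (basis_vec k))) (basis_vec k)
        = s * ((B ^^ i) v k * cnj ((A ^^ j) v k))" if k: "k \<in> I" for k
    proof -
      have "cip I ((B ^^ Suc i) ((A ^^ j) (basis_vec k))) (basis_vec k)
          = cip I (B ((A ^^ j) (basis_vec k))) ((B ^^ i) (basis_vec k))"
        by (subst sym_opD[OF sym_op_funpow[OF sB, of i], symmetric]) (simp add: funpow_swap1)
      also have "\<dots> = cip I (A ((A ^^ j) (basis_vec k))) ((B ^^ i) (basis_vec k))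
          + s * cip I ((A ^^ j) (basis_vec k)) v * cip I v ((B ^^ i) (basis_vec k))"
        by (subst (1) B) (simp add: rank_one_update_def cip_add_left cip_scale_left)
      also have "cip I (A ((A ^^ j) (basis_vec k))) ((B ^^ i) (basis_vec k))
          = cip I ((B ^^ i) ((A ^^ Suc j) (basis_vec k))) (basis_vec k)"
        by (simp add: sym_opD[OF sym_op_funpow[OF sB, of i]])
      also have "cip I ((A ^^ j) (basis_vec k)) v = cnj ((A ^^ j) v k)"
        using sym_opD[OF sym_op_funpow[OF A, of j], of "basis_vec k" v]
          cip_cnj[of I "basis_vec k" "(A ^^ j) v"] cip_basis_vec[OF fin k] by simp
      also have "cip I v ((B ^^ i) (basis_vec k)) = (B ^^ i) v k"
        using sym_opD[OF sym_op_funpow[OF sB, of i], of v "basis_vec k"] cip_basis_vec[OF fin k]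
        by simp
      finally show ?thesis by (simp add: algebra_simps)
    qed
    have "op_trace I ((B ^^ Suc i) \<circ> (A ^^ j)) - op_trace I ((B ^^ i) \<circ> (A ^^ Suc j))
        = Re (\<Sum>k\<in>I. cip I ((B ^^ Suc i) ((A ^^ j) (basis_vec k))) (basis_vec k)
          - cip I ((B ^^ i) ((A ^^ Suc j) (basis_vec k))) (basis_vec k))"
      by (simp add: op_trace_def qform_def sum_subtractf)
    also have "\<dots> = Re (\<Sum>k\<in>I. s * ((B ^^ i) v k * cnj ((A ^^ j) v k)))"
      by (intro arg_cong[of _ _ Re] sum.cong term1 refl)
    also have "\<dots> = s * Re (cip I ((B ^^ i) v) ((A ^^ j) v))"
      by (simp only: cip_def sum_distrib_left[symmetric]) simp
    finally show ?thesis .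
  qed
  have "op_trace I ((B ^^ q) \<circ> (A ^^ (p - q))) - op_trace I (A ^^ p)
      = s * (\<Sum>i<q. Re (cip I ((B ^^ i) v) ((A ^^ (p - 1 - i)) v)))" if "q \<le> p" for q
    using that
  proof (induction q)
    case 0
    then show ?case by simp
  next
    case (Suc q)
    have "Suc (p - Suc q) = p - q" "p - 1 - q = p - Suc q" using Suc.prems by auto
    then show ?case using Suc step[of q "p - Suc q"]
      by (simp only: sum.lessThan_Suc distrib_left) linarith
  qed
  from this[of p] show ?thesis by simp
qed

lemma qform_id [simp]: "qform I id v = sqn I v"
  by (simp add: qform_def cip_self)

text \<open>
  Second-order lower estimate of the decrease. The correction terms are products of two moments of
  total order \<open>p - 2\<close>; each is at most \<open>R\<close> times the moment of order \<open>p - 2\<close>, hence at most \<open>R / c\<close>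
  times the moment of order \<open>p - 1\<close>.
\<close>

lemma op_trace_update_minus:
  assumes A: "sym_op I A" "\<And>u. c * sqn I u \<le> qform I A u" and c: "c > 0"
    and B: "B = rank_one_update I (-1) v A" "\<And>u. 0 \<le> qform I B u"
    and R: "sqn I v \<le> R"
  shows "op_trace I (B ^^ p)
    \<le> op_trace I (A ^^ p) - real p * (1 - (real p - 1) * R / (2 * c)) * qform I (A ^^ (p - 1)) v"
proof -
  have psd: "0 \<le> qform I A u" for u
    by (rule order_trans[OF _ A(2)]) (use c sqn_nonneg[of I u] in simp)
  interpret a: log_convex_seq "\<lambda>j. qform I (A ^^ j) v" by (rule qform_funpow_log_convex[OF A(1) psd])
  have sB: "sym_op I B" unfolding B by (rule sym_op_rank_one_update[OF A(1)])
  interpret b: log_convex_seq "\<lambda>j. qform I (B ^^ j) v" by (rule qform_funpow_log_convex[OF sB B(2)])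
  let ?a = "\<lambda>j. qform I (A ^^ j) v" and ?b = "\<lambda>j. qform I (B ^^ j) v"
  have b_le: "?b i \<le> ?a i" for i
    using arg_cong[OF cip_update_funpow[OF A(1) B(1), of i 0], of Re]
    by (simp add: qform_def[of I "B ^^ i" v] sum_nonneg a.nonneg b.nonneg)
  have a0: "0 \<le> R" using R sqn_nonneg[of I v] by linarith
  have step: "c * ?a j \<le> ?a (Suc j)" for j
    by (rule a.growth_step) (use c A(2)[of v] in auto)
  have low: "(1 - real i * (R / c)) * ?a (p - 1) \<le> Re (cip I ((B ^^ i) v) ((A ^^ (p - 1 - i)) v))"
    if i: "i < p" for i
  proof -
    have "?b l * ?a (p - 1 - 1 - l) \<le> R / c * ?a (p - 1)" if l: "l < i" for l
    proof -
      have "?b l * ?a (p - 1 - 1 - l) \<le> ?a l * ?a (p - 1 - 1 - l)"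
        by (intro mult_right_mono b_le a.nonneg)
      also have "\<dots> \<le> ?a 0 * ?a (p - 2)" using a.mult_le[of l "p - 1 - 1 - l"] l i by simp
      also have "\<dots> \<le> R * ?a (p - 2)" using R by (intro mult_right_mono a.nonneg) simp
      also have "?a (p - 2) \<le> ?a (p - 1) / c"
        using step[of "p - 2"] l i c by (simp add: field_simps Suc_diff_Suc numeral_2_eq_2)
      finally show ?thesis using a0 by (simp add: mult_left_mono)
    qed
    then have "(\<Sum>l<i. ?b l * ?a (p - 1 - 1 - l)) \<le> real i * (R / c * ?a (p - 1))"
      using sum_bounded_above[of "{..<i}" "\<lambda>l. ?b l * ?a (p - 1 - 1 - l)" "R / c * ?a (p - 1)"] by simp
    moreover have "i + (p - 1 - i) = p - 1" using i by simp
    then have "Re (cip I ((B ^^ i) v) ((A ^^ (p - 1 - i)) v))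
        = ?a (p - 1) - (\<Sum>l<i. ?b l * ?a (p - 1 - 1 - l))"
      unfolding cip_update_funpow[OF A(1) B(1)] by simp
    ultimately show ?thesis by (simp add: algebra_simps)
  qed
  have "(\<Sum>i<p. 1 - real i * (R / c)) = real p * (1 - (real p - 1) * R / (2 * c))"
  proof -
    have "(\<Sum>i<p. 1 - real i * r) = real p * (1 - (real p - 1) * r / 2)" for r :: real
      by (induction p) (simp_all add: field_simps)
    from this[of "R / c"] show ?thesis by (simp add: field_simps)
  qed
  then have "real p * (1 - (real p - 1) * R / (2 * c)) * ?a (p - 1)
      = (\<Sum>i<p. (1 - real i * (R / c)) * ?a (p - 1))"
    by (simp only: sum_distrib_right[symmetric])
  also have "\<dots> \<le> (\<Sum>i<p. Re (cip I ((B ^^ i) v) ((A ^^ (p - 1 - i)) v)))"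
    by (intro sum_mono low) auto
  also have "\<dots> = op_trace I (A ^^ p) - op_trace I (B ^^ p)"
    using op_trace_update_funpow[OF A(1) B(1), of p] by simp
  finally show ?thesis by simp
qed

text \<open>
  For \<open>\<parallel>v\<parallel>\<^sup>2 = R\<close> and commuting operators the increase would be the mean of \<open>(x + R)\<^sup>p - x\<^sup>p\<close> over the
  normalised spectral measure of \<open>v\<close>; association of moments shows that noncommutativity does not
  make it larger. The factor \<open>(1 + R / c)\<^bsup>p-1\<^esup>\<close> is the growth of the derivative on that interval.
\<close>

lemma op_trace_update_plus:
  assumes A: "sym_op I A" "\<And>u. c * sqn I u \<le> qform I A u" and c: "c > 0"
    and B: "B = rank_one_update I 1 v A"
    and R: "sqn I v \<le> R"
  shows "op_trace I (B ^^ p)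
    \<le> op_trace I (A ^^ p) + real p * (1 + R / c) ^ (p - 1) * qform I (A ^^ (p - 1)) v"
proof -
  have psd: "0 \<le> qform I A u" for u
    by (rule order_trans[OF _ A(2)]) (use c sqn_nonneg[of I u] in simp)
  interpret a: log_convex_seq "\<lambda>j. qform I (A ^^ j) v" by (rule qform_funpow_log_convex[OF A(1) psd])
  let ?a = "\<lambda>j. qform I (A ^^ j) v" and ?b = "\<lambda>j. qform I (B ^^ j) v"
  define r where "r = R / c"
  have r0: "0 \<le> r" using R sqn_nonneg[of I v] c by (simp add: r_def)
  have step: "c * ?a j \<le> ?a (Suc j)" for j
    by (rule a.growth_step) (use c A(2)[of v] in auto)
  have prod_le: "?a l * ?a j \<le> r * ?a (Suc (l + j))" for l j
  proof -
    have "?a l * ?a j \<le> ?a 0 * ?a (l + j)" by (rule a.mult_le)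
    also have "\<dots> \<le> R * ?a (l + j)" using R by (intro mult_right_mono a.nonneg) simp
    also have "\<dots> = r * (c * ?a (l + j))" using c by (simp add: r_def)
    also have "\<dots> \<le> r * ?a (Suc (l + j))" by (intro mult_left_mono step r0)
    finally show ?thesis .
  qed
  have geo: "1 + r * (\<Sum>l<i. (1 + r) ^ l) = (1 + r) ^ i" for i
    by (induction i) (simp_all add: algebra_simps)
  have b_le: "?b i \<le> (1 + r) ^ i * ?a i" for i
  proof (induction i rule: less_induct)
    case (less i)
    have "?b i = ?a i + (\<Sum>l<i. ?b l * ?a (i - 1 - l))"
      using arg_cong[OF cip_update_funpow[OF A(1) B, of i 0], of Re]
      by (simp add: qform_def[of I "B ^^ i" v])
    also have "\<dots> \<le> ?a i + (\<Sum>l<i. (1 + r) ^ l * (r * ?a i))"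
    proof (intro add_left_mono sum_mono)
      fix l assume l: "l \<in> {..<i}"
      have "?b l * ?a (i - 1 - l) \<le> (1 + r) ^ l * ?a l * ?a (i - 1 - l)"
        using less.IH[of l] l by (intro mult_right_mono a.nonneg) auto
      also have "\<dots> \<le> (1 + r) ^ l * (r * ?a i)"
      proof -
        have "Suc (l + (i - 1 - l)) = i" using l by simp
        then show ?thesis using prod_le[of l "i - 1 - l"] r0
          by (simp only: mult.assoc) (intro mult_left_mono, auto)
      qed
      finally show "?b l * ?a (i - 1 - l) \<le> (1 + r) ^ l * (r * ?a i)" .
    qed
    also have "\<dots> = (1 + r * (\<Sum>l<i. (1 + r) ^ l)) * ?a i"
      by (simp add: algebra_simps sum_distrib_left)
    finally show ?case by (simp add: geo)
  qed
  have up: "Re (cip I ((B ^^ i) v) ((A ^^ (p - 1 - i)) v)) \<le> (1 + r) ^ (p - 1) * ?a (p - 1)"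
    if i: "i < p" for i
  proof -
    have "Re (cip I ((B ^^ i) v) ((A ^^ (p - 1 - i)) v))
        = ?a (p - 1) + (\<Sum>l<i. ?b l * ?a (p - 1 - 1 - l))"
    proof -
      have "i + (p - 1 - i) = p - 1" using i by simp
      then show ?thesis unfolding cip_update_funpow[OF A(1) B] by simp
    qed
    also have "\<dots> \<le> ?a (p - 1) + (\<Sum>l<i. (1 + r) ^ l * (r * ?a (p - 1)))"
    proof (intro add_left_mono sum_mono)
      fix l assume l: "l \<in> {..<i}"
      have "?b l * ?a (p - 1 - 1 - l) \<le> (1 + r) ^ l * ?a l * ?a (p - 1 - 1 - l)"
        by (intro mult_right_mono a.nonneg b_le)
      also have "\<dots> \<le> (1 + r) ^ l * (r * ?a (p - 1))"
      proof -
        have "Suc (l + (p - 1 - 1 - l)) = p - 1" using l i by simp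
        then show ?thesis using prod_le[of l "p - 1 - 1 - l"] r0
          by (simp only: mult.assoc) (intro mult_left_mono, auto)
      qed
      finally show "?b l * ?a (p - 1 - 1 - l) \<le> (1 + r) ^ l * (r * ?a (p - 1))" .
    qed
    also have "\<dots> = (1 + r * (\<Sum>l<i. (1 + r) ^ l)) * ?a (p - 1)"
      by (simp add: algebra_simps sum_distrib_left)
    also have "\<dots> = (1 + r) ^ i * ?a (p - 1)" by (simp add: geo)
    also have "\<dots> \<le> (1 + r) ^ (p - 1) * ?a (p - 1)"
      using i r0 by (intro mult_right_mono a.nonneg power_increasing) auto
    finally show ?thesis .
  qed
  have "op_trace I (B ^^ p) - op_trace I (A ^^ p)
      = (\<Sum>i<p. Re (cip I ((B ^^ i) v) ((A ^^ (p - 1 - i)) v)))"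
    using op_trace_update_funpow[OF A(1) B, of p] by simp
  also have "\<dots> \<le> (\<Sum>i<p. (1 + r) ^ (p - 1) * ?a (p - 1))" by (intro sum_mono up) auto
  finally show ?thesis by (simp add: r_def)
qed

section \<open>Concentration for sums of random rank-one operators\<close>

text \<open>
  The operator \<open>c + s \<Sum>\<^bsub>i<k\<^esub> y\<^sub>i y\<^sub>i\<^sup>*\<close> with \<open>y\<^sub>i = Y (x i)\<close>.
\<close>

primrec sample_op :: "'i set \<Rightarrow> ('a \<Rightarrow> 'i \<Rightarrow> complex) \<Rightarrow> real \<Rightarrow> real \<Rightarrow> (nat \<Rightarrow> 'a) \<Rightarrow> nat \<Rightarrow>
    ('i \<Rightarrow> complex) \<Rightarrow> ('i \<Rightarrow> complex)" where
  "sample_op I Y c s x 0 = (\<lambda>u i. of_real c * u i)"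
| "sample_op I Y c s x (Suc k) = rank_one_update I s (Y (x k)) (sample_op I Y c s x k)"

lemma sym_op_sample_op: "finite I \<Longrightarrow> sym_op I (sample_op I Y c s x k)"
  by (induction k)
     (simp_all add: sym_op_rank_one_update, simp add: sym_op_def cip_scale_left cip_scale_right)

lemma qform_sample_op:
  "qform I (sample_op I Y c s x k) u = c * sqn I u + s * (\<Sum>i<k. (cmod (cip I u (Y (x i))))\<^sup>2)"
proof (induction k)
  case 0
  show ?case by (simp add: qform_def cip_scale_left cip_self)
next
  case (Suc k)
  then show ?case by (simp add: qform_rank_one_update algebra_simps)
qed

lemma sample_op_cong:
  "(\<And>i. i < k \<Longrightarrow> x i = x' i) \<Longrightarrow> sample_op I Y c s x k = sample_op I Y c s x' k"
  by (induction k) auto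

lemma cmod_cip_le: "(cmod (cip I u v))\<^sup>2 \<le> sqn I u * sqn I v"
proof -
  have "(cmod (cip I u v))\<^sup>2 \<le> (\<Sum>i\<in>I. cmod (u i) * cmod (v i))\<^sup>2"
    unfolding cip_def
    by (intro power_mono order_trans[OF norm_sum] sum_mono) (auto simp: norm_mult)
  also have "\<dots> \<le> sqn I u * sqn I v"
    unfolding sqn_def by (rule Cauchy_Schwarz_ineq_sum)
  finally show ?thesis .
qed

lemma sqn_basis_vec: "finite I \<Longrightarrow> i \<in> I \<Longrightarrow> sqn I (basis_vec i) = 1"
  by (simp add: sqn_def basis_vec_def if_distrib[of cmod] if_distrib[of "\<lambda>z. z ^ 2"] cong: if_cong)

lemma borel_measurable_cnj [measurable (raw)]:
  "f \<in> borel_measurable N \<Longrightarrow> (\<lambda>x. cnj (f x)) \<in> borel_measurable N"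
  by (rule borel_measurable_continuous_on) (auto intro: continuous_intros)

lemma measurable_sample_op:
  fixes x :: "'w \<Rightarrow> nat \<Rightarrow> 'a" and u :: "'w \<Rightarrow> 'i \<Rightarrow> complex"
  assumes Y: "\<And>k i. k < n \<Longrightarrow> i \<in> I \<Longrightarrow> (\<lambda>\<omega>. Y (x \<omega> k) i) \<in> borel_measurable N"
    and u: "\<And>i. i \<in> I \<Longrightarrow> (\<lambda>\<omega>. u \<omega> i) \<in> borel_measurable N"
    and k: "k \<le> n" and i: "i \<in> I"
  shows "(\<lambda>\<omega>. sample_op I Y c s (x \<omega>) k (u \<omega>) i) \<in> borel_measurable N"
  using k
proof (induction k)
  case 0
  show ?case using u[OF i] by simp
next
  case (Suc k)
  have [measurable]: "(\<lambda>\<omega>. Y (x \<omega> k) i) \<in> borel_measurable N" if "i \<in> I" for i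
    using Y[of k i] Suc.prems that by simp
  note [measurable] = u
  have "(\<lambda>\<omega>. cip I (u \<omega>) (Y (x \<omega> k))) \<in> borel_measurable N"
    unfolding cip_def by measurable
  then show ?case using Suc i by (simp add: rank_one_update_def)
qed

lemma measurable_trace_sample_op:
  fixes x :: "'w \<Rightarrow> nat \<Rightarrow> 'a"
  assumes Y: "\<And>k i. k < n \<Longrightarrow> i \<in> I \<Longrightarrow> (\<lambda>\<omega>. Y (x \<omega> k) i) \<in> borel_measurable N"
    and k: "k \<le> n"
  shows "(\<lambda>\<omega>. op_trace I (sample_op I Y c s (x \<omega>) k ^^ p)) \<in> borel_measurable N"
proof -
  have *: "(\<lambda>\<omega>. (sample_op I Y c s (x \<omega>) k ^^ p) v i) \<in> borel_measurable N" if "i \<in> I" for v i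
    using that
  proof (induction p arbitrary: i)
    case 0
    show ?case by simp
  next
    case (Suc p)
    show ?case
      using measurable_sample_op[where u = "\<lambda>\<omega>. (sample_op I Y c s (x \<omega>) k ^^ p) v" and n = n
          and x = x and Y = Y, OF Y Suc.IH k Suc.prems] by simp
  qed
  show ?thesis
    unfolding op_trace_def qform_def cip_def using * by (intro borel_measurable_sum) (measurable, simp_all)
qed

lemma trace_sample_op_0: "finite I \<Longrightarrow> op_trace I (sample_op I Y c s x 0 ^^ p) = real (card I) * c ^ p"
proof -
  assume fin: "finite I"
  have "(sample_op I Y c s x 0 ^^ p) u = (\<lambda>i. of_real (c ^ p) * u i)" for u
    by (induction p) (auto simp: mult_ac)
  then show ?thesis
    using fin by (simp add: op_trace_def qform_def cip_scale_left cip_self sqn_basis_vec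
        del: sample_op.simps of_real_power)
qed

text \<open>
  Integrating out the last sample first turns a bound on conditional expectations into a bound on the
  expectation over all samples.
\<close>

lemma nn_integral_PiM_contraction:
  fixes F :: "nat \<Rightarrow> (nat \<Rightarrow> 'a) \<Rightarrow> real"
  assumes "prob_space \<rho>"
    and meas: "\<And>k. k \<le> n \<Longrightarrow> F k \<in> borel_measurable (PiM {..<k} (\<lambda>_. \<rho>))"
    and step: "\<And>k x. k < n \<Longrightarrow> x \<in> space (PiM {..<k} (\<lambda>_. \<rho>)) \<Longrightarrow>
      (\<integral>\<^sup>+y. ennreal (F (Suc k) (x(k := y))) \<partial>\<rho>) \<le> ennreal q * ennreal (F k x)"
    and F0: "\<And>x. F 0 x \<le> init" and nn: "0 \<le> init" "0 \<le> q"
  shows "(\<integral>\<^sup>+x. ennreal (F n x) \<partial>PiM {..<n} (\<lambda>_. \<rho>)) \<le> ennreal (q ^ n * init)"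
proof -
  interpret prob_space \<rho> by fact
  interpret P: product_prob_space "\<lambda>_::nat. \<rho>" by unfold_locales
  have "(\<integral>\<^sup>+x. ennreal (F k x) \<partial>PiM {..<k} (\<lambda>_. \<rho>)) \<le> ennreal (q ^ k * init)" if "k \<le> n" for k
    using that
  proof (induction k)
    case 0
    have "(\<integral>\<^sup>+x. ennreal (F 0 x) \<partial>PiM {..<0} (\<lambda>_. \<rho>)) \<le> (\<integral>\<^sup>+x. ennreal init \<partial>PiM {..<0::nat} (\<lambda>_. \<rho>))"
      by (intro nn_integral_mono ennreal_leI F0)
    also have "\<dots> = ennreal init"
      using prob_space.emeasure_space_1[OF prob_space_PiM[of "{..<0::nat}" "\<lambda>_. \<rho>"]] prob_space_axioms
      by simp
    finally show ?case by simp
  next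
    case (Suc k)
    have ins: "{..<Suc k} = insert k {..<k}" by auto
    have "(\<integral>\<^sup>+x. ennreal (F (Suc k) x) \<partial>PiM {..<Suc k} (\<lambda>_. \<rho>))
        = (\<integral>\<^sup>+x. (\<integral>\<^sup>+y. ennreal (F (Suc k) (x(k := y))) \<partial>\<rho>) \<partial>PiM {..<k} (\<lambda>_. \<rho>))"
      using meas[OF Suc.prems] unfolding ins
      by (intro P.product_nn_integral_insert) auto
    also have "\<dots> \<le> (\<integral>\<^sup>+x. ennreal q * ennreal (F k x) \<partial>PiM {..<k} (\<lambda>_. \<rho>))"
      using Suc.prems by (intro nn_integral_mono step) auto
    also have "\<dots> = ennreal q * (\<integral>\<^sup>+x. ennreal (F k x) \<partial>PiM {..<k} (\<lambda>_. \<rho>))"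
      using meas[of k] Suc.prems by (intro nn_integral_cmult) auto
    also have "\<dots> \<le> ennreal q * ennreal (q ^ k * init)"
      using Suc by (intro mult_left_mono) auto
    also have "\<dots> = ennreal (q ^ Suc k * init)"
      using nn by (simp add: ennreal_mult' mult.assoc)
    finally show ?case .
  qed
  then show ?thesis by simp
qed

lemma prob_PiM_contraction:
  fixes F :: "nat \<Rightarrow> (nat \<Rightarrow> 'a) \<Rightarrow> real"
  assumes "prob_space \<rho>"
    and meas: "\<And>k. k \<le> n \<Longrightarrow> F k \<in> borel_measurable (PiM {..<k} (\<lambda>_. \<rho>))"
    and step: "\<And>k x. k < n \<Longrightarrow> x \<in> space (PiM {..<k} (\<lambda>_. \<rho>)) \<Longrightarrow>
      (\<integral>\<^sup>+y. ennreal (F (Suc k) (x(k := y))) \<partial>\<rho>) \<le> ennreal q * ennreal (F k x)"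
    and F0: "\<And>x. F 0 x \<le> init" and nn: "0 \<le> init" "0 \<le> q" and a: "0 < a"
  shows "{x \<in> space (PiM {..<n} (\<lambda>_. \<rho>)). F n x < a} \<in> sets (PiM {..<n} (\<lambda>_. \<rho>))"
    and "measure (PiM {..<n} (\<lambda>_. \<rho>)) {x \<in> space (PiM {..<n} (\<lambda>_. \<rho>)). F n x < a}
      \<ge> 1 - q ^ n * init / a"
proof -
  let ?P = "PiM {..<n} (\<lambda>_. \<rho>)"
  interpret P: prob_space ?P by (rule prob_space_PiM) (rule assms(1))
  have [measurable]: "F n \<in> borel_measurable ?P" using meas[of n] by simp
  show G: "{x \<in> space ?P. F n x < a} \<in> sets ?P" by measurable
  have "emeasure ?P {x \<in> space ?P. a \<le> F n x} \<le> ennreal (q ^ n * init / a)"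
  proof -
    have "emeasure ?P {x \<in> space ?P. a \<le> F n x}
        \<le> emeasure ?P {x \<in> space ?P. 1 \<le> ennreal (1 / a) * ennreal (F n x)}"
      using a by (intro emeasure_mono)
        (auto simp: ennreal_mult'[symmetric] ennreal_1[symmetric] simp del: ennreal_1 intro!: ennreal_leI)
    also have "\<dots> \<le> ennreal (1 / a) * (\<integral>\<^sup>+x. ennreal (F n x) * indicator (space ?P) x \<partial>?P)"
      by (rule nn_integral_Markov_inequality) auto
    also have "(\<integral>\<^sup>+x. ennreal (F n x) * indicator (space ?P) x \<partial>?P) = (\<integral>\<^sup>+x. ennreal (F n x) \<partial>?P)"
      by (intro nn_integral_cong) (auto simp: indicator_def)
    also have "ennreal (1 / a) * \<dots> \<le> ennreal (1 / a) * ennreal (q ^ n * init)"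
      by (intro mult_left_mono nn_integral_PiM_contraction[OF assms(1-6)]) auto
    also have "\<dots> = ennreal (q ^ n * init / a)" using a by (simp add: ennreal_mult'[symmetric])
    finally show ?thesis .
  qed
  then have "P.prob {x \<in> space ?P. a \<le> F n x} \<le> q ^ n * init / a"
    using a nn by (simp add: P.emeasure_eq_measure)
  moreover have "P.prob {x \<in> space ?P. a \<le> F n x} = 1 - P.prob {x \<in> space ?P. F n x < a}"
  proof -
    have "{x \<in> space ?P. a \<le> F n x} = space ?P - {x \<in> space ?P. F n x < a}" by auto
    then show ?thesis using P.prob_compl[OF G] by simp
  qed
  ultimately show "P.prob {x \<in> space ?P. F n x < a} \<ge> 1 - q ^ n * init / a" by simp
qed

locale random_vector = prob_space \<rho> for \<rho> :: "'a measure" +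
  fixes I :: "'i set" and Y :: "'a \<Rightarrow> 'i \<Rightarrow> complex" and R :: real and l :: "'i \<Rightarrow> real"
  assumes fin: "finite I"
    and meas: "i \<in> I \<Longrightarrow> (\<lambda>x. Y x i) \<in> borel_measurable \<rho>"
    and bound: "x \<in> space \<rho> \<Longrightarrow> sqn I (Y x) \<le> R"
    and R_pos: "0 < R"
    and second_moment: "i \<in> I \<Longrightarrow> j \<in> I \<Longrightarrow>
      (\<integral>x. Y x i * cnj (Y x j) \<partial>\<rho>) = (if i = j then of_real (l i) else 0)"
begin

lemma cmod_le: "x \<in> space \<rho> \<Longrightarrow> i \<in> I \<Longrightarrow> (cmod (Y x i))\<^sup>2 \<le> R"
  using bound[of x] member_le_sum[of i I "\<lambda>i. (cmod (Y x i))\<^sup>2"] fin by (simp add: sqn_def)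

lemma integrable_prod:
  assumes "i \<in> I" "j \<in> I"
  shows "integrable \<rho> (\<lambda>x. Y x i * cnj (Y x j))"
proof (rule integrable_const_bound[where B = R])
  show "(\<lambda>x. Y x i * cnj (Y x j)) \<in> borel_measurable \<rho>"
    using meas[OF assms(1)] meas[OF assms(2)] by measurable
  show "AE x in \<rho>. cmod (Y x i * cnj (Y x j)) \<le> R"
  proof (rule AE_I2)
    fix x assume x: "x \<in> space \<rho>"
    have "0 \<le> (cmod (Y x i) - cmod (Y x j))\<^sup>2" by simp
    then show "cmod (Y x i * cnj (Y x j)) \<le> R"
      using cmod_le[OF x assms(1)] cmod_le[OF x assms(2)]
      by (simp add: norm_mult power2_eq_square algebra_simps)
  qed
qed

lemma qform_expand:
  assumes "sym_op I P"
  shows "qform I P v = (\<Sum>i\<in>I. \<Sum>j\<in>I. Re (cnj (P (basis_vec i) j) * (v j * cnj (v i))))"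
proof -
  have "P v i = (\<Sum>j\<in>I. v j * cnj (P (basis_vec i) j))" if "i \<in> I" for i
    using cip_basis_vec[OF fin that, of "P v"] sym_opD[OF assms, of v "basis_vec i"]
    by (simp add: cip_def)
  then have "cip I (P v) v = (\<Sum>i\<in>I. \<Sum>j\<in>I. cnj (P (basis_vec i) j) * (v j * cnj (v i)))"
    by (simp add: cip_def sum_distrib_right sum_distrib_left mult_ac)
  then show ?thesis by (simp add: qform_def)
qed

text \<open>
  Since the coordinates are uncorrelated, the expectation of \<open>\<langle>P y, y\<rangle>\<close> only sees the diagonal of \<open>P\<close>.
  For an isotropic vector it is the trace.
\<close>

lemma integral_qform:
  assumes "sym_op I P"
  shows "integrable \<rho> (\<lambda>x. qform I P (Y x))"
    and "(\<integral>x. qform I P (Y x) \<partial>\<rho>) = (\<Sum>i\<in>I. l i * qform I P (basis_vec i))"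
proof -
  have int: "integrable \<rho> (\<lambda>x. cnj (P (basis_vec i) j) * (Y x j * cnj (Y x i)))"
    if "i \<in> I" "j \<in> I" for i j
    using integrable_prod[OF that(2) that(1)] by simp
  show "integrable \<rho> (\<lambda>x. qform I P (Y x))"
    unfolding qform_expand[OF assms]
    by (intro Bochner_Integration.integrable_sum integrable_Re int)
  have "(\<integral>x. qform I P (Y x) \<partial>\<rho>)
      = (\<Sum>i\<in>I. \<Sum>j\<in>I. Re (\<integral>x. cnj (P (basis_vec i) j) * (Y x j * cnj (Y x i)) \<partial>\<rho>))"
    unfolding qform_expand[OF assms] using int
    by (simp add: Bochner_Integration.integral_sum Bochner_Integration.integrable_sum integral_Re
        del: times_complex.sel)
  also have "\<dots> = (\<Sum>i\<in>I. \<Sum>j\<in>I. if j = i then l i * Re (P (basis_vec i) i) else 0)"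
    by (intro sum.cong refl) (auto simp: second_moment)
  also have "\<dots> = (\<Sum>i\<in>I. l i * qform I P (basis_vec i))"
    using fin by (intro sum.cong refl) (simp add: qform_def cip_basis_vec)
  finally show "(\<integral>x. qform I P (Y x) \<partial>\<rho>) = (\<Sum>i\<in>I. l i * qform I P (basis_vec i))" .
qed

text \<open>
  One step of either potential: the update changes it by at most a multiple of a moment of the new vector,
  and the second moments turn the expectation of that moment into a weighted trace.
\<close>

lemma nn_integral_le_affine_qform:
  assumes P: "sym_op I P"
    and F: "\<And>y. y \<in> space \<rho> \<Longrightarrow> 0 \<le> F y" "\<And>y. y \<in> space \<rho> \<Longrightarrow> F y \<le> a + b * qform I P (Y y)"
    and q: "a + b * (\<Sum>i\<in>I. l i * qform I P (basis_vec i)) \<le> q * a" "0 \<le> q"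
  shows "(\<integral>\<^sup>+y. ennreal (F y) \<partial>\<rho>) \<le> ennreal q * ennreal a"
proof -
  note ig = integral_qform[OF P]
  have "(\<integral>\<^sup>+y. ennreal (F y) \<partial>\<rho>) \<le> (\<integral>\<^sup>+y. ennreal (a + b * qform I P (Y y)) \<partial>\<rho>)"
    by (intro nn_integral_mono ennreal_leI F(2))
  also have "\<dots> = ennreal (\<integral>y. a + b * qform I P (Y y) \<partial>\<rho>)"
    by (rule nn_integral_eq_integral)
      (use ig(1) F in \<open>auto intro!: AE_I2 intro: order_trans\<close>)
  also have "(\<integral>y. a + b * qform I P (Y y) \<partial>\<rho>) = a + b * (\<Sum>i\<in>I. l i * qform I P (basis_vec i))"
    using ig by (simp add: prob_space)
  also have "ennreal \<dots> \<le> ennreal (q * a)" by (rule ennreal_leI[OF q(1)])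
  finally show ?thesis unfolding ennreal_mult'[OF q(2)] .
qed

lemma sum_second_moment_le: "(\<Sum>i\<in>I. l i) \<le> R"
proof -
  have s: "sym_op I (\<lambda>u. u)" using fin by (simp add: sym_op_def)
  have q: "qform I (\<lambda>u. u) v = sqn I v" for v by (simp add: qform_def cip_self)
  have "(\<Sum>i\<in>I. l i) = (\<integral>x. sqn I (Y x) \<partial>\<rho>)"
    using integral_qform(2)[OF s] fin by (simp add: q sqn_basis_vec)
  also have "\<dots> \<le> R"
    using integral_qform(1)[OF s] bound by (intro integral_le_const) (auto simp: q)
  finally show ?thesis .
qed

lemma measurable_trace_PiM:
  "k \<le> n \<Longrightarrow> (\<lambda>x. op_trace I (sample_op I Y c s x k ^^ p)) \<in> borel_measurable (PiM {..<n} (\<lambda>_. \<rho>))"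
proof -
  assume k: "k \<le> n"
  have *: "(\<lambda>x. Y (x j) i) \<in> borel_measurable (PiM {..<n} (\<lambda>_. \<rho>))" if "j < n" "i \<in> I" for i j
    using measurable_compose[OF measurable_component_singleton[of j "{..<n}" "\<lambda>_. \<rho>"] meas[OF that(2)]]
      that by simp
  show ?thesis
    by (rule measurable_trace_sample_op[where n = n and x = "\<lambda>x. x"]) (use * k in auto)
qed

lemma space_PiMD: "x \<in> space (PiM {..<k} (\<lambda>_. \<rho>)) \<Longrightarrow> i < k \<Longrightarrow> x i \<in> space \<rho>"
  by (auto simp: space_PiM PiE_def Pi_def)

lemma sum_cip_bounds:
  assumes "x \<in> space (PiM {..<k} (\<lambda>_. \<rho>))"
  shows "0 \<le> (\<Sum>i<k. (cmod (cip I u (Y (x i))))\<^sup>2)"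
    and "(\<Sum>i<k. (cmod (cip I u (Y (x i))))\<^sup>2) \<le> real k * R * sqn I u"
proof -
  show "0 \<le> (\<Sum>i<k. (cmod (cip I u (Y (x i))))\<^sup>2)" by (simp add: sum_nonneg)
  have "(cmod (cip I u (Y (x i))))\<^sup>2 \<le> R * sqn I u" if "i < k" for i
    using cmod_cip_le[of I u "Y (x i)"] bound[OF space_PiMD[OF assms that]]
      mult_left_mono[of "sqn I (Y (x i))" R "sqn I u"] sqn_nonneg[of I u]
    by (simp add: mult.commute)
  then show "(\<Sum>i<k. (cmod (cip I u (Y (x i))))\<^sup>2) \<le> real k * R * sqn I u"
    using sum_bounded_above[of "{..<k}" "\<lambda>i. (cmod (cip I u (Y (x i))))\<^sup>2" "R * sqn I u"] by simp
qed

text \<open>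
  An upper bound on \<open>A\<close> controls the passage from an even power to the next odd one, where \<open>A\<close> can be
  placed in the middle. This is why \<open>lower_tail\<close> uses an odd exponent.
\<close>

lemma qform_funpow_odd_le:
  assumes A: "sym_op I A" "\<And>u. qform I A u \<le> c * sqn I u"
  shows "qform I (A ^^ Suc (2 * j)) u \<le> c * qform I (A ^^ (2 * j)) u"
proof -
  have 1: "cip I ((A ^^ Suc (2 * j)) u) u = cip I (A ((A ^^ j) u)) ((A ^^ j) u)"
    using cip_funpow_funpow[OF A(1), of "Suc j" u j u] by (simp add: mult_2)
  have 2: "cip I ((A ^^ (2 * j)) u) u = cip I ((A ^^ j) u) ((A ^^ j) u)"
    using cip_funpow_funpow[OF A(1), of j u j u] by (simp add: mult_2)
  show ?thesis using A(2)[of "(A ^^ j) u"]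
    by (simp only: qform_def 1 2) (simp add: cip_self)
qed

text \<open>
  The potential is the trace of \<open>(c - S)\<^sup>p\<close>, with \<open>c = 20 n R\<close> so large that \<open>c - S\<close> stays close to
  \<open>c\<close>, and \<open>p / c\<close> about \<open>1 / (2 R)\<close>, the exponent of the Chernoff bound. If \<open>S\<close> has a Rayleigh
  quotient below \<open>n / 2\<close>, then the potential exceeds \<open>(c - n/2)\<^sup>p\<close>.
\<close>

lemma lower_tail:
  assumes n: "1 \<le> n" and R1: "1 \<le> R" and iso: "\<And>i. i \<in> I \<Longrightarrow> l i = 1"
  obtains G where "G \<in> sets (PiM {..<n} (\<lambda>_. \<rho>))"
    "measure (PiM {..<n} (\<lambda>_. \<rho>)) G \<ge> 1 - real (card I) * exp (- real n / (48 * R))"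
    "\<And>x u. x \<in> G \<Longrightarrow> real n / 2 * sqn I u \<le> (\<Sum>k<n. (cmod (cip I u (Y (x k))))\<^sup>2)"
proof -
  define c where "c = 20 * real n * R"
  define p where "p = Suc (2 * (5 * n))"
  define q where "q = 1 - 7 / (19 * R)"
  define F where "F = (\<lambda>k x. op_trace I (sample_op I Y c (- 1) x k ^^ p))"
  define a where "a = (c - real n / 2) ^ p"
  have nR: "1 \<le> real n * R" using n R1 mult_mono[of 1 "real n" 1 R] by simp
  have c0: "c > 0" using n R_pos by (simp add: c_def)
  have rp: "real p = 10 * real n + 1" by (simp add: p_def)
  have "real n \<le> real n * R" using R1 n by (simp add: mult_le_cancel_left1)
  then have cn: "real n / 2 < c" using n by (simp add: c_def)
  have a0: "a > 0" using cn by (simp add: a_def)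
  have q0: "0 \<le> q" using R1 by (simp add: q_def field_simps)
  let ?A = "\<lambda>x k. sample_op I Y c (- 1) x k"
  have sA: "sym_op I (?A x k)" for x k by (rule sym_op_sample_op[OF fin])
  have lowA: "(c - real k * R) * sqn I u \<le> qform I (?A x k) u"
    and upA: "qform I (?A x k) u \<le> c * sqn I u"
    if "x \<in> space (PiM {..<k} (\<lambda>_. \<rho>))" for x k u
    using sum_cip_bounds[OF that, of u] by (simp_all add: qform_sample_op algebra_simps)
  have step: "(\<integral>\<^sup>+y. ennreal (F (Suc k) (x(k := y))) \<partial>\<rho>) \<le> ennreal q * ennreal (F k x)"
    if k: "k < n" and x: "x \<in> space (PiM {..<k} (\<lambda>_. \<rho>))" for k x
  proof -
    let ?B = "\<lambda>y. rank_one_update I (- 1) (Y y) (?A x k)"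
    have eq: "?A (x(k := y)) (Suc k) = ?B y" for y
      using sample_op_cong[of k "x(k := y)" x I Y c "- 1"] by simp
    have xy: "x(k := y) \<in> space (PiM {..<Suc k} (\<lambda>_. \<rho>))" if "y \<in> space \<rho>" for y
      using x that by (auto simp: space_PiM PiE_def Pi_def extensional_def less_Suc_eq)
    have kR: "real k * R \<le> real n * R" "real (Suc k) * R \<le> real n * R"
      using k R_pos by (auto intro!: mult_right_mono)
    have c1: "c - real k * R > 0" using kR nR by (simp add: c_def)
    have A1: "19 * real n * R * sqn I u \<le> qform I (?A x k) u" for u
      by (rule order_trans[OF _ lowA[OF x]], rule mult_right_mono)
        (use kR(1) sqn_nonneg[of I u] in \<open>simp_all add: c_def mult.commute\<close>)
    have B0: "0 \<le> qform I (?B y) u" if "y \<in> space \<rho>" for y u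
    proof -
      have "0 \<le> (c - real (Suc k) * R) * sqn I u"
        using kR(2) nR sqn_nonneg[of I u] by (intro mult_nonneg_nonneg) (auto simp: c_def)
      then show ?thesis using lowA[OF xy[OF that], of u] unfolding eq by simp
    qed
    let ?g = "qform I (?A x k ^^ (p - 1))"
    define \<theta> where "\<theta> = real p * (14 / 19)"
    have th: "real p * (1 - (real p - 1) * R / (2 * (19 * real n * R))) = \<theta>"
      using n R_pos by (simp add: \<theta>_def rp field_simps)
    have pw: "F (Suc k) (x(k := y)) \<le> F k x - \<theta> * ?g (Y y)" if y: "y \<in> space \<rho>" for y
      using op_trace_update_minus[OF sA A1 _ refl B0[OF y] bound[OF y], of p] n R_pos
      unfolding th F_def eq by simp
    have Fnn: "0 \<le> F (Suc k) (x(k := y))" if y: "y \<in> space \<rho>" for y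
    proof -
      have "log_convex_seq (\<lambda>j. qform I (?B y ^^ j) u)" for u
        by (rule qform_funpow_log_convex[OF sym_op_rank_one_update[OF sA] B0[OF y]])
      then have "0 \<le> qform I (?B y ^^ p) u" for u by (rule log_convex_seq.nonneg)
      then show ?thesis unfolding F_def eq op_trace_def by (intro sum_nonneg) auto
    qed
    have sP: "sym_op I (?A x k ^^ (p - 1))" by (rule sym_op_funpow[OF sA])
    have iso_trace: "(\<Sum>i\<in>I. l i * ?g (basis_vec i)) = op_trace I (?A x k ^^ (p - 1))"
      by (simp add: op_trace_def iso)
    have "F k x + (- \<theta>) * (\<Sum>i\<in>I. l i * ?g (basis_vec i)) \<le> q * F k x"
    proof -
      have "F k x \<le> c * op_trace I (?A x k ^^ (p - 1))"
        unfolding F_def op_trace_def sum_distrib_left p_def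
        by (intro sum_mono) (use qform_funpow_odd_le[OF sA upA[OF x], of "5 * n"] in simp)
      from mult_right_mono[OF this, of "\<theta> / c"]
      have "F k x * (\<theta> / c) \<le> \<theta> * op_trace I (?A x k ^^ (p - 1))"
        using c0 by (simp add: \<theta>_def mult_ac)
      moreover have "7 / (19 * R) * F k x \<le> F k x * (\<theta> / c)"
      proof -
        have "7 / (19 * R) \<le> \<theta> / c" using n R_pos by (simp add: \<theta>_def c_def rp field_simps)
        moreover have "0 \<le> F k x"
        proof -
          have "0 \<le> qform I (?A x k) u" for u
            by (rule order_trans[OF _ A1]) (use R_pos sqn_nonneg[of I u] in simp)
          then have "log_convex_seq (\<lambda>j. qform I (?A x k ^^ j) u)" for u
            by (rule qform_funpow_log_convex[OF sA])
          then have "0 \<le> qform I (?A x k ^^ p) u" for u by (rule log_convex_seq.nonneg)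
          then show ?thesis unfolding F_def op_trace_def by (intro sum_nonneg) auto
        qed
        ultimately have "7 / (19 * R) * F k x \<le> \<theta> / c * F k x" by (rule mult_right_mono)
        then show ?thesis by (simp only: mult.commute)
      qed
      ultimately show ?thesis unfolding iso_trace by (simp add: q_def algebra_simps)
    qed
    then show ?thesis
      by (intro nn_integral_le_affine_qform[where b = "- \<theta>", OF sP Fnn _ _ q0]) (use pw in auto)
  qed
  have mF: "F k \<in> borel_measurable (PiM {..<k} (\<lambda>_. \<rho>))" for k
    unfolding F_def by (rule measurable_trace_PiM) simp
  have F0: "F 0 x \<le> real (card I) * c ^ p" for x
    unfolding F_def trace_sample_op_0[OF fin] by simp
  define G where "G = {x \<in> space (PiM {..<n} (\<lambda>_. \<rho>)). F n x < a}"
  have f0: "0 \<le> real (card I) * c ^ p" using c0 by simp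
  note Q = prob_PiM_contraction[where F = F and q = q and init = "real (card I) * c ^ p",
      OF prob_space_axioms mF step F0 f0 q0 a0]
  have P1: "G \<in> sets (PiM {..<n} (\<lambda>_. \<rho>))" unfolding G_def by (rule Q(1))
  have P2: "1 - q ^ n * (real (card I) * c ^ p) / a \<le> measure (PiM {..<n} (\<lambda>_. \<rho>)) G"
    unfolding G_def by (rule Q(2))
  have num: "q ^ n * (real (card I) * c ^ p) / a \<le> real (card I) * exp (- real n / (48 * R))"
  proof -
    have "q ^ n \<le> exp (- 7 / (19 * R)) ^ n"
      using exp_ge_add_one_self[of "- 7 / (19 * R)"] q0 by (intro power_mono) (auto simp: q_def)
    also have "\<dots> = exp (- (7 / 19) * (real n / R))" by (simp flip: exp_of_nat_mult)
    finally have q1: "q ^ n \<le> exp (- (7 / 19) * (real n / R))" .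
    have "c / (c - real n / 2) = 1 + (real n / 2) / (c - real n / 2)" using cn by (simp add: field_simps)
    also have "(real n / 2) / (c - real n / 2) \<le> 1 / (39 * R)"
      using cn n R1 \<open>real n \<le> real n * R\<close> R_pos by (simp add: c_def field_simps)
    also have "1 + 1 / (39 * R) \<le> exp (1 / (39 * R))" by (rule exp_ge_add_one_self)
    finally have "(c / (c - real n / 2)) ^ p \<le> exp (1 / (39 * R)) ^ p"
      using cn c0 by (intro power_mono) auto
    also have "\<dots> = exp (real p / (39 * R))" by (simp flip: exp_of_nat_mult)
    also have "\<dots> \<le> exp (11 / 39 * (real n / R))"
      using n R_pos by (simp add: rp field_simps)
    finally have c1: "c ^ p / a \<le> exp (11 / 39 * (real n / R))"
      by (simp add: a_def power_divide)
    have "q ^ n * (c ^ p / a) \<le> exp (- (7 / 19) * (real n / R)) * exp (11 / 39 * (real n / R))"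
      using q1 c1 a0 c0 by (intro mult_mono) auto
    also have "\<dots> = exp ((11 / 39 - 7 / 19) * (real n / R))"
      by (simp add: algebra_simps flip: exp_add)
    also have "\<dots> \<le> exp (- 1 / 48 * (real n / R))"
      using R_pos by (subst exp_le_cancel_iff, intro mult_right_mono) auto
    finally have "q ^ n * (c ^ p / a) \<le> exp (- real n / (48 * R))" by simp
    then have "real (card I) * (q ^ n * (c ^ p / a)) \<le> real (card I) * exp (- real n / (48 * R))"
      by (rule mult_left_mono) simp
    then show ?thesis by (simp add: mult_ac)
  qed
  show ?thesis
  proof (rule that)
    show "G \<in> sets (PiM {..<n} (\<lambda>_. \<rho>))" by (rule P1)
    show "measure (PiM {..<n} (\<lambda>_. \<rho>)) G \<ge> 1 - real (card I) * exp (- real n / (48 * R))"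
      using P2 num by linarith
    fix x u assume "x \<in> G"
    then have x: "x \<in> space (PiM {..<n} (\<lambda>_. \<rho>))" and Fa: "F n x < a" by (auto simp: G_def)
    let ?S = "\<Sum>k<n. (cmod (cip I u (Y (x k))))\<^sup>2"
    show "real n / 2 * sqn I u \<le> ?S"
    proof (rule ccontr)
      assume "\<not> ?thesis"
      then have lt: "?S < real n / 2 * sqn I u" by simp
      then have s0: "sqn I u > 0"
        using sum_cip_bounds(1)[OF x, of u] sqn_nonneg[of I u] by (cases "sqn I u = 0") auto
      have psd: "0 \<le> qform I (?A x n) w" for w
        by (rule order_trans[OF _ lowA[OF x]]) (use sqn_nonneg[of I w] n R_pos in \<open>simp add: c_def\<close>)
      have lc: "log_convex_seq (\<lambda>j. qform I (?A x n ^^ j) w)" for w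
        by (rule qform_funpow_log_convex[OF sA psd])
      have "(c - real n / 2) ^ p * sqn I u \<le> qform I (?A x n ^^ p) u"
        using log_convex_seq.growth_power[OF lc, of "c - real n / 2" u p] cn lt
        by (simp add: qform_sample_op algebra_simps)
      also have "\<dots> \<le> F n x * sqn I u"
        unfolding F_def by (rule qform_le_trace[OF sym_op_funpow[OF sA] log_convex_seq.nonneg[OF lc]])
      finally show False using s0 Fa by (simp add: a_def)
    qed
  qed
qed

text \<open>
  The potential is the trace of \<open>(c + S)\<^sup>p - c\<^sup>p\<close> plus \<open>d c\<^sup>p\<close>, where \<open>d = R / M\<close> dominates the intrinsic
  dimension. It starts at \<open>d c\<^sup>p\<close>, whatever the size of \<open>I\<close>, and the sum \<open>\<Sum> l i\<close>, which is only
  bounded by \<open>R = M d\<close>, is exactly absorbed by the second summand. With \<open>c = p R\<close> each sample costs a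
  factor \<open>1 + 3 M / R\<close>, in total \<open>exp (3 \<kappa>)\<close> with \<open>\<kappa> = n M / R\<close>; and \<open>d \<le> n \<le> exp \<kappa>\<close> by the
  logarithm in the assumption on \<open>M\<close>. Choosing \<open>p\<close> about \<open>3 \<kappa>\<close> beats both factors.
\<close>

lemma upper_tail:
  fixes M \<delta> :: real
  assumes n: "1 \<le> n" and \<delta>: "0 < \<delta>" "\<delta> < 1"
    and M: "0 < M" "\<And>i. i \<in> I \<Longrightarrow> l i \<le> M" and MR: "ln (8 * real n) / real n * R \<le> M"
  obtains G where "G \<in> sets (PiM {..<n} (\<lambda>_. \<rho>))"
    "measure (PiM {..<n} (\<lambda>_. \<rho>)) G \<ge> 1 - \<delta>"
    "\<And>x u. x \<in> G \<Longrightarrow> (\<Sum>k<n. (cmod (cip I u (Y (x k))))\<^sup>2) \<le> 14 * real n * M / \<delta> * sqn I u"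
proof -
  define \<kappa> where "\<kappa> = real n * M / R"
  define p where "p = nat \<lceil>3 * \<kappa>\<rceil>"
  define c where "c = real p * R"
  define d where "d = R / M"
  define q where "q = 1 + 3 * M / R"
  define t where "t = 14 * real n * M / \<delta>"
  define \<Phi> where "\<Phi> = (\<lambda>p k x. (\<Sum>i\<in>I. qform I (sample_op I Y c 1 x k ^^ p) (basis_vec i) - c ^ p) + d * c ^ p)"
  define a where "a = (c + t) ^ p - c ^ p"
  have kap: "ln (8 * real n) \<le> \<kappa>" using MR R_pos n by (simp add: \<kappa>_def field_simps)
  have "ln (8::real) \<le> ln (8 * real n)" using n by simp
  moreover have "2 \<le> ln (8::real)"
  proof -
    have "exp (2::real) = exp 1 * exp 1" by (simp flip: exp_add)
    also have "\<dots> \<le> 2.8 * 2.8" using e_less_272 by (intro mult_mono) auto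
    finally show ?thesis by (simp add: ln_ge_iff)
  qed
  ultimately have kap2: "2 \<le> \<kappa>" using kap by simp
  have p: "3 * \<kappa> \<le> real p" "real p \<le> 3 * \<kappa> + 1" using kap2 by (auto simp: p_def; linarith)+
  have p1: "1 \<le> p" "p > 0" using p(1) kap2 by (auto simp: Suc_le_eq intro: gr0I)
  have c0: "c > 0" using p1 R_pos by (simp add: c_def)
  have d0: "d > 0" using R_pos M by (simp add: d_def)
  have t0: "t > 0" using n M \<delta> by (simp add: t_def)
  have q0: "0 \<le> q" using M R_pos by (simp add: q_def)
  have a0: "a > 0" using t0 c0 p1 by (simp add: a_def power_strict_mono)
  let ?A = "\<lambda>x k. sample_op I Y c 1 x k"
  have sA: "sym_op I (?A x k)" for x k by (rule sym_op_sample_op[OF fin])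
  have lowA: "c * sqn I u \<le> qform I (?A x k) u" for x k u
    by (simp add: qform_sample_op sum_nonneg)
  have psd: "0 \<le> qform I (?A x k) u" for x k u
    by (rule order_trans[OF _ lowA]) (use c0 sqn_nonneg[of I u] in auto)
  have lc: "log_convex_seq (\<lambda>j. qform I (?A x k ^^ j) u)" for x k u
    by (rule qform_funpow_log_convex[OF sA psd])
  have grow: "c * qform I (?A x k ^^ j) u \<le> qform I (?A x k ^^ Suc j) u" for x k j u
    by (rule log_convex_seq.growth_step[OF lc]) (use c0 lowA[of u x k] in auto)
  have growp: "c ^ j * sqn I u \<le> qform I (?A x k ^^ j) u" for x k j u
    using log_convex_seq.growth_power[OF lc, of c x k u j] c0 lowA[of u x k] by simp
  have growu: "c ^ j \<le> qform I (?A x k ^^ j) (basis_vec i)" if "i \<in> I" for x k j i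
    using growp[of j "basis_vec i" x k] that by (simp add: sqn_basis_vec[OF fin])
  have Phi_nn: "0 \<le> \<Phi> j k x" for j k x
    using growu d0 c0 by (auto simp: \<Phi>_def intro!: add_nonneg_nonneg sum_nonneg)
  have Phi_trace: "\<Phi> j k x = op_trace I (?A x k ^^ j) - real (card I) * c ^ j + d * c ^ j" for j k x
    by (simp add: \<Phi>_def op_trace_def sum_subtractf)
  have step: "(\<integral>\<^sup>+y. ennreal (\<Phi> p (Suc k) (x(k := y))) \<partial>\<rho>) \<le> ennreal q * ennreal (\<Phi> p k x)"
    if k: "k < n" and x: "x \<in> space (PiM {..<k} (\<lambda>_. \<rho>))" for k x
  proof -
    let ?B = "\<lambda>y. rank_one_update I 1 (Y y) (?A x k)"
    have eq: "?A (x(k := y)) (Suc k) = ?B y" for y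
      using sample_op_cong[of k "x(k := y)" x I Y c 1] by simp
    let ?g = "qform I (?A x k ^^ (p - 1))"
    have g0: "0 \<le> ?g u" for u by (rule log_convex_seq.nonneg[OF lc])
    have e3: "(1 + R / c) ^ (p - 1) \<le> 3"
    proof -
      have "R / c = 1 / real p" using R_pos by (simp add: c_def)
      have "(1 + 1 / real p) ^ (p - 1) \<le> (1 + 1 / real p) ^ p"
        by (rule power_increasing) auto
      also have "\<dots> \<le> exp (1 / real p) ^ p"
        by (intro power_mono exp_ge_add_one_self) auto
      also have "\<dots> = exp 1" using p1 by (simp flip: exp_of_nat_mult)
      also have "\<dots> \<le> 3" by (rule exp_le)
      finally show ?thesis by (simp add: \<open>R / c = 1 / real p\<close>)
    qed
    have pw: "\<Phi> p (Suc k) (x(k := y)) \<le> \<Phi> p k x + 3 * real p * ?g (Y y)" if y: "y \<in> space \<rho>" for y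
    proof -
      have "op_trace I (?B y ^^ p) \<le> op_trace I (?A x k ^^ p) + real p * (1 + R / c) ^ (p - 1) * ?g (Y y)"
        by (rule op_trace_update_plus[OF sA lowA c0 refl bound[OF y]])
      also have "real p * (1 + R / c) ^ (p - 1) * ?g (Y y) \<le> real p * 3 * ?g (Y y)"
        by (intro mult_right_mono mult_left_mono e3 g0) auto
      finally show ?thesis unfolding Phi_trace eq by (simp add: mult_ac)
    qed
    have sP: "sym_op I (?A x k ^^ (p - 1))" by (rule sym_op_funpow[OF sA])
    have "\<Phi> p k x + 3 * real p * (\<Sum>i\<in>I. l i * ?g (basis_vec i)) \<le> q * \<Phi> p k x"
    proof -
      have "(\<Sum>i\<in>I. l i * ?g (basis_vec i))
          = (\<Sum>i\<in>I. l i * (?g (basis_vec i) - c ^ (p - 1))) + (\<Sum>i\<in>I. l i) * c ^ (p - 1)"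
        by (simp add: right_diff_distrib sum_subtractf sum_distrib_right)
      also have "\<dots> \<le> (\<Sum>i\<in>I. M * (?g (basis_vec i) - c ^ (p - 1))) + R * c ^ (p - 1)"
        using growu[of _ "p - 1" x k] M sum_second_moment_le c0
        by (intro add_mono sum_mono mult_right_mono) auto
      also have "\<dots> = M * \<Phi> (p - 1) k x"
        using M by (simp add: \<Phi>_def d_def sum_distrib_left algebra_simps)
      also have "\<dots> \<le> M * (\<Phi> p k x / c)"
      proof -
        have "c * (?g (basis_vec i) - c ^ (p - 1)) \<le> qform I (?A x k ^^ p) (basis_vec i) - c ^ p" for i
          using grow[of "p - 1" x k "basis_vec i"] p1 by (cases p) (simp_all add: algebra_simps)
        then have "c * \<Phi> (p - 1) k x \<le> \<Phi> p k x"
          unfolding \<Phi>_def distrib_left sum_distrib_left using p1 c0 d0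
          by (intro add_mono sum_mono) (cases p, auto)+
        then show ?thesis using M c0 by (intro mult_left_mono) (simp_all add: field_simps)
      qed
      finally have "3 * real p * (\<Sum>i\<in>I. l i * ?g (basis_vec i)) \<le> 3 * real p * (M * (\<Phi> p k x / c))"
        by (intro mult_left_mono) auto
      also have "\<dots> = 3 * M / R * \<Phi> p k x" using p1 by (simp add: c_def)
      finally show ?thesis by (simp add: q_def algebra_simps)
    qed
    then show ?thesis
      by (intro nn_integral_le_affine_qform[where b = "3 * real p", OF sP Phi_nn _ _ q0]) (use pw in auto)
  qed
  have mF: "\<Phi> p k \<in> borel_measurable (PiM {..<k} (\<lambda>_. \<rho>))" for k
    unfolding Phi_trace[abs_def]
    by (intro borel_measurable_add borel_measurable_diff measurable_trace_PiM borel_measurable_const) simp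
  have F0: "\<Phi> p 0 x \<le> d * c ^ p" for x
    unfolding Phi_trace trace_sample_op_0[OF fin] by simp
  define G where "G = {x \<in> space (PiM {..<n} (\<lambda>_. \<rho>)). \<Phi> p n x < a}"
  have f0: "0 \<le> d * c ^ p" using c0 d0 by simp
  note Q = prob_PiM_contraction[where F = "\<Phi> p" and q = q and init = "d * c ^ p",
      OF prob_space_axioms mF step F0 f0 q0 a0]
  have P1: "G \<in> sets (PiM {..<n} (\<lambda>_. \<rho>))" unfolding G_def by (rule Q(1))
  have P2: "1 - q ^ n * (d * c ^ p) / a \<le> measure (PiM {..<n} (\<lambda>_. \<rho>)) G"
    unfolding G_def by (rule Q(2))
  have num: "q ^ n * (d * c ^ p) / a \<le> \<delta>"
  proof -
    have "q ^ n \<le> exp (3 * M / R) ^ n"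
      using exp_ge_add_one_self[of "3 * M / R"] q0 by (intro power_mono) (auto simp: q_def)
    also have "\<dots> = exp (3 * \<kappa>)" by (simp add: \<kappa>_def mult_ac flip: exp_of_nat_mult)
    finally have q1: "q ^ n \<le> exp (3 * \<kappa>)" .
    have n8: "8 * real n \<le> exp \<kappa>" 
    proof -
      have "exp (ln (8 * real n)) \<le> exp \<kappa>" using kap by simp
      then show ?thesis using n by simp
    qed
    have "d = real n / \<kappa>" using n M R_pos by (simp add: d_def \<kappa>_def)
    also have "\<dots> \<le> real n / 2" using kap2 by (intro divide_left_mono) auto
    also have "\<dots> \<le> exp \<kappa> / 16" using n8 by simp
    finally have d1: "d \<le> exp \<kappa> / 16" .
    have "4 / \<delta> \<le> t / c"
    proof -
      have "t / c = 14 * \<kappa> / (real p * \<delta>)" using R_pos by (simp add: t_def c_def \<kappa>_def mult_ac)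
      moreover have "4 * real p \<le> 14 * \<kappa>" using p(2) kap2 by simp
      then have "4 / \<delta> \<le> 14 * \<kappa> / (real p * \<delta>)" using p1 \<delta> by (simp add: field_simps)
      ultimately show ?thesis by simp
    qed
    then have "(1 + 4 / \<delta>) ^ p \<le> (1 + t / c) ^ p" using \<delta> by (intro power_mono) auto
    moreover have "4 / \<delta> * 5 ^ (p - 1) \<le> (1 + 4 / \<delta>) ^ p - 1"
    proof -
      have "(5::real) \<le> 1 + 4 / \<delta>" using \<delta> by (simp add: field_simps)
      then have "(1 + 4 / \<delta>) * 5 ^ (p - 1) \<le> (1 + 4 / \<delta>) * (1 + 4 / \<delta>) ^ (p - 1)"
        using \<delta> by (intro mult_left_mono power_mono) auto
      also have "\<dots> = (1 + 4 / \<delta>) ^ p" using p1 by (cases p) auto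
      finally have "(1 + 4 / \<delta>) * 5 ^ (p - 1) \<le> (1 + 4 / \<delta>) ^ p" .
      moreover have "(1::real) \<le> 5 ^ (p - 1)" by (rule one_le_power) simp
      ultimately show ?thesis unfolding distrib_right by linarith
    qed
    moreover have "exp (4 * \<kappa>) \<le> 5 ^ p"
    proof -
      have e4: "exp (4::real) \<le> 5 ^ 3"
      proof -
        have "exp (4::real) = exp 1 ^ 4" by (simp flip: exp_of_nat_mult)
        also have "\<dots> \<le> 3 ^ 4" by (intro power_mono exp_le) simp
        finally show ?thesis by simp
      qed
      have "4 * \<kappa> \<le> 4 / 3 * real p" using p(1) by simp
      then have "exp (4 * \<kappa>) ^ 3 \<le> exp (4 / 3 * real p) ^ 3" by (intro power_mono) auto
      also have "\<dots> = exp 4 ^ p" by (simp flip: exp_of_nat_mult)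
      also have "\<dots> \<le> (5 ^ 3) ^ p" using e4 by (intro power_mono) auto
      also have "\<dots> = (5 ^ p) ^ 3" by (simp only: power_mult[symmetric] mult.commute)
      finally show ?thesis by (subst (asm) power_mono_iff) auto
    qed
    moreover have "(5::real) ^ p = 5 * 5 ^ (p - 1)" using p1 by (cases p) auto
    ultimately have "4 / \<delta> * (exp (4 * \<kappa>) / 5) \<le> (1 + t / c) ^ p - 1"
      using \<delta> mult_left_mono[of "exp (4 * \<kappa>) / 5" "5 ^ (p - 1)" "4 / \<delta>"] by simp
    also have "\<dots> = a / c ^ p" using c0 by (simp add: a_def field_simps flip: power_mult_distrib)
    finally have a1: "4 / \<delta> * (exp (4 * \<kappa>) / 5) * c ^ p \<le> a" using c0 by (simp add: field_simps)
    have "q ^ n * (d * c ^ p) \<le> exp (3 * \<kappa>) * (exp \<kappa> / 16 * c ^ p)"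
      using q1 d1 d0 c0 by (intro mult_mono) auto
    also have "\<dots> = exp (4 * \<kappa>) / 16 * c ^ p" by (simp add: mult_ac flip: exp_add)
    also have "\<dots> \<le> \<delta> * (4 / \<delta> * (exp (4 * \<kappa>) / 5) * c ^ p)"
      using \<delta> c0 by simp
    also have "\<dots> \<le> \<delta> * a" using a1 \<delta> by (intro mult_left_mono) auto
    finally show ?thesis using a0 by (simp add: field_simps)
  qed
  show ?thesis
  proof (rule that)
    show "G \<in> sets (PiM {..<n} (\<lambda>_. \<rho>))" by (rule P1)
    show "measure (PiM {..<n} (\<lambda>_. \<rho>)) G \<ge> 1 - \<delta>" using P2 num by linarith
    fix x u assume "x \<in> G"
    then have x: "x \<in> space (PiM {..<n} (\<lambda>_. \<rho>))" and Fa: "\<Phi> p n x < a" by (auto simp: G_def)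
    let ?S = "\<Sum>k<n. (cmod (cip I u (Y (x k))))\<^sup>2"
    have "?S \<le> t * sqn I u"
    proof (rule ccontr)
      assume "\<not> ?thesis"
      then have lt: "t * sqn I u < ?S" by simp
      then have s0: "sqn I u > 0"
        using sum_cip_bounds(2)[OF x, of u] sqn_nonneg[of I u] by (cases "sqn I u = 0") auto
      \<comment> \<open>A vector on which \<open>S\<close> is large makes the trace of this positive operator large.\<close>
      define P where "P = (\<lambda>v i. (?A x n ^^ p) v i - of_real (c ^ p) * v i)"
      have qP: "qform I P v = qform I (?A x n ^^ p) v - c ^ p * sqn I v" for v
        using cip_add_left[of I "(?A x n ^^ p) v" "\<lambda>i. of_real (- (c ^ p)) * v i" v]
          cip_scale_left[of I "of_real (- (c ^ p))" v v]
        by (simp add: P_def qform_def cip_self flip: of_real_power)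
      have sP: "sym_op I P"
      proof -
        have "cip I (P v) w = cip I v (P w)" for v w
        proof -
          have "cip I (P v) w = cip I ((?A x n ^^ p) v) w - of_real (c ^ p) * cip I v w"
            by (simp add: P_def cip_def algebra_simps sum_subtractf sum_distrib_left)
          also have "cip I ((?A x n ^^ p) v) w = cip I v ((?A x n ^^ p) w)"
            by (rule sym_opD[OF sym_op_funpow[OF sA]])
          also have "\<dots> - of_real (c ^ p) * cip I v w = cip I v (P w)"
            by (simp add: P_def cip_def algebra_simps sum_subtractf sum_distrib_left)
          finally show ?thesis .
        qed
        then show ?thesis using fin by (simp add: sym_op_def)
      qed
      have "(c + t) ^ p * sqn I u \<le> qform I (?A x n ^^ p) u"
        using log_convex_seq.growth_power[OF lc, of "c + t" x n u p] c0 t0 lt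
        by (simp add: qform_sample_op algebra_simps)
      then have "a * sqn I u \<le> qform I P u" by (simp add: a_def qP algebra_simps)
      also have "\<dots> \<le> op_trace I P * sqn I u"
        by (rule qform_le_trace[OF sP]) (simp add: qP growp)
      also have "op_trace I P \<le> \<Phi> p n x"
        using d0 c0 by (simp add: op_trace_def qP \<Phi>_def sqn_basis_vec[OF fin])
      finally show False using s0 Fa by simp
    qed
    then show "?S \<le> 14 * real n * M / \<delta> * sqn I u" by (simp add: t_def)
  qed
qed

end

section \<open>Hilbert spaces of functions\<close>

sublocale function_hilbert_space \<subseteq> psd_form H ip
  by unfold_locales (auto intro: subspace_H ip_add_left ip_scale_left ip_commute ip_nonneg)

context function_hilbert_space
begin

lemma hnorm_eq: "hnorm ip f = sqrt (sq f)" by (simp add: hnorm_def)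

lemma complete_sq:
  assumes "\<And>i. u i \<in> H" "\<And>\<epsilon>. \<epsilon> > 0 \<Longrightarrow> \<exists>N. \<forall>p\<ge>N. \<forall>r\<ge>N. sq (u p - u r) < \<epsilon>"
  obtains f where "f \<in> H" "(\<lambda>i. sqrt (sq (u i - f))) \<longlonglongrightarrow> 0"
proof -
  have "\<exists>N. \<forall>p\<ge>N. \<forall>r\<ge>N. hnorm ip (u p - u r) < \<epsilon>" if "\<epsilon> > 0" for \<epsilon>
  proof -
    have "\<epsilon>\<^sup>2 > 0" using that by simp
    from assms(2)[OF this] obtain N where "\<forall>p\<ge>N. \<forall>r\<ge>N. sq (u p - u r) < \<epsilon>\<^sup>2" by blast
    then have "\<forall>p\<ge>N. \<forall>r\<ge>N. hnorm ip (u p - u r) < \<epsilon>"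
      using that real_sqrt_less_mono[of _ "\<epsilon>\<^sup>2"] by (auto simp: hnorm_eq)
    then show ?thesis ..
  qed
  from complete_H[OF assms(1) this] show ?thesis using that by (auto simp: hnorm_eq)
qed

text \<open>
  Minimise \<open>J h = \<parallel>h\<parallel>\<^sup>2 - 2 Re (\<phi> h)\<close>. By the parallelogram law a minimising sequence is a Cauchy sequence, and
  the first variation of \<open>J\<close> at its limit is the required identity.
\<close>

lemma riesz:
  assumes add: "\<And>f g. f \<in> H \<Longrightarrow> g \<in> H \<Longrightarrow> \<phi> (f + g) = \<phi> f + \<phi> g"
    and scale: "\<And>c f. f \<in> H \<Longrightarrow> \<phi> (cscale c f) = c * \<phi> f"
    and bounded: "\<And>f. f \<in> H \<Longrightarrow> cmod (\<phi> f) \<le> B * sqrt (sq f)"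
  shows "\<exists>h\<in>H. \<forall>f\<in>H. \<phi> f = ip f h"
proof -
  define J where "J = (\<lambda>h. sq h - 2 * Re (\<phi> h))"
  have J_low: "- B\<^sup>2 \<le> J h" if "h \<in> H" for h
  proof -
    have "Re (\<phi> h) \<le> B * sqrt (sq h)"
      using bounded[OF that] complex_Re_le_cmod[of "\<phi> h"] by linarith
    moreover have "0 \<le> (sqrt (sq h) - B)\<^sup>2" by simp
    ultimately show ?thesis using nonneg[OF that] by (simp add: J_def power2_diff mult_ac)
  qed
  have bdd: "bdd_below (J ` H)" using J_low by (intro bdd_belowI2) auto
  define m where "m = (INF h\<in>H. J h)"
  have m: "m \<le> J h" if "h \<in> H" for h unfolding m_def by (rule cINF_lower[OF bdd that])
  have "\<exists>h\<in>H. J h < m + 1 / real (Suc i)" for i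
  proof -
    have ne: "H \<noteq> {}" using zero_mem by blast
    have "m < m + 1 / real (Suc i)" by simp
    then show ?thesis using cINF_less_iff[OF ne bdd] unfolding m_def by blast
  qed
  then obtain u where u: "\<And>i. u i \<in> H" "\<And>i. J (u i) < m + 1 / real (Suc i)" by metis
  have cauchy: "sq (u i - u j) \<le> 2 / real (Suc i) + 2 / real (Suc j)" for i j
  proof -
    define w where "w = cscale (1/2) (u i + u j)"
    have sq_w: "sq w = sq (u i + u j) / 4"
      using sq_scale[of "u i + u j" "1/2"] u(1) by (simp add: w_def power2_eq_square norm_divide)
    have phi_w: "Re (\<phi> w) = (Re (\<phi> (u i)) + Re (\<phi> (u j))) / 2"
    proof -
      have "\<phi> w = of_real (1/2) * (\<phi> (u i) + \<phi> (u j))"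
        using scale[of "u i + u j" "1/2"] add[OF u(1) u(1), of i j] u(1) by (simp add: w_def)
      then show ?thesis by (simp only: Re_complex_of_real times_complex.sel plus_complex.sel Im_complex_of_real)
    qed
    have "4 * J w = 2 * J (u i) + 2 * J (u j) - sq (u i - u j)"
    proof -
      have arith: "4 * (W - 2 * F) = 2 * (p - 2 * a) + 2 * (r - 2 * b) - d"
        if "W = S / 4" "F = (a + b) / 2" "S + d = 2 * p + 2 * r" for W F p r a b d S :: real
        using that by (simp add: field_simps)
      show ?thesis unfolding J_def by (rule arith[OF sq_w phi_w parallelogram[OF u(1) u(1)]])
    qed
    moreover have "m \<le> J w" by (rule m) (use u(1) in \<open>simp add: w_def\<close>)
    ultimately show ?thesis using u(2)[of i] u(2)[of j] by simp
  qed
  have "\<exists>N. \<forall>p\<ge>N. \<forall>r\<ge>N. sq (u p - u r) < \<epsilon>" if e: "\<epsilon> > 0" for \<epsilon>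
  proof -
    obtain N where N: "1 / real (Suc N) < \<epsilon> / 4"
      using nat_approx_posE[of "\<epsilon> / 4"] e by auto
    have "sq (u p - u r) < \<epsilon>" if "N \<le> p" "N \<le> r" for p r
    proof -
      have "1 / real (Suc p) \<le> 1 / real (Suc N)" "1 / real (Suc r) \<le> 1 / real (Suc N)"
        using that by (auto simp: frac_le)
      then show ?thesis using cauchy[of p r] N by simp
    qed
    then show ?thesis by blast
  qed
  from complete_sq[OF u(1) this]
  obtain h where h: "h \<in> H" "(\<lambda>i. sqrt (sq (u i - h))) \<longlonglongrightarrow> 0" .
  have "\<phi> f = ip f h" if f: "f \<in> H" for f
  proof -
    define z where "z = ip h f - cnj (\<phi> f)"
    have "0 \<le> 2 * Re (cnj c * z) + (cmod c)\<^sup>2 * sq f" for c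
    proof (rule LIMSEQ_le_const)
      have "(\<lambda>i. 2 * Re (cnj c * ip (u i) f) - 2 * Re (c * \<phi> f) + (cmod c)\<^sup>2 * sq f + 1 / real (Suc i))
        \<longlonglongrightarrow> 2 * Re (cnj c * ip h f) - 2 * Re (c * \<phi> f) + (cmod c)\<^sup>2 * sq f + 0"
        by (intro tendsto_intros tendsto_left u h f LIMSEQ_Suc[OF lim_inverse_n', unfolded o_def])
      moreover have "2 * Re (cnj c * ip h f) - 2 * Re (c * \<phi> f) + (cmod c)\<^sup>2 * sq f + 0
          = 2 * Re (cnj c * z) + (cmod c)\<^sup>2 * sq f"
        by (simp add: z_def algebra_simps)
      ultimately show "(\<lambda>i. 2 * Re (cnj c * ip (u i) f) - 2 * Re (c * \<phi> f) + (cmod c)\<^sup>2 * sq f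
          + 1 / real (Suc i)) \<longlonglongrightarrow> 2 * Re (cnj c * z) + (cmod c)\<^sup>2 * sq f"
        by (simp only:)
      show "\<exists>N. \<forall>i\<ge>N. 0 \<le> 2 * Re (cnj c * ip (u i) f) - 2 * Re (c * \<phi> f) + (cmod c)\<^sup>2 * sq f
          + 1 / real (Suc i)"
      proof (intro exI allI impI)
        fix i
        have "m \<le> J (u i + cscale c f)" by (rule m) (use u(1) f in simp)
        then show "0 \<le> 2 * Re (cnj c * ip (u i) f) - 2 * Re (c * \<phi> f) + (cmod c)\<^sup>2 * sq f
            + 1 / real (Suc i)"
          using u(2)[of i] sq_line[OF u(1)[of i] f, of c] add[OF u(1)[of i] scale_mem[OF f], of c]
            scale[OF f, of c]
          by (simp only: J_def) (simp add: algebra_simps)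
      qed
    qed
    note var = this
    have "z = 0"
    proof (rule ccontr)
      assume nz: "z \<noteq> 0"
      \<comment> \<open>Testing with \<open>c = - s z\<close> makes the linear term dominate the quadratic one.\<close>
      define s where "s = 1 / (1 + sq f)"
      have s: "0 < s" "s * sq f < 1" using nonneg[OF f] by (auto simp: s_def field_simps)
      have "0 \<le> 2 * Re (cnj (- of_real s * z) * z) + (cmod (- of_real s * z))\<^sup>2 * sq f" by (rule var)
      also have "cnj (- of_real s * z) * z = of_real (- s * (cmod z)\<^sup>2)"
        using complex_norm_square[of z] by (simp add: mult.commute)
      also have "2 * Re (of_real (- s * (cmod z)\<^sup>2)) + (cmod (- of_real s * z))\<^sup>2 * sq f
          = s * (cmod z)\<^sup>2 * (s * sq f - 2)"
        using s by (simp add: norm_mult power_mult_distrib power2_eq_square algebra_simps del: of_real_mult)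
      finally have "0 \<le> s * (cmod z)\<^sup>2 * (s * sq f - 2)" .
      moreover have "s * (cmod z)\<^sup>2 > 0" using s nz by simp
      ultimately show False using s(2) by (simp add: zero_le_mult_iff)
    qed
    then have "cnj (\<phi> f) = ip h f" by (simp add: z_def)
    then show ?thesis unfolding commute[OF h(1) f] by (metis complex_cnj_cnj)
  qed
  then show ?thesis using h(1) by blast
qed

end

section \<open>The embedding into the space of square-integrable functions\<close>

(* Keeps the side conditions 1 <= k on eigenvalue indices in the form in which they are stated. *)
declare One_nat_def [simp del]

lemma sum_fun_apply: "(sum g A) x = (\<Sum>k\<in>A. g k x)" for g :: "'b \<Rightarrow> 'a \<Rightarrow> complex"
  by (induction A rule: infinite_finite_induct) auto

context psd_form
begin

lemma sq_sum_orthogonal: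
  assumes "finite A" "\<And>k. k \<in> A \<Longrightarrow> g k \<in> V"
    "\<And>j k. j \<in> A \<Longrightarrow> k \<in> A \<Longrightarrow> j \<noteq> k \<Longrightarrow> q (g j) (g k) = 0"
  shows "sq (sum g A) = (\<Sum>k\<in>A. sq (g k))"
  using assms
proof (induction A rule: finite_induct)
  case empty
  show ?case unfolding sum.empty by (simp only: zero_left[OF zero_mem] zero_complex.sel)
next
  case (insert x A)
  have m: "g x \<in> V" "sum g A \<in> V" using insert.prems(1) by (auto intro: sum_mem)
  have "q (sum g A) (g x) = (\<Sum>k\<in>A. q (g k) (g x))"
    using insert.prems(1) by (intro sum_left) auto
  also have "\<dots> = 0" using insert.prems(2) insert.hyps(2) by (intro sum.neutral) auto
  finally have z: "q (sum g A) (g x) = 0" .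
  have c1: "cscale 1 (g x) = g x" by (simp add: cscale_def)
  have "sq (sum g A + g x) = sq (sum g A) + sq (g x)"
    using sq_line[OF m(2) m(1), of 1] unfolding c1 z by simp
  moreover have "sq (sum g A) = (\<Sum>k\<in>A. sq (g k))" using insert.prems by (intro insert.IH) auto
  ultimately show ?case by (simp only: sum.insert[OF insert.hyps(1,2)] add.commute)
qed

end

text \<open>
  The constant \<open>B\<close> bounds the kernel on the diagonal, hence all point evaluations.
\<close>

locale rkhs_L2 = rkhs D K H ip + prob_space \<rho>
  for D :: "'a set" and K H ip and \<rho> :: "'a measure" +
  fixes B :: real and lam :: "nat \<Rightarrow> real" and e :: "nat \<Rightarrow> 'a \<Rightarrow> complex"
  assumes space_rho: "space \<rho> = D"
    and meas_H: "f \<in> H \<Longrightarrow> f \<in> borel_measurable \<rho>"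
    and separable: "hseparable H ip"
    and K_bound: "x \<in> D \<Longrightarrow> Re (K x x) \<le> B"
    and eigen: "eigensystem \<rho> H ip lam e"
begin

definition kfun :: "'a \<Rightarrow> 'a \<Rightarrow> complex" where
  "kfun x = (\<lambda>y. if y \<in> D then K y x else 0)"

lemma kfun_mem: "x \<in> D \<Longrightarrow> kfun x \<in> H"
  unfolding kfun_def by (rule kernel_mem)

lemma eval_eq: "f \<in> H \<Longrightarrow> x \<in> D \<Longrightarrow> f x = ip f (kfun x)"
  unfolding kfun_def by (rule reproducing)

lemma sq_kfun: "x \<in> D \<Longrightarrow> sq (kfun x) \<le> B"
  using eval_eq[OF kfun_mem, of x x] K_bound[of x] by (simp add: kfun_def)

lemma B_nonneg: "0 \<le> B"
proof -
  obtain x where "x \<in> D" using not_empty space_rho by blast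
  then show ?thesis using nonneg[OF kfun_mem[of x]] sq_kfun[of x] by linarith
qed

lemma eval_bound:
  assumes "f \<in> H" "x \<in> D"
  shows "(cmod (f x))\<^sup>2 \<le> B * sq f"
proof -
  have "(cmod (f x))\<^sup>2 \<le> sq f * sq (kfun x)"
    unfolding eval_eq[OF assms] by (rule CS[OF assms(1) kfun_mem[OF assms(2)]])
  also have "\<dots> \<le> sq f * B" by (intro mult_left_mono sq_kfun assms nonneg)
  finally show ?thesis by (simp add: mult.commute)
qed

lemma eval_tendsto:
  assumes "\<And>i. u i \<in> H" "f \<in> H" "(\<lambda>i. sqrt (sq (u i - f))) \<longlonglongrightarrow> 0" "x \<in> D"
  shows "(\<lambda>i. u i x) \<longlonglongrightarrow> f x"
  using tendsto_left[OF assms(1,2) kfun_mem[OF assms(4)] assms(3)] eval_eq assms by simp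

lemma integrable_prod:
  assumes "f \<in> H" "g \<in> H"
  shows "integrable \<rho> (\<lambda>x. f x * cnj (g x))"
proof (rule integrable_const_bound)
  note [measurable] = meas_H[OF assms(1)] meas_H[OF assms(2)]
  show "(\<lambda>x. f x * cnj (g x)) \<in> borel_measurable \<rho>" by measurable
  show "AE x in \<rho>. cmod (f x * cnj (g x)) \<le> sqrt (B * sq f) * sqrt (B * sq g)"
  proof (rule AE_I2)
    fix x assume "x \<in> space \<rho>"
    then have x: "x \<in> D" by (simp add: space_rho)
    have "cmod (f x) \<le> sqrt (B * sq f)" "cmod (g x) \<le> sqrt (B * sq g)"
      using eval_bound[OF assms(1) x] eval_bound[OF assms(2) x] by (auto intro: real_le_rsqrt)
    then show "cmod (f x * cnj (g x)) \<le> sqrt (B * sq f) * sqrt (B * sq g)"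
      unfolding norm_mult complex_mod_cnj
      by (intro mult_mono) (auto simp: B_nonneg nonneg assms)
  qed
qed

sublocale L2: psd_form H "L2_inner \<rho>"
proof
  show "cfun.subspace H" by (rule subspace_V)
  show "L2_inner \<rho> (f + g) h = L2_inner \<rho> f h + L2_inner \<rho> g h"
    if "f \<in> H" "g \<in> H" "h \<in> H" for f g h
    using integrable_prod[OF that(1,3)] integrable_prod[OF that(2,3)]
    by (simp add: L2_inner_def distrib_right)
  show "L2_inner \<rho> (cscale c f) g = c * L2_inner \<rho> f g" for c f g
    by (simp add: L2_inner_def cscale_def mult.assoc)
  show "L2_inner \<rho> g f = cnj (L2_inner \<rho> f g)" for f g
  proof -
    have "L2_inner \<rho> g f = (\<integral>x. cnj (f x * cnj (g x)) \<partial>\<rho>)"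
      by (simp add: L2_inner_def mult.commute del: Bochner_Integration.integral_cnj)
    also have "\<dots> = cnj (\<integral>x. f x * cnj (g x) \<partial>\<rho>)" by (rule Bochner_Integration.integral_cnj)
    finally show ?thesis by (simp only: L2_inner_def)
  qed
  show "0 \<le> Re (L2_inner \<rho> f f)" if "f \<in> H" for f
  proof -
    have "L2_inner \<rho> f f = of_real (\<integral>x. (cmod (f x))\<^sup>2 \<partial>\<rho>)"
      unfolding L2_inner_def mult_cnj_self by (rule integral_complex_of_real)
    then show ?thesis by simp
  qed
qed

lemma L2_sq: "L2.sq f = (\<integral>x. (cmod (f x))\<^sup>2 \<partial>\<rho>)"
proof -
  have "L2_inner \<rho> f f = of_real (\<integral>x. (cmod (f x))\<^sup>2 \<partial>\<rho>)"
    unfolding L2_inner_def mult_cnj_self by (rule integral_complex_of_real)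
  then show ?thesis by (simp only: Re_complex_of_real)
qed

lemma integrable_sq: "f \<in> H \<Longrightarrow> integrable \<rho> (\<lambda>x. (cmod (f x))\<^sup>2)"
  using integrable_Re[OF integrable_prod[of f f]] by (simp only: mult_cnj_self Re_complex_of_real)

lemma L2_le: "f \<in> H \<Longrightarrow> L2.sq f \<le> B * sq f"
  unfolding L2_sq
  by (rule integral_le_const[OF integrable_sq]) (auto intro!: AE_I2 eval_bound simp: space_rho)

abbreviation W :: "('a \<Rightarrow> complex) \<Rightarrow> 'a \<Rightarrow> complex" where "W \<equiv> Id_adjoint \<rho> H ip"

text \<open>
  The definite description in the adjoint denotes the Riesz representer, so that the hypothesis on the
  eigensystem can be used.
\<close>

lemma W:
  assumes f: "f \<in> H"
  shows W_mem: "W f \<in> H" and W_eq: "g \<in> H \<Longrightarrow> ip g (W f) = L2_inner \<rho> g f"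
proof -
  have bd: "cmod (L2_inner \<rho> g f) \<le> sqrt (B * L2.sq f) * sqrt (sq g)" if g: "g \<in> H" for g
  proof -
    have "cmod (L2_inner \<rho> g f) \<le> sqrt (L2.sq g) * sqrt (L2.sq f)" by (rule L2.CS_sqrt[OF g f])
    also have "\<dots> \<le> sqrt (B * sq g) * sqrt (L2.sq f)"
      by (intro mult_right_mono real_sqrt_le_mono L2_le g) (simp add: L2.nonneg f)
    finally show ?thesis by (simp add: real_sqrt_mult mult_ac)
  qed
  have "\<exists>h\<in>H. \<forall>g\<in>H. L2_inner \<rho> g f = ip g h"
  proof (rule riesz)
    show "L2_inner \<rho> (g + h) f = L2_inner \<rho> g f + L2_inner \<rho> h f" if "g \<in> H" "h \<in> H" for g h
      by (rule L2.add_left[OF that f])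
    show "L2_inner \<rho> (cscale c g) f = c * L2_inner \<rho> g f" if "g \<in> H" for c g
      by (rule L2.scale_left[OF that f])
  qed (rule bd)
  then obtain h where h: "h \<in> H" "\<forall>g\<in>H. ip g h = L2_inner \<rho> g f" by metis
  have "W f = h" unfolding Id_adjoint_def
  proof (rule the_equality)
    show "h \<in> H \<and> (\<forall>g\<in>H. ip g h = L2_inner \<rho> g f)" using h by simp
    fix h' assume h': "h' \<in> H \<and> (\<forall>g\<in>H. ip g h' = L2_inner \<rho> g f)"
    have "ip (h' - h) (h' - h) = 0"
      using h h' diff_right[of h' h "h' - h"] by simp
    then have "h' - h = 0" using h h' by (intro ip_eq_zero) simp_all
    then show "h' = h" by simp
  qed
  then show "W f \<in> H" "g \<in> H \<Longrightarrow> ip g (W f) = L2_inner \<rho> g f" using h by simp_all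
qed

lemma sq_W_le:
  assumes f: "f \<in> H"
  shows "sq (W f) \<le> B * L2.sq f"
proof (cases "sq (W f) = 0")
  case True
  then show ?thesis using B_nonneg L2.nonneg[OF f] by simp
next
  case False
  then have pos: "sq (W f) > 0" using nonneg[OF W_mem[OF f]] by simp
  have "(sq (W f))\<^sup>2 \<le> (cmod (L2_inner \<rho> (W f) f))\<^sup>2"
    unfolding W_eq[OF f W_mem[OF f], symmetric] by (intro power_mono complex_Re_le_cmod nonneg W_mem f)
  also have "\<dots> \<le> L2.sq (W f) * L2.sq f" by (rule L2.CS[OF W_mem[OF f] f])
  also have "\<dots> \<le> B * sq (W f) * L2.sq f" by (intro mult_right_mono L2_le W_mem f L2.nonneg)
  finally show ?thesis using pos by (simp add: power2_eq_square)
qed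

lemma W_diff:
  assumes "f \<in> H" "g \<in> H"
  shows "W (f - g) = W f - W g"
proof -
  have 1: "W (f - g) - (W f - W g) \<in> H" using assms by (simp add: W_mem)
  have "ip h (W (f - g) - (W f - W g)) = 0" if h: "h \<in> H" for h
    using assms h by (simp add: diff_right W_mem W_eq L2.diff_right)
  from ip_eq_zero[OF 1 this[OF 1]] show ?thesis by simp
qed

subsection \<open>Compactness\<close>

text \<open>
  A diagonal argument over a countable dense set; convergence of the inner products with the dense set
  extends to the kernel functions, that is, to point evaluations.
\<close>

lemma weakly_convergent_subsequence:
  fixes u :: "nat \<Rightarrow> 'a \<Rightarrow> complex"
  assumes u: "\<And>i. u i \<in> H" "\<And>i. sq (u i) \<le> 1"
  obtains r where "strict_mono r" "\<forall>x\<in>D. convergent (\<lambda>i. u (r i) x)"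
proof -
  obtain S where S: "countable S" "S \<subseteq> H" "\<And>f \<epsilon>. f \<in> H \<Longrightarrow> \<epsilon> > 0 \<Longrightarrow> \<exists>g\<in>S. hnorm ip (f - g) < \<epsilon>"
    using separable unfolding hseparable_def by blast
  have "S \<noteq> {}" using S(3)[of 0 1] zero_mem by auto
  define g where "g = from_nat_into S"
  have g: "range g = S" unfolding g_def by (rule range_from_nat_into[OF \<open>S \<noteq> {}\<close> S(1)])
  have gH: "g n \<in> H" for n using g S(2) by auto
  define P where "P = (\<lambda>n (s :: nat \<Rightarrow> nat). convergent (\<lambda>i. ip (u (s i)) (g n)))"
  interpret subseqs P
  proof
    fix n and s :: "nat \<Rightarrow> nat" assume "strict_mono s"
    have "cmod (ip (u (s i)) (g n)) \<le> sqrt (sq (g n))" for i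
    proof -
      have "cmod (ip (u (s i)) (g n)) \<le> sqrt (sq (u (s i))) * sqrt (sq (g n))"
        by (rule CS_sqrt[OF u(1) gH])
      also have "\<dots> \<le> 1 * sqrt (sq (g n))" using u(2) nonneg[OF gH] by (intro mult_right_mono) auto
      finally show ?thesis by simp
    qed
    then have "bounded (range (\<lambda>i. ip (u (s i)) (g n)))" by (auto simp: bounded_iff)
    from bounded_imp_convergent_subsequence[OF this]
    obtain l r where "strict_mono r" "((\<lambda>i. ip (u (s i)) (g n)) \<circ> r) \<longlonglongrightarrow> l" by blast
    then have "strict_mono r \<and> P n (s \<circ> r)" by (auto simp: P_def o_def convergent_def)
    then show "\<exists>r'. strict_mono r' \<and> P n (s \<circ> r')" by blast
  qed
  have conv: "convergent (\<lambda>i. ip (u (diagseq i)) (g n))" for n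
  proof -
    have "P n (diagseq \<circ> ((+) (Suc n)))"
    proof (rule diagseq_holds)
      fix r s :: "nat \<Rightarrow> nat" and n assume "strict_mono r" "P n s"
      then obtain l where "(\<lambda>i. ip (u (s i)) (g n)) \<longlonglongrightarrow> l" by (auto simp: P_def convergent_def)
      from LIMSEQ_subseq_LIMSEQ[OF this \<open>strict_mono r\<close>]
      show "P n (s \<circ> r)" by (auto simp: P_def convergent_def o_def)
    qed
    then have "convergent (\<lambda>i. ip (u (diagseq (i + Suc n))) (g n))"
      by (simp add: P_def o_def add.commute)
    then show ?thesis by (subst (asm) convergent_ignore_initial_segment)
  qed
  have "\<forall>x\<in>D. convergent (\<lambda>i. u (diagseq i) x)"
  proof (intro ballI)
    fix x assume x: "x \<in> D"
    show "convergent (\<lambda>i. u (diagseq i) x)"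
    proof (rule Cauchy_convergent, rule metric_CauchyI)
      fix \<epsilon> :: real assume eps: "\<epsilon> > 0"
      obtain n where n: "sqrt (sq (kfun x - g n)) < \<epsilon> / 4"
        using S(3)[OF kfun_mem[OF x], of "\<epsilon> / 4"] eps g by (auto simp: hnorm_eq)
      have near: "cmod (u i x - ip (u i) (g n)) < \<epsilon> / 4" for i
      proof -
        have "u i x - ip (u i) (g n) = ip (u i) (kfun x - g n)"
          using eval_eq[OF u(1) x] by (simp add: diff_right u kfun_mem x gH)
        moreover have "cmod \<dots> \<le> sqrt (sq (u i)) * sqrt (sq (kfun x - g n))"
          by (rule CS_sqrt) (simp_all add: u kfun_mem x gH)
        moreover have "\<dots> \<le> 1 * sqrt (sq (kfun x - g n))"
          using u(2) nonneg[of "kfun x - g n"] by (intro mult_right_mono) (auto simp: kfun_mem x gH)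
        ultimately show ?thesis using n by simp
      qed
      have "Cauchy (\<lambda>i. ip (u (diagseq i)) (g n))" using conv by (rule convergent_Cauchy)
      from metric_CauchyD[OF this, of "\<epsilon> / 4"] eps
      obtain N where N: "\<And>p q. p \<ge> N \<Longrightarrow> q \<ge> N \<Longrightarrow>
          dist (ip (u (diagseq p)) (g n)) (ip (u (diagseq q)) (g n)) < \<epsilon> / 4" by auto
      show "\<exists>N. \<forall>p\<ge>N. \<forall>q\<ge>N. dist (u (diagseq p) x) (u (diagseq q) x) < \<epsilon>"
      proof (intro exI allI impI)
        fix p q assume pq: "p \<ge> N" "q \<ge> N"
        let ?a = "u (diagseq p) x" and ?b = "ip (u (diagseq p)) (g n)"
          and ?c = "ip (u (diagseq q)) (g n)" and ?d = "u (diagseq q) x"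
        have "dist ?a ?d \<le> dist ?a ?b + dist ?b ?c + dist ?c ?d"
          using dist_triangle[of ?a ?d ?b] dist_triangle[of ?b ?d ?c] by linarith
        moreover have "dist ?a ?b < \<epsilon> / 4" "dist ?c ?d < \<epsilon> / 4"
          using near by (auto simp: dist_norm norm_minus_commute)
        ultimately show "dist ?a ?d < \<epsilon>" using N[OF pq] eps by linarith
      qed
    qed
  qed
  with subseq_diagseq show ?thesis by (rule that)
qed

text \<open>
  Bounded sequences have pointwise convergent subsequences, which converge in \<open>L\<^sub>2(\<rho>)\<close> by dominated
  convergence; and \<open>W\<close> is continuous from the \<open>L\<^sub>2\<close> seminorm to \<open>H\<close>.
\<close>

lemma W_compact:
  fixes u :: "nat \<Rightarrow> 'a \<Rightarrow> complex"
  assumes u: "\<And>i. u i \<in> H" "\<And>i. sq (u i) \<le> 1"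
  obtains r h where "strict_mono r" "h \<in> H" "(\<lambda>i. sqrt (sq (W (u (r i)) - h))) \<longlonglongrightarrow> 0"
proof -
  from weakly_convergent_subsequence[where u = u, OF u]
  obtain r where r: "strict_mono r" "\<forall>x\<in>D. convergent (\<lambda>i. u (r i) x)" .
  define v where "v = (\<lambda>i. u (r i))"
  \<comment> \<open>Convergence is known on \<open>D\<close>, which is the space of \<open>\<rho>\<close>; elsewhere \<open>lim\<close> is a default value.\<close>
  define w where "w = (\<lambda>x. lim (\<lambda>i. v i x))"
  have v: "v i \<in> H" "sq (v i) \<le> 1" for i using u by (auto simp: v_def)
  have lim: "(\<lambda>i. v i x) \<longlonglongrightarrow> w x" if "x \<in> D" for x
    using bspec[OF r(2) that] unfolding w_def v_def by (simp add: convergent_LIMSEQ_iff)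
  note [measurable] = meas_H[OF v(1)]
  have wm [measurable]: "w \<in> borel_measurable \<rho>" unfolding w_def by measurable
  have vb: "cmod (v i x) \<le> sqrt B" if "x \<in> D" for i x
  proof (rule real_le_rsqrt)
    have "(cmod (v i x))\<^sup>2 \<le> B * sq (v i)" by (rule eval_bound[OF v(1) that])
    also have "\<dots> \<le> B * 1" by (intro mult_left_mono v B_nonneg)
    finally show "(cmod (v i x))\<^sup>2 \<le> B" by simp
  qed
  have wb: "cmod (w x) \<le> sqrt B" if "x \<in> D" for x
    by (rule LIMSEQ_le_const2[OF tendsto_norm[OF lim[OF that]]]) (use vb[OF that] in auto)
  have dom: "(cmod (v i x - w x))\<^sup>2 \<le> (2 * sqrt B)\<^sup>2" if "x \<in> D" for i x
    using norm_triangle_ineq4[of "v i x" "w x"] vb[OF that, of i] wb[OF that] by (intro power_mono) auto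
  have int: "integrable \<rho> (\<lambda>x. (cmod (v i x - w x))\<^sup>2)" for i
    by (rule integrable_const_bound[where B = "(2 * sqrt B)\<^sup>2"])
      (use dom in \<open>auto intro!: AE_I2 simp: space_rho\<close>)
  have zero: "(\<lambda>i. \<integral>x. (cmod (v i x - w x))\<^sup>2 \<partial>\<rho>) \<longlonglongrightarrow> (\<integral>x. 0 \<partial>\<rho>)"
  proof (rule integral_dominated_convergence[where w = "\<lambda>_. (2 * sqrt B)\<^sup>2"])
    show "AE x in \<rho>. (\<lambda>i. (cmod (v i x - w x))\<^sup>2) \<longlonglongrightarrow> 0"
    proof (rule AE_I2)
      fix x assume "x \<in> space \<rho>"
      then have "(\<lambda>i. v i x - w x) \<longlonglongrightarrow> 0" using lim by (intro LIM_zero) (simp add: space_rho)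
      from tendsto_power[OF tendsto_norm_zero[OF this], of 2]
      show "(\<lambda>i. (cmod (v i x - w x))\<^sup>2) \<longlonglongrightarrow> 0" by simp
    qed
    show "AE x in \<rho>. norm ((cmod (v i x - w x))\<^sup>2) \<le> (2 * sqrt B)\<^sup>2" for i
      using dom by (intro AE_I2) (simp add: space_rho)
  qed auto
  have L2d: "L2.sq (v i - v j) \<le> 2 * (\<integral>x. (cmod (v i x - w x))\<^sup>2 \<partial>\<rho>) + 2 * (\<integral>x. (cmod (v j x - w x))\<^sup>2 \<partial>\<rho>)"
    for i j
  proof -
    have "L2.sq (v i - v j) \<le> (\<integral>x. 2 * (cmod (v i x - w x))\<^sup>2 + 2 * (cmod (v j x - w x))\<^sup>2 \<partial>\<rho>)"
      unfolding L2_sq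
    proof (rule integral_mono)
      show "integrable \<rho> (\<lambda>x. (cmod ((v i - v j) x))\<^sup>2)" by (rule integrable_sq[OF diff_mem[OF v(1) v(1)]])
      show "integrable \<rho> (\<lambda>x. 2 * (cmod (v i x - w x))\<^sup>2 + 2 * (cmod (v j x - w x))\<^sup>2)" using int by simp
      fix x
      have "cmod (v i x - v j x) \<le> cmod (v i x - w x) + cmod (v j x - w x)"
        using norm_triangle_ineq4[of "v i x - w x" "v j x - w x"] by simp
      then have "(cmod (v i x - v j x))\<^sup>2 \<le> (cmod (v i x - w x) + cmod (v j x - w x))\<^sup>2"
        by (intro power_mono) auto
      also have "\<dots> \<le> 2 * (cmod (v i x - w x))\<^sup>2 + 2 * (cmod (v j x - w x))\<^sup>2"
        using sum_squares_bound[of "cmod (v i x - w x)" "cmod (v j x - w x)"] by (simp add: power2_sum)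
      finally show "(cmod ((v i - v j) x))\<^sup>2 \<le> 2 * (cmod (v i x - w x))\<^sup>2 + 2 * (cmod (v j x - w x))\<^sup>2"
        by simp
    qed
    then show ?thesis using int by simp
  qed
  have "\<exists>N. \<forall>p\<ge>N. \<forall>q\<ge>N. sq (W (v p) - W (v q)) < \<epsilon>" if eps: "\<epsilon> > 0" for \<epsilon>
  proof -
    define s where "s = \<epsilon> / (4 * (B + 1))"
    have "s > 0" using eps B_nonneg by (simp add: s_def)
    from order_tendstoD(2)[OF zero[unfolded integral_zero] this]
    obtain N where N: "\<And>i. i \<ge> N \<Longrightarrow> (\<integral>x. (cmod (v i x - w x))\<^sup>2 \<partial>\<rho>) < s"
      by (auto simp: eventually_sequentially)
    have "sq (W (v p) - W (v q)) < \<epsilon>" if "p \<ge> N" "q \<ge> N" for p q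
    proof -
      have "sq (W (v p) - W (v q)) \<le> B * L2.sq (v p - v q)"
        unfolding W_diff[OF v(1) v(1), symmetric] by (rule sq_W_le) (simp add: v)
      also have "\<dots> \<le> (B + 1) * L2.sq (v p - v q)"
        by (intro mult_right_mono L2.nonneg) (simp_all add: v)
      also have "\<dots> < (B + 1) * (\<epsilon> / (B + 1))"
      proof (intro mult_strict_left_mono)
        have "\<epsilon> / (B + 1) = 4 * s"
          unfolding s_def using mult_divide_mult_cancel_left[of 4 \<epsilon> "B + 1"] by (simp only: times_divide_eq_right)
        then show "L2.sq (v p - v q) < \<epsilon> / (B + 1)"
          using L2d[of p q] N[OF that(1)] N[OF that(2)] by linarith
      qed (use B_nonneg in simp)
      finally show ?thesis using B_nonneg by simp
    qed
    then show ?thesis by blast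
  qed
  from complete_sq[where u = "\<lambda>i. W (v i)", OF W_mem[OF v(1)] this]
  obtain h where "h \<in> H" "(\<lambda>i. sqrt (sq (W (v i) - h))) \<longlonglongrightarrow> 0" .
  then show ?thesis using that[OF r(1)] by (simp add: v_def)
qed

subsection \<open>The variational characterisation of the eigenvalues\<close>

lemma lam_pos: "1 \<le> k \<Longrightarrow> 0 < lam k"
  and lam_Suc: "1 \<le> k \<Longrightarrow> lam (Suc k) \<le> lam k"
  and e_mem: "1 \<le> k \<Longrightarrow> e k \<in> H"
  and W_e: "1 \<le> k \<Longrightarrow> W (e k) = cscale (of_real (lam k)) (e k)"
  and e_orth: "1 \<le> j \<Longrightarrow> 1 \<le> k \<Longrightarrow> ip (e j) (e k) = (if j = k then 1 else 0)"
  and eigenspace: "0 < t \<Longrightarrow> f \<in> H \<Longrightarrow> W f = cscale (of_real t) f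
    \<Longrightarrow> f \<in> cfun.span {e k |k. k \<ge> 1 \<and> lam k = t}"
  using eigen unfolding eigensystem_def by blast+

lemma lam_antimono:
  assumes "1 \<le> j" "j \<le> k"
  shows "lam k \<le> lam j"
  using assms(2,1)
proof (induction k rule: dec_induct)
  case (step k)
  then show ?case using lam_Suc[of k] by simp
qed simp

lemma L2_e:
  assumes "f \<in> H" "1 \<le> k"
  shows "L2_inner \<rho> f (e k) = of_real (lam k) * ip f (e k)"
  using W_eq[OF e_mem[OF assms(2)] assms(1)] scale_right[OF e_mem[OF assms(2)] assms(1)]
  by (simp add: W_e[OF assms(2)])

text \<open>
  Let \<open>t\<close> be the supremum of the Rayleigh quotient over the orthogonal complement \<open>V\<close> of the chosen
  eigenfunctions. For a maximising sequence \<open>v\<close>, Cauchy-Schwarz for the form \<open>t \<langle>f, g\<rangle> - \<langle>f, g\<rangle>\<^bsub>L2\<^esub>\<close>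
  gives \<open>t v - W v \<rightarrow> 0\<close>, so compactness of \<open>W\<close> makes a subsequence of \<open>v\<close> converge to an
  eigenvector.
\<close>

lemma top_eigenvector:
  assumes J: "J \<subseteq> {1..}" and f0: "f0 \<in> H" "\<forall>k\<in>J. ip f0 (e k) = 0"
    and t0: "0 \<le> t0" "t0 * sq f0 < L2.sq f0"
  obtains t f where "t0 < t" "f \<in> H" "\<forall>k\<in>J. ip f (e k) = 0"
    "W f = cscale (of_real t) f" "f \<noteq> 0"
proof -
  define V where "V = {f \<in> H. \<forall>k\<in>J. ip f (e k) = 0}"
  have eH: "e k \<in> H" if "k \<in> J" for k using J that by (intro e_mem) auto
  have VH: "f \<in> H" if "f \<in> V" for f using that by (simp add: V_def)
  have sub: "cfun.subspace V"
    by (rule cfun.subspaceI) (auto simp: V_def add_left scale_left eH simp del: zero_fun_def)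
  have Vscale: "cscale c f \<in> V" if "f \<in> V" for c f by (rule cfun.subspace_scale[OF sub that])
  define A where "A = {L2.sq f |f. f \<in> V \<and> sq f \<le> 1}"
  define t where "t = Sup A"
  have bdd: "bdd_above A"
  proof (rule bdd_aboveI)
    fix y assume "y \<in> A"
    then obtain f where f: "f \<in> V" "sq f \<le> 1" "y = L2.sq f" by (auto simp: A_def)
    have "L2.sq f \<le> B * sq f" by (rule L2_le[OF VH[OF f(1)]])
    also have "\<dots> \<le> B * 1" using f(2) by (intro mult_left_mono B_nonneg)
    finally show "y \<le> B" using f(3) by simp
  qed
  have t_up: "L2.sq f \<le> t * sq f" if f: "f \<in> V" for f
  proof (cases "sq f = 0")
    case True
    then show ?thesis using L2_le[OF VH[OF f]] L2.nonneg[OF VH[OF f]] by simp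
  next
    case False
    then have pos: "sq f > 0" using nonneg[OF VH[OF f]] by simp
    define s where "s = complex_of_real (1 / sqrt (sq f))"
    have s2: "(cmod s)\<^sup>2 = 1 / sq f" using pos by (simp add: s_def norm_divide power_divide)
    have "sq (cscale s f) = 1" using sq_scale[OF VH[OF f], of s] pos by (simp add: s2)
    then have "L2.sq (cscale s f) \<in> A" using Vscale[OF f, of s] by (auto simp: A_def)
    then have "L2.sq (cscale s f) \<le> t" unfolding t_def by (rule cSup_upper[OF _ bdd])
    then have "L2.sq f / sq f \<le> t" using L2.sq_scale[OF VH[OF f], of s] by (simp add: s2)
    then show ?thesis using pos by (simp add: field_simps)
  qed
  have f0V: "f0 \<in> V" using f0 by (simp add: V_def)
  have "sq f0 > 0"
  proof (rule ccontr)
    assume "\<not> ?thesis"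
    then have "sq f0 = 0" using nonneg[OF f0(1)] by simp
    then show False using L2_le[OF f0(1)] t0 by simp
  qed
  then have tt: "t0 < t" using t_up[OF f0V] t0(2) by (metis mult_less_cancel_right_pos order_less_le_trans)
  have tpos: "t > 0" using tt t0(1) by simp
  have "\<exists>f. f \<in> V \<and> sq f \<le> 1 \<and> t - 1 / real (Suc i) < L2.sq f" for i
  proof -
    have ne: "A \<noteq> {}"
    proof -
      have "0 \<in> V" by (rule cfun.subspace_0[OF sub])
      moreover have "sq 0 \<le> 1" using zero_left[OF zero_mem] by (simp only: zero_complex.sel)
      ultimately have "L2.sq 0 \<in> A" unfolding A_def by blast
      then show ?thesis by blast
    qed
    have "t - 1 / real (Suc i) < Sup A" by (simp add: t_def)
    from less_cSupD[OF ne this] show ?thesis by (auto simp: A_def)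
  qed
  then obtain v where v: "\<And>i. v i \<in> V" "\<And>i. sq (v i) \<le> 1" "\<And>i. t - 1 / real (Suc i) < L2.sq (v i)"
    by metis
  have vH: "v i \<in> H" for i using v(1) by (rule VH)
  define z where "z = (\<lambda>i. cscale (of_real t) (v i) - W (v i))"
  have WV: "W f \<in> V" if f: "f \<in> V" for f
  proof -
    have "ip (W f) (e k) = 0" if k: "k \<in> J" for k
    proof -
      have k1: "1 \<le> k" using J k by auto
      have "ip (W f) (e k) = cnj (ip (e k) (W f))" by (rule commute[OF eH[OF k] W_mem[OF VH[OF f]]])
      also have "\<dots> = cnj (L2_inner \<rho> (e k) f)" by (simp only: W_eq[OF VH[OF f] eH[OF k]])
      also have "\<dots> = L2_inner \<rho> f (e k)" by (rule L2.commute[OF eH[OF k] VH[OF f], symmetric])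
      also have "\<dots> = of_real (lam k) * ip f (e k)" by (rule L2_e[OF VH[OF f] k1])
      also have "\<dots> = 0" using f k by (simp add: V_def)
      finally show ?thesis .
    qed
    then show ?thesis using W_mem[OF VH[OF f]] by (simp add: V_def)
  qed
  have zV: "z i \<in> V" for i
    unfolding z_def by (intro cfun.subspace_diff[OF sub] Vscale WV v)
  have zH: "z i \<in> H" for i by (rule VH[OF zV])
  define Q where "Q = (\<lambda>f g. of_real t * ip f g - L2_inner \<rho> f g)"
  interpret Q: psd_form V Q
  proof
    show "cfun.subspace V" by (rule sub)
    show "Q (f + g) h = Q f h + Q g h" if "f \<in> V" "g \<in> V" "h \<in> V" for f g h
      unfolding Q_def add_left[OF VH[OF that(1)] VH[OF that(2)] VH[OF that(3)]]
        L2.add_left[OF VH[OF that(1)] VH[OF that(2)] VH[OF that(3)]]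
      by (simp add: algebra_simps)
    show "Q (cscale c f) g = c * Q f g" if "f \<in> V" "g \<in> V" for c f g
      unfolding Q_def scale_left[OF VH[OF that(1)] VH[OF that(2)]]
        L2.scale_left[OF VH[OF that(1)] VH[OF that(2)]]
      by (simp add: algebra_simps)
    show "Q g f = cnj (Q f g)" if "f \<in> V" "g \<in> V" for f g
      unfolding Q_def commute[OF VH[OF that(1)] VH[OF that(2)]]
        L2.commute[OF VH[OF that(1)] VH[OF that(2)]]
      by simp
    show "0 \<le> Re (Q f f)" if "f \<in> V" for f
      unfolding Q_def using t_up[OF that] by simp
  qed
  have z_small: "sq (z i) \<le> t / real (Suc i)" for i
  proof (cases "sq (z i) = 0")
    case True
    then show ?thesis using tpos by simp
  next
    case False
    then have pos: "sq (z i) > 0" using nonneg[OF zH[of i]] by simp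
    have "ip (z i) (z i) = Q (v i) (z i)"
    proof -
      have "ip (W (v i)) (z i) = cnj (ip (z i) (W (v i)))" by (rule commute[OF zH W_mem[OF vH]])
      also have "\<dots> = L2_inner \<rho> (v i) (z i)"
        unfolding W_eq[OF vH zH] by (rule L2.commute[OF zH vH, symmetric])
      finally have "ip (W (v i)) (z i) = L2_inner \<rho> (v i) (z i)" .
      moreover have "ip (z i) (z i) = ip (cscale (of_real t) (v i)) (z i) - ip (W (v i)) (z i)"
        by (subst (1) z_def) (rule diff_left[OF scale_mem[OF vH] W_mem[OF vH] zH])
      ultimately show ?thesis by (simp add: Q_def scale_left[OF vH zH])
    qed
    then have "sq (z i) = Re (Q (v i) (z i))" by simp
    then have "(sq (z i))\<^sup>2 \<le> (cmod (Q (v i) (z i)))\<^sup>2"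
      using pos complex_Re_le_cmod[of "Q (v i) (z i)"] by (intro power_mono) auto
    also have "\<dots> \<le> Q.sq (v i) * Q.sq (z i)" by (rule Q.CS[OF v(1) zV])
    also have "\<dots> \<le> (1 / real (Suc i)) * (t * sq (z i))"
    proof (intro mult_mono)
      have "t * sq (v i) \<le> t * 1" using v(2) tpos by (intro mult_left_mono) auto
      then show "Q.sq (v i) \<le> 1 / real (Suc i)" using v(3)[of i] by (simp add: Q_def)
      show "Q.sq (z i) \<le> t * sq (z i)" using L2.nonneg[OF zH] by (simp add: Q_def)
    qed (auto simp: Q.nonneg zV)
    finally have "sq (z i) * sq (z i) \<le> t / real (Suc i) * sq (z i)"
      by (simp add: power2_eq_square)
    then show ?thesis using pos by (rule mult_right_le_imp_le)
  qed
  from W_compact[where u = v, OF vH v(2)]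
  obtain r h where r: "strict_mono r" and h: "h \<in> H" "(\<lambda>i. sqrt (sq (W (v (r i)) - h))) \<longlonglongrightarrow> 0" .
  define f where "f = cscale (of_real (1 / t)) h"
  have fH: "f \<in> H" unfolding f_def by (rule scale_mem[OF h(1)])
  have hf: "h = cscale (of_real t) f" using tpos by (simp add: f_def cscale_def fun_eq_iff)
  have conv: "(\<lambda>i. sqrt (sq (v (r i) - f))) \<longlonglongrightarrow> 0"
  proof (rule Lim_null_comparison)
    show "(\<lambda>i. (sqrt (t / real (Suc (r i))) + sqrt (sq (W (v (r i)) - h))) / t) \<longlonglongrightarrow> 0"
    proof -
      have "(\<lambda>i. t / real (Suc (r i))) \<longlonglongrightarrow> 0"
        using LIMSEQ_subseq_LIMSEQ[OF LIMSEQ_Suc[OF lim_const_over_n[of t]] r] by (simp add: o_def)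
      from tendsto_divide[OF tendsto_add[OF tendsto_real_sqrt[OF this] h(2)] tendsto_const[of t]]
      show ?thesis using tpos by simp
    qed
    show "\<forall>\<^sub>F i in sequentially. norm (sqrt (sq (v (r i) - f)))
        \<le> (sqrt (t / real (Suc (r i))) + sqrt (sq (W (v (r i)) - h))) / t"
    proof (intro always_eventually allI)
      fix i
      have eq: "cscale (of_real t) (v (r i) - f) = z (r i) + (W (v (r i)) - h)"
        unfolding hf z_def by (simp add: cscale_def fun_eq_iff algebra_simps)
      have "t * sqrt (sq (v (r i) - f)) = sqrt (sq (cscale (of_real t) (v (r i) - f)))"
        using sq_scale[OF diff_mem[OF vH fH], of "of_real t" "r i"] tpos
        by (simp only:) (simp add: real_sqrt_mult)
      also have "\<dots> \<le> sqrt (sq (z (r i))) + sqrt (sq (W (v (r i)) - h))"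
        unfolding eq by (rule norm_triangle[OF zH diff_mem[OF W_mem[OF vH] h(1)]])
      also have "\<dots> \<le> sqrt (t / real (Suc (r i))) + sqrt (sq (W (v (r i)) - h))"
        by (intro add_right_mono real_sqrt_le_mono z_small)
      finally show "norm (sqrt (sq (v (r i) - f)))
          \<le> (sqrt (t / real (Suc (r i))) + sqrt (sq (W (v (r i)) - h))) / t"
        using tpos nonneg[OF diff_mem[OF vH fH]] by (simp add: pos_le_divide_eq mult.commute)
    qed
  qed
  have conv2: "(\<lambda>i. sqrt (L2.sq (v (r i) - f))) \<longlonglongrightarrow> 0"
  proof (rule Lim_null_comparison)
    show "(\<lambda>i. sqrt B * sqrt (sq (v (r i) - f))) \<longlonglongrightarrow> 0"
      using tendsto_mult_left[OF conv, of "sqrt B"] by simp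
    show "\<forall>\<^sub>F i in sequentially. norm (sqrt (L2.sq (v (r i) - f))) \<le> sqrt B * sqrt (sq (v (r i) - f))"
      using L2_le[OF diff_mem[OF vH fH]] L2.nonneg[OF diff_mem[OF vH fH]]
      by (intro always_eventually allI) (simp add: real_sqrt_mult[symmetric])
  qed
  have "ip f (e k) = 0" if k: "k \<in> J" for k
  proof -
    have "(\<lambda>i. ip (v (r i)) (e k)) \<longlonglongrightarrow> ip f (e k)" by (rule tendsto_left[OF vH fH eH[OF k] conv])
    moreover have "ip (v (r i)) (e k) = 0" for i using v(1) k by (simp add: V_def)
    ultimately show ?thesis by (simp add: LIMSEQ_const_iff)
  qed
  moreover have "W f = h"
  proof -
    have "ip g h = ip g (W f)" if g: "g \<in> H" for g
    proof -
      have "(\<lambda>i. ip (W (v (r i))) g) \<longlonglongrightarrow> ip h g"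
        by (rule tendsto_left[OF W_mem[OF vH] h(1) g h(2)])
      moreover have "ip (W (v (r i))) g = L2_inner \<rho> (v (r i)) g" for i
        using commute[OF g W_mem[OF vH]] L2.commute[OF g vH] W_eq[OF vH g] by simp
      moreover have "(\<lambda>i. L2_inner \<rho> (v (r i)) g) \<longlonglongrightarrow> L2_inner \<rho> f g"
        by (rule L2.tendsto_left[OF vH fH g conv2])
      ultimately have "ip h g = L2_inner \<rho> f g" using LIMSEQ_unique by simp
      then show ?thesis
        using commute[OF h(1) g] L2.commute[OF fH g] W_eq[OF fH g] by simp
    qed
    from this[OF diff_mem[OF W_mem[OF fH] h(1)]]
    have "ip (W f - h) (W f - h) = 0"
      using diff_right[OF W_mem[OF fH] h(1) diff_mem[OF W_mem[OF fH] h(1)]] by simp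
    from ip_eq_zero[OF diff_mem[OF W_mem[OF fH] h(1)] this] show ?thesis by simp
  qed
  moreover have "f \<noteq> 0"
  proof
    assume "f = 0"
    have up: "(\<lambda>i. L2.sq (v (r i))) \<longlonglongrightarrow> L2.sq f" by (rule L2.tendsto_sq[OF vH fH conv2])
    have low: "(\<lambda>i. t - 1 / real (Suc (r i))) \<longlonglongrightarrow> t - 0"
      using LIMSEQ_subseq_LIMSEQ[OF LIMSEQ_Suc[OF lim_const_over_n[of 1]] r]
      by (intro tendsto_diff tendsto_const) (simp add: o_def)
    have "t - 0 \<le> L2.sq f"
      by (rule LIMSEQ_le[OF low up]) (use v(3) in \<open>auto intro: less_imp_le\<close>)
    then show False using tpos L2.zero_left[OF zero_mem] unfolding \<open>f = 0\<close> by simp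
  qed
  ultimately show ?thesis using that[of t f] tt fH hf by simp
qed

text \<open>
  Otherwise there is an eigenvector orthogonal to \<open>e\<^sub>1, \<dots>, e\<^bsub>m-1\<^esub>\<close> for an eigenvalue \<open>t > lam m\<close>. The
  eigenspace of \<open>t\<close> is spanned by eigenfunctions with index below \<open>m\<close>, so the vector is zero.
\<close>

lemma L2_sq_le_lam:
  assumes f: "f \<in> H" "\<And>k. k \<in> {1..<m} \<Longrightarrow> ip f (e k) = 0" and m: "1 \<le> m"
  shows "L2.sq f \<le> lam m * sq f"
proof (rule ccontr)
  assume "\<not> ?thesis"
  then have gt: "lam m * sq f < L2.sq f" by simp
  obtain t g where g: "lam m < t" "g \<in> H" "\<forall>k\<in>{1..<m}. ip g (e k) = 0"
    "W g = cscale (of_real t) g" "g \<noteq> 0"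
    by (rule top_eigenvector[of "{1..<m}" f "lam m"]) (use f gt lam_pos[OF m] in auto)
  have "t > 0" using g(1) lam_pos[OF m] by simp
  then have span: "g \<in> cfun.span {e k |k. k \<ge> 1 \<and> lam k = t}" by (rule eigenspace[OF _ g(2,4)])
  have "cfun.subspace {u \<in> H. ip g u = 0}"
    by (rule cfun.subspaceI) (auto simp: add_right scale_right g(2) simp del: zero_fun_def)
  moreover have "{e k |k. k \<ge> 1 \<and> lam k = t} \<subseteq> {u \<in> H. ip g u = 0}"
  proof
    fix u assume "u \<in> {e k |k. k \<ge> 1 \<and> lam k = t}"
    then obtain k where k: "1 \<le> k" "t = lam k" "u = e k" by blast
    have "k < m"
    proof (rule ccontr)
      assume "\<not> k < m"
      then show False using lam_antimono[OF m, of k] g(1) k by simp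
    qed
    then show "u \<in> {u \<in> H. ip g u = 0}" using g(3) k by (auto intro: e_mem)
  qed
  ultimately have "g \<in> {u \<in> H. ip g u = 0}" using cfun.span_minimal span by blast
  then show False using ip_eq_zero[OF g(2)] g(5) by simp
qed

subsection \<open>Expansion in eigenfunctions\<close>

definition proj :: "('a \<Rightarrow> complex) \<Rightarrow> nat \<Rightarrow> 'a \<Rightarrow> complex" where
  "proj f M = (\<Sum>k\<in>{1..<M}. cscale (ip f (e k)) (e k))"

lemma proj_apply: "proj f M x = (\<Sum>k\<in>{1..<M}. ip f (e k) * e k x)"
  unfolding proj_def sum_fun_apply by (simp add: cscale_def)

lemma comb_mem: "A \<subseteq> {1..} \<Longrightarrow> (\<Sum>k\<in>A. cscale (c k) (e k)) \<in> H"
  by (intro sum_mem scale_mem e_mem) auto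

lemma proj_mem: "proj f M \<in> H"
  unfolding proj_def by (rule comb_mem) auto

lemma L2_e_e: "1 \<le> j \<Longrightarrow> 1 \<le> k \<Longrightarrow> L2_inner \<rho> (e j) (e k) = (if j = k then of_real (lam k) else 0)"
  by (simp add: L2_e[OF e_mem] e_orth)

lemma sq_e: "1 \<le> k \<Longrightarrow> sq (e k) = 1"
  by (simp add: e_orth)

lemma sq_comb:
  assumes A: "finite A" "A \<subseteq> {1..}"
  shows "sq (\<Sum>k\<in>A. cscale (c k) (e k)) = (\<Sum>k\<in>A. (cmod (c k))\<^sup>2)"
    and "L2.sq (\<Sum>k\<in>A. cscale (c k) (e k)) = (\<Sum>k\<in>A. lam k * (cmod (c k))\<^sup>2)"
proof -
  have k1: "1 \<le> k" if "k \<in> A" for k using A that by auto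
  have o1: "ip (cscale (c j) (e j)) (cscale (c k) (e k)) = 0" if "j \<in> A" "k \<in> A" "j \<noteq> k" for j k
    using that by (simp add: scale_left scale_right e_mem k1 e_orth)
  have o2: "L2_inner \<rho> (cscale (c j) (e j)) (cscale (c k) (e k)) = 0" if "j \<in> A" "k \<in> A" "j \<noteq> k" for j k
    using that by (simp add: L2.scale_left L2.scale_right e_mem k1 L2_e_e)
  have "sq (\<Sum>k\<in>A. cscale (c k) (e k)) = (\<Sum>k\<in>A. sq (cscale (c k) (e k)))"
    by (rule sq_sum_orthogonal[OF A(1)]) (auto simp: o1 e_mem k1)
  also have "\<dots> = (\<Sum>k\<in>A. (cmod (c k))\<^sup>2)"
    by (intro sum.cong refl) (simp add: sq_scale e_mem k1 sq_e)
  finally show "sq (\<Sum>k\<in>A. cscale (c k) (e k)) = (\<Sum>k\<in>A. (cmod (c k))\<^sup>2)" .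
  have "L2.sq (\<Sum>k\<in>A. cscale (c k) (e k)) = (\<Sum>k\<in>A. L2.sq (cscale (c k) (e k)))"
    by (rule L2.sq_sum_orthogonal[OF A(1)]) (auto simp: o2 e_mem k1)
  also have "\<dots> = (\<Sum>k\<in>A. lam k * (cmod (c k))\<^sup>2)"
    by (intro sum.cong refl) (simp add: L2.sq_scale e_mem k1 L2_e_e)
  finally show "L2.sq (\<Sum>k\<in>A. cscale (c k) (e k)) = (\<Sum>k\<in>A. lam k * (cmod (c k))\<^sup>2)" .
qed

lemma ip_comb:
  assumes A: "finite A" "A \<subseteq> {1..}" and j: "1 \<le> j"
  shows "ip (\<Sum>k\<in>A. cscale (c k) (e k)) (e j) = (if j \<in> A then c j else 0)"
proof -
  have "ip (\<Sum>k\<in>A. cscale (c k) (e k)) (e j) = (\<Sum>k\<in>A. ip (cscale (c k) (e k)) (e j))"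
    using A by (intro sum_left scale_mem e_mem j) auto
  also have "\<dots> = (\<Sum>k\<in>A. if k = j then c k else 0)"
  proof (intro sum.cong refl)
    fix k assume "k \<in> A"
    then have "1 \<le> k" using A by auto
    then show "ip (cscale (c k) (e k)) (e j) = (if k = j then c k else 0)"
      by (simp add: scale_left e_mem j e_orth)
  qed
  finally show ?thesis using A(1) by simp
qed

lemma ip_minus_proj:
  assumes "f \<in> H" "1 \<le> j" "j < M"
  shows "ip (f - proj f M) (e j) = 0"
proof -
  have "ip (proj f M) (e j) = ip f (e j)"
    unfolding proj_def by (subst ip_comb) (use assms in auto)
  then show ?thesis using diff_left[OF assms(1) proj_mem e_mem[OF assms(2)], of f M] by simp
qed

lemma sq_minus_proj:
  assumes f: "f \<in> H"
  shows "sq (f - proj f M) = sq f - (\<Sum>k\<in>{1..<M}. (cmod (ip f (e k)))\<^sup>2)"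
proof -
  let ?r = "f - proj f M"
  have rH: "?r \<in> H" by (rule diff_mem[OF f proj_mem])
  have "ip (proj f M) ?r = (\<Sum>k\<in>{1..<M}. ip (cscale (ip f (e k)) (e k)) ?r)"
  proof -
    have "cscale (ip f (e k)) (e k) \<in> H" if "k \<in> {1..<M}" for k
      using that by (intro scale_mem e_mem) simp
    from sum_left[OF this rH] show ?thesis by (simp only: proj_def)
  qed
  also have "\<dots> = 0"
  proof (intro sum.neutral ballI)
    fix k assume k: "k \<in> {1..<M}"
    have "ip (e k) ?r = cnj (ip ?r (e k))" using k by (intro commute[OF rH]) (auto intro: e_mem)
    also have "\<dots> = 0" using k by (subst ip_minus_proj[OF f]) auto
    finally have "ip (e k) ?r = 0" .
    then show "ip (cscale (ip f (e k)) (e k)) ?r = 0"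
      using k scale_left[OF _ rH, of "e k"] by (auto intro: e_mem)
  qed
  finally have z: "ip (proj f M) ?r = 0" .
  have c1: "proj f M + cscale 1 ?r = f" by (simp add: cscale_def fun_eq_iff)
  have "sq f = sq (proj f M) + sq ?r"
    using sq_line[OF proj_mem[of f M] rH, of 1] unfolding c1 z by simp
  moreover have "sq (proj f M) = (\<Sum>k\<in>{1..<M}. (cmod (ip f (e k)))\<^sup>2)"
    unfolding proj_def by (rule sq_comb(1)) auto
  ultimately show ?thesis by simp
qed

lemma bessel:
  assumes "f \<in> H" "finite A" "A \<subseteq> {1..}"
  shows "(\<Sum>k\<in>A. (cmod (ip f (e k)))\<^sup>2) \<le> sq f"
proof -
  have "A \<subseteq> {1..<Suc (Max (insert 0 A))}"
  proof
    fix k assume "k \<in> A"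
    moreover have "k \<le> Max (insert 0 A)" using \<open>k \<in> A\<close> assms(2) by (intro Max_ge) auto
    ultimately show "k \<in> {1..<Suc (Max (insert 0 A))}" using assms(3) by auto
  qed
  then have "(\<Sum>k\<in>A. (cmod (ip f (e k)))\<^sup>2) \<le> (\<Sum>k\<in>{1..<Suc (Max (insert 0 A))}. (cmod (ip f (e k)))\<^sup>2)"
    by (intro sum_mono2) auto
  also have "\<dots> \<le> sq f"
    using sq_minus_proj[OF assms(1)] nonneg[OF diff_mem[OF assms(1) proj_mem]] by (metis diff_ge_0_iff_ge)
  finally show ?thesis .
qed

lemma sum_e_le:
  assumes x: "x \<in> D" and A: "finite A" "A \<subseteq> {1..}"
  shows "(\<Sum>k\<in>A. (cmod (e k x))\<^sup>2) \<le> B"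
proof -
  have "cmod (ip (kfun x) (e k)) = cmod (e k x)" if "k \<in> A" for k
  proof -
    have k: "e k \<in> H" using A that by (intro e_mem) auto
    show ?thesis unfolding eval_eq[OF k x] commute[OF k kfun_mem[OF x]] by simp
  qed
  then have "(\<Sum>k\<in>A. (cmod (e k x))\<^sup>2) = (\<Sum>k\<in>A. (cmod (ip (kfun x) (e k)))\<^sup>2)" by simp
  also have "\<dots> \<le> sq (kfun x)" by (rule bessel[OF kfun_mem[OF x] A])
  also have "\<dots> \<le> B" by (rule sq_kfun[OF x])
  finally show ?thesis .
qed

lemma lam_eq: "1 \<le> k \<Longrightarrow> lam k = (\<integral>x. (cmod (e k x))\<^sup>2 \<partial>\<rho>)"
  using L2_sq[of "e k"] by (simp add: L2_e_e)

text \<open>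
  The sum of the eigenvalues is the integral of \<open>\<Sum> \<bar>e\<^sub>k\<bar>\<^sup>2\<close>, which Bessel's inequality for the kernel
  functions bounds by \<open>B\<close>.
\<close>

lemma lam_le: "1 \<le> M \<Longrightarrow> real M * lam M \<le> B"
proof -
  assume M: "1 \<le> M"
  have int: "integrable \<rho> (\<lambda>x. (cmod (e k x))\<^sup>2)" if "k \<in> {1..M}" for k
    using that by (intro integrable_sq e_mem) auto
  have "real M * lam M = (\<Sum>k\<in>{1..M}. lam M)" by simp
  also have "\<dots> \<le> (\<Sum>k\<in>{1..M}. lam k)" by (intro sum_mono lam_antimono) auto
  also have "\<dots> = (\<Sum>k\<in>{1..M}. \<integral>x. (cmod (e k x))\<^sup>2 \<partial>\<rho>)" by (intro sum.cong refl lam_eq) auto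
  also have "\<dots> = (\<integral>x. (\<Sum>k\<in>{1..M}. (cmod (e k x))\<^sup>2) \<partial>\<rho>)"
    using int by (intro Bochner_Integration.integral_sum[symmetric]) auto
  also have "\<dots> \<le> B"
    using int by (intro integral_le_const Bochner_Integration.integrable_sum AE_I2)
      (auto intro!: sum_e_le simp: space_rho)
  finally show ?thesis .
qed

lemma lam_tendsto_0: "lam \<longlonglongrightarrow> 0"
proof (rule Lim_null_comparison)
  show "(\<lambda>n. B / real n) \<longlonglongrightarrow> 0" by (rule lim_const_over_n)
  show "\<forall>\<^sub>F n in sequentially. norm (lam n) \<le> B / real n"
  proof (rule eventually_sequentiallyI[of 1])
    fix n :: nat assume "1 \<le> n"
    then show "norm (lam n) \<le> B / real n"
      using lam_le[of n] lam_pos[of n] by (simp add: field_simps)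
  qed
qed

lemma proj_converges:
  assumes f: "f \<in> H"
  obtains g where "g \<in> H" "(\<lambda>M. sqrt (sq (proj f M - g))) \<longlonglongrightarrow> 0"
proof -
  define s where "s = (\<lambda>M. \<Sum>k\<in>{1..<M}. (cmod (ip f (e k)))\<^sup>2)"
  have mono: "incseq s" unfolding s_def by (intro incseq_SucI sum_mono2) auto
  have "s M \<le> sq f" for M unfolding s_def by (rule bessel[OF f]) auto
  then obtain L where "s \<longlonglongrightarrow> L" using incseq_convergent[OF mono, of "sq f"] by blast
  then have "convergent s" by (rule convergentI)
  then have cau: "Cauchy s" by (rule convergent_Cauchy)
  have diff: "sq (proj f p - proj f q) = s p - s q" if "q \<le> p" for p q
  proof -
    have split: "{1..<p} = {1..<q} \<union> {max 1 q..<p}" using that by auto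
    have disj: "{1..<q} \<inter> {max 1 q..<p} = {}" by auto
    have "proj f p = proj f q + (\<Sum>k\<in>{max 1 q..<p}. cscale (ip f (e k)) (e k))"
      unfolding proj_def split by (rule sum.union_disjoint) (use disj in auto)
    then have "proj f p - proj f q = (\<Sum>k\<in>{max 1 q..<p}. cscale (ip f (e k)) (e k))"
      by (simp only: add_diff_cancel_left')
    then have "sq (proj f p - proj f q) = (\<Sum>k\<in>{max 1 q..<p}. (cmod (ip f (e k)))\<^sup>2)"
      by (simp only:) (rule sq_comb(1), auto)
    moreover have "s p = s q + (\<Sum>k\<in>{max 1 q..<p}. (cmod (ip f (e k)))\<^sup>2)"
      unfolding s_def split by (rule sum.union_disjoint) (use disj in auto)
    ultimately show ?thesis by simp
  qed
  have "\<exists>N. \<forall>p\<ge>N. \<forall>q\<ge>N. sq (proj f p - proj f q) < \<epsilon>" if "\<epsilon> > 0" for \<epsilon>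
  proof -
    from metric_CauchyD[OF cau that] obtain N where N: "\<And>p q. p \<ge> N \<Longrightarrow> q \<ge> N \<Longrightarrow> dist (s p) (s q) < \<epsilon>"
      by auto
    have "sq (proj f p - proj f q) < \<epsilon>" if "p \<ge> N" "q \<ge> N" for p q
    proof (cases "q \<le> p")
      case True
      then show ?thesis using diff[OF True] N[OF that] by (simp add: dist_real_def)
    next
      case False
      then have "p \<le> q" by simp
      from diff[OF this] sq_diff_commute[OF proj_mem proj_mem, of f p f q] N[OF that]
      show ?thesis by (simp add: dist_real_def)
    qed
    then show ?thesis by blast
  qed
  from complete_sq[where u = "proj f", OF proj_mem this]
  obtain g where "g \<in> H" "(\<lambda>M. sqrt (sq (proj f M - g))) \<longlonglongrightarrow> 0" .
  then show ?thesis by (rule that)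
qed

text \<open>
  The expansion converges in \<open>H\<close> to some \<open>g\<close>. The difference \<open>f - g\<close> is orthogonal to all eigenfunctions, so its
  \<open>L\<^sub>2\<close> norm is bounded by all \<open>lam m\<close> and vanishes.
\<close>

lemma AE_expansion_single:
  assumes f: "f \<in> H"
  shows "AE x in \<rho>. (\<lambda>M. proj f M x) \<longlonglongrightarrow> f x"
proof -
  from proj_converges[OF f]
  obtain g where g: "g \<in> H" "(\<lambda>M. sqrt (sq (proj f M - g))) \<longlonglongrightarrow> 0" .
  define r where "r = f - g"
  have rH: "r \<in> H" unfolding r_def by (rule diff_mem[OF f g(1)])
  have orth: "ip r (e k) = 0" if k: "1 \<le> k" for k
  proof -
    have "(\<lambda>M. ip (proj f M) (e k)) \<longlonglongrightarrow> ip g (e k)" by (rule tendsto_left[OF proj_mem g(1) e_mem[OF k] g(2)])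
    moreover have "\<forall>\<^sub>F M in sequentially. ip (proj f M) (e k) = ip f (e k)"
      unfolding proj_def
      by (rule eventually_sequentiallyI[of "Suc k"]) (subst ip_comb, use k in auto)
    then have "(\<lambda>M. ip (proj f M) (e k)) \<longlonglongrightarrow> ip f (e k)" by (rule tendsto_eventually)
    ultimately have "ip g (e k) = ip f (e k)" by (rule LIMSEQ_unique)
    then show ?thesis unfolding r_def by (simp add: diff_left[OF f g(1) e_mem[OF k]])
  qed
  have "L2.sq r \<le> 0 * sq r"
  proof (rule LIMSEQ_le_const)
    show "(\<lambda>m. lam m * sq r) \<longlonglongrightarrow> 0 * sq r" by (intro tendsto_intros lam_tendsto_0)
    show "\<exists>N. \<forall>m\<ge>N. L2.sq r \<le> lam m * sq r"
      using L2_sq_le_lam[OF rH] orth by (intro exI[of _ 1]) auto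
  qed
  then have "(\<integral>x. (cmod (r x))\<^sup>2 \<partial>\<rho>) = 0" using L2.nonneg[OF rH] unfolding L2_sq by linarith
  then have "AE x in \<rho>. (cmod (r x))\<^sup>2 = 0"
    using integral_nonneg_eq_0_iff_AE[OF integrable_sq[OF rH]] by simp
  then show ?thesis
  proof (rule AE_mp, intro AE_I2 impI)
    fix x assume x: "x \<in> space \<rho>" and "(cmod (r x))\<^sup>2 = 0"
    then have "g x = f x" by (simp add: r_def)
    then show "(\<lambda>M. proj f M x) \<longlonglongrightarrow> f x"
      using eval_tendsto[where u = "proj f", OF proj_mem g, of x] x by (simp add: space_rho)
  qed
qed

lemma proj_diff: "f \<in> H \<Longrightarrow> g \<in> H \<Longrightarrow> proj (f - g) M x = proj f M x - proj g M x"
  unfolding proj_apply sum_subtractf[symmetric]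
  by (intro sum.cong refl) (simp add: diff_left e_mem algebra_simps)

lemma sq_proj_le: "f \<in> H \<Longrightarrow> sq (proj f M) \<le> sq f"
  unfolding proj_def by (subst sq_comb(1)) (auto intro: bessel)

text \<open>
  The exceptional null set can be chosen independently of \<open>f\<close>: it suffices to treat a countable dense
  set, since evaluation at a point and the partial sums are equicontinuous on \<open>H\<close>. This matters because
  the nodes are drawn before \<open>f\<close> is chosen.
\<close>

lemma AE_expansion: "AE x in \<rho>. \<forall>f\<in>H. (\<lambda>M. proj f M x) \<longlonglongrightarrow> f x"
proof -
  obtain S where S: "countable S" "S \<subseteq> H" "\<And>f \<epsilon>. f \<in> H \<Longrightarrow> \<epsilon> > 0 \<Longrightarrow> \<exists>g\<in>S. hnorm ip (f - g) < \<epsilon>"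
    using separable unfolding hseparable_def by blast
  have "AE x in \<rho>. \<forall>g\<in>S. (\<lambda>M. proj g M x) \<longlonglongrightarrow> g x"
    using S(1,2) by (subst AE_ball_countable) (auto intro: AE_expansion_single)
  then show ?thesis
  proof (rule AE_mp, intro AE_I2 impI ballI)
    fix x f assume "x \<in> space \<rho>" and lim: "\<forall>g\<in>S. (\<lambda>M. proj g M x) \<longlonglongrightarrow> g x" and f: "f \<in> H"
    then have x: "x \<in> D" by (simp add: space_rho)
    define b where "b = sqrt B + 1"
    have b: "b > 0" using B_nonneg by (simp add: b_def add_nonneg_pos)
    have ev: "cmod (h x) \<le> b * sqrt (sq h)" if "h \<in> H" for h
    proof -
      have "cmod (h x) \<le> sqrt (B * sq h)" using eval_bound[OF that x] by (rule real_le_rsqrt)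
      also have "\<dots> \<le> b * sqrt (sq h)" using nonneg[OF that] by (simp add: real_sqrt_mult b_def algebra_simps)
      finally show ?thesis .
    qed
    show "(\<lambda>M. proj f M x) \<longlonglongrightarrow> f x"
    proof (rule metric_LIMSEQ_I)
      fix \<epsilon> :: real assume eps: "\<epsilon> > 0"
      define s where "s = \<epsilon> / (3 * b)"
      have s: "s > 0" "b * s = \<epsilon> / 3" using b eps by (auto simp: s_def)
      obtain g where g: "g \<in> S" "sqrt (sq (f - g)) < s" using S(3)[OF f s(1)] by (auto simp: hnorm_eq)
      have gH: "g \<in> H" using g S(2) by auto
      have fg: "f - g \<in> H" by (rule diff_mem[OF f gH])
      have "b * sqrt (sq (f - g)) < b * s" using g(2) b by (rule mult_strict_left_mono)
      then have small: "b * sqrt (sq (f - g)) < \<epsilon> / 3" using s(2) by simp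
      have 1: "cmod (f x - g x) < \<epsilon> / 3" using ev[OF fg] small by simp
      have 2: "cmod (proj f M x - proj g M x) < \<epsilon> / 3" for M
      proof -
        have "cmod (proj f M x - proj g M x) \<le> b * sqrt (sq (proj (f - g) M))"
          unfolding proj_diff[OF f gH, symmetric] by (rule ev[OF proj_mem])
        also have "\<dots> \<le> b * sqrt (sq (f - g))"
          using sq_proj_le[OF fg] b by (intro mult_left_mono real_sqrt_le_mono) auto
        finally show ?thesis using small by simp
      qed
      have "\<epsilon> / 3 > 0" using eps by simp
      from metric_LIMSEQ_D[OF bspec[OF lim g(1)] this]
      obtain N where N: "\<And>M. M \<ge> N \<Longrightarrow> dist (proj g M x) (g x) < \<epsilon> / 3" by auto
      have "dist (proj f M x) (f x) < \<epsilon>" if "M \<ge> N" for M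
      proof -
        have "dist (proj f M x) (f x) \<le> dist (proj f M x) (proj g M x) + dist (proj g M x) (g x) + dist (g x) (f x)"
          using dist_triangle[of "proj f M x" "f x" "proj g M x"] dist_triangle[of "proj g M x" "f x" "g x"]
          by linarith
        then show ?thesis using 1 2[of M] N[OF that] eps by (simp add: dist_norm norm_minus_commute)
      qed
      then show "\<exists>N. \<forall>M\<ge>N. dist (proj f M x) (f x) < \<epsilon>" by blast
    qed
  qed
qed

subsection \<open>The spectral functions and the associated random vectors\<close>

lemma sum_le_spectral_T:
  assumes x: "x \<in> D" and m: "1 \<le> m"
  shows "(\<Sum>k\<in>{m..<p}. (cmod (e k x))\<^sup>2) \<le> spectral_T D e m"
proof -
  have summ: "(\<lambda>k. (cmod (e k y))\<^sup>2) summable_on {m..}" if "y \<in> D" for y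
  proof (rule nonneg_bdd_above_summable_on)
    show "bdd_above (sum (\<lambda>k. (cmod (e k y))\<^sup>2) ` {F. F \<subseteq> {m..} \<and> finite F})"
      using m by (intro bdd_aboveI2[where M = B] sum_e_le[OF that]) auto
  qed auto
  have le: "(\<Sum>\<^sub>\<infinity>k\<in>{m..}. (cmod (e k y))\<^sup>2) \<le> B" if "y \<in> D" for y
    using m by (intro infsum_le_finite_sums[OF summ[OF that]] sum_e_le[OF that]) auto
  have "(\<Sum>k\<in>{m..<p}. (cmod (e k x))\<^sup>2) \<le> (\<Sum>\<^sub>\<infinity>k\<in>{m..}. (cmod (e k x))\<^sup>2)"
    by (rule finite_sum_le_infsum[OF summ[OF x]]) auto
  also have "\<dots> \<le> spectral_T D e m"
    unfolding spectral_T_def by (rule cSUP_upper[OF x]) (use le in \<open>auto intro!: bdd_aboveI2\<close>)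
  finally show ?thesis .
qed

lemma eta_eq: "1 \<le> k \<Longrightarrow> eta lam e k x = of_real (inverse (sqrt (lam k))) * e k x"
proof -
  assume k: "1 \<le> k"
  have "(-1/2 :: real) = - (1/2)" by simp
  then have "lam k powr (-1/2) = inverse (sqrt (lam k))"
    using powr_half_sqrt[of "lam k"] lam_pos[OF k] by (simp only: powr_minus)
  then show ?thesis by (simp only: eta_def)
qed

lemma cmod_eta: "1 \<le> k \<Longrightarrow> (cmod (eta lam e k x))\<^sup>2 = (cmod (e k x))\<^sup>2 / lam k"
  using lam_pos[of k]
  by (simp add: eta_eq norm_mult norm_inverse power_mult_distrib power_inverse divide_inverse)

lemma sum_le_spectral_N:
  assumes x: "x \<in> D"
  shows "(\<Sum>k=1..m-1. (cmod (eta lam e k x))\<^sup>2) \<le> spectral_N D lam e m"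
proof -
  have "(\<Sum>k=1..m-1. (cmod (eta lam e k y))\<^sup>2) \<le> (\<Sum>k=1..m-1. B / lam k)" if "y \<in> D" for y
  proof (intro sum_mono)
    fix k assume k: "k \<in> {1..m-1}"
    have "(cmod (e k y))\<^sup>2 \<le> B" using sum_e_le[OF that, of "{k}"] k by simp
    then show "(cmod (eta lam e k y))\<^sup>2 \<le> B / lam k"
      using k lam_pos[of k] by (simp add: cmod_eta divide_right_mono)
  qed
  then show ?thesis unfolding spectral_N_def by (intro cSUP_upper[OF x] bdd_aboveI2) auto
qed

lemma eta_second_moment:
  assumes "1 \<le> j" "1 \<le> k"
  shows "integrable \<rho> (\<lambda>x. eta lam e j x * cnj (eta lam e k x))"
    and "(\<integral>x. eta lam e j x * cnj (eta lam e k x) \<partial>\<rho>) = (if j = k then 1 else 0)"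
proof -
  let ?c = "complex_of_real (inverse (sqrt (lam j)) * inverse (sqrt (lam k)))"
  have eq: "eta lam e j x * cnj (eta lam e k x) = ?c * (e j x * cnj (e k x))" for x
    by (simp only: eta_eq[OF assms(1)] eta_eq[OF assms(2)] complex_cnj_mult complex_cnj_complex_of_real
        of_real_mult mult_ac)
  show "integrable \<rho> (\<lambda>x. eta lam e j x * cnj (eta lam e k x))"
    unfolding eq by (intro integrable_mult_right integrable_prod e_mem assms)
  have "(\<integral>x. eta lam e j x * cnj (eta lam e k x) \<partial>\<rho>) = ?c * L2_inner \<rho> (e j) (e k)"
    unfolding eq L2_inner_def by (rule integral_mult_right_zero)
  also have "\<dots> = (if j = k then 1 else 0)"
  proof (cases "j = k")
    case True
    have "inverse (sqrt (lam k)) * inverse (sqrt (lam k)) * lam k = 1"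
      using lam_pos[OF assms(2)] by (simp add: field_simps)
    then show ?thesis unfolding True L2_e_e[OF assms(2) assms(2)]
      by (simp only: simp_thms if_True of_real_mult[symmetric] of_real_1)
  qed (simp add: L2_e_e assms)
  finally show "(\<integral>x. eta lam e j x * cnj (eta lam e k x) \<partial>\<rho>) = (if j = k then 1 else 0)" .
qed

lemma eta_measurable: "1 \<le> k \<Longrightarrow> eta lam e k \<in> borel_measurable \<rho>"
  using meas_H[OF e_mem[of k]] unfolding eta_def[abs_def] by measurable

lemma sqn_eta:
  assumes "x \<in> D"
  shows "sqn {..<m - 1} (\<lambda>k. eta lam e (k + 1) x) \<le> spectral_N D lam e m"
proof -
  have "sqn {..<m - 1} (\<lambda>k. eta lam e (k + 1) x) = (\<Sum>k=1..m-1. (cmod (eta lam e k x))\<^sup>2)"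
    unfolding sqn_def by (rule sum.reindex_bij_witness[of _ "\<lambda>k. k - 1" "\<lambda>k. k + 1"]) auto
  then show ?thesis using sum_le_spectral_N[OF assms, of m] by simp
qed

lemma spectral_N_ge: "real (m - 1) \<le> spectral_N D lam e m"
proof -
  have int: "integrable \<rho> (\<lambda>x. (cmod (eta lam e (k + 1) x))\<^sup>2)"
    and one: "(\<integral>x. (cmod (eta lam e (k + 1) x))\<^sup>2 \<partial>\<rho>) = 1" for k
  proof -
    show "integrable \<rho> (\<lambda>x. (cmod (eta lam e (k + 1) x))\<^sup>2)"
      using integrable_Re[OF eta_second_moment(1)[of "k + 1" "k + 1"]]
      by (simp only: mult_cnj_self Re_complex_of_real)
    have "complex_of_real (\<integral>x. (cmod (eta lam e (k + 1) x))\<^sup>2 \<partial>\<rho>) = 1"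
      using eta_second_moment(2)[of "k + 1" "k + 1"]
      by (simp only: mult_cnj_self integral_complex_of_real) simp
    then show "(\<integral>x. (cmod (eta lam e (k + 1) x))\<^sup>2 \<partial>\<rho>) = 1" by (simp only: of_real_eq_1_iff)
  qed
  have "real (m - 1) = (\<Sum>k<m - 1. \<integral>x. (cmod (eta lam e (k + 1) x))\<^sup>2 \<partial>\<rho>)"
    by (simp only: one) simp
  also have "\<dots> = (\<integral>x. (\<Sum>k<m - 1. (cmod (eta lam e (k + 1) x))\<^sup>2) \<partial>\<rho>)"
    by (rule Bochner_Integration.integral_sum[symmetric]) (rule int)
  also have "\<dots> \<le> spectral_N D lam e m"
  proof (rule integral_le_const)
    show "integrable \<rho> (\<lambda>x. \<Sum>k<m - 1. (cmod (eta lam e (k + 1) x))\<^sup>2)"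
      by (rule Bochner_Integration.integrable_sum) (rule int)
    show "AE x in \<rho>. (\<Sum>k<m - 1. (cmod (eta lam e (k + 1) x))\<^sup>2) \<le> spectral_N D lam e m"
      by (rule AE_I2) (use sqn_eta[of _ m] in \<open>simp add: sqn_def space_rho\<close>)
  qed
  finally show ?thesis .
qed

lemma random_vector_eta:
  assumes "2 \<le> m"
  shows "random_vector \<rho> {..<m - 1} (\<lambda>x k. eta lam e (k + 1) x) (spectral_N D lam e m) (\<lambda>_. 1)"
proof unfold_locales
  show "(\<lambda>x. eta lam e (i + 1) x) \<in> borel_measurable \<rho>" for i by (rule eta_measurable) simp
  show "sqn {..<m - 1} (\<lambda>k. eta lam e (k + 1) x) \<le> spectral_N D lam e m" if "x \<in> space \<rho>" for x
    using that by (intro sqn_eta) (simp add: space_rho)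
  show "0 < spectral_N D lam e m" using spectral_N_ge[of m] assms by simp
  show "(\<integral>x. eta lam e (i + 1) x * cnj (eta lam e (j + 1) x) \<partial>\<rho>) = (if i = j then of_real 1 else 0)" for i j
    using eta_second_moment(2)[of "i + 1" "j + 1"] by simp
qed simp

lemma spectral_T_pos:
  assumes m: "1 \<le> m"
  shows "0 < spectral_T D e m"
proof -
  have "lam m = (\<integral>x. (cmod (e m x))\<^sup>2 \<partial>\<rho>)" by (rule lam_eq[OF m])
  also have "\<dots> \<le> spectral_T D e m"
    using sum_le_spectral_T[OF _ m, of _ "Suc m"]
    by (intro integral_le_const integrable_sq e_mem m AE_I2) (simp add: space_rho)
  finally show ?thesis using lam_pos[OF m] by simp
qed

lemma random_vector_e:
  assumes m: "1 \<le> m"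
  shows "random_vector \<rho> {m..<p} (\<lambda>x k. e k x) (spectral_T D e m) lam"
proof unfold_locales
  show "(\<lambda>x. e i x) \<in> borel_measurable \<rho>" if "i \<in> {m..<p}" for i
    using that m meas_H[OF e_mem[of i]] by simp
  show "sqn {m..<p} (\<lambda>k. e k x) \<le> spectral_T D e m" if "x \<in> space \<rho>" for x
    using that sum_le_spectral_T[OF _ m, of x p] by (simp add: sqn_def space_rho)
  show "0 < spectral_T D e m" by (rule spectral_T_pos[OF m])
  show "(\<integral>x. e i x * cnj (e j x) \<partial>\<rho>) = (if i = j then of_real (lam i) else 0)"
    if "i \<in> {m..<p}" "j \<in> {m..<p}" for i j
    using L2_e_e[of i j] that m by (simp add: L2_inner_def)
qed simp

end

section \<open>Full column rank and the normal equations\<close>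

lemma (in vec_space) rank_le_card_cols:
  assumes A: "A \<in> carrier_mat n nc"
  shows "rank A \<le> card (set (cols A))"
proof -
  obtain S where S: "maximal S (\<lambda>T. T \<subseteq> set (cols A) \<and> lin_indpt T)"
    using maximal_exists[of "\<lambda>T. T \<subseteq> set (cols A) \<and> lin_indpt T" "card (set (cols A))" "{}"]
    by (meson List.finite_set card_mono empty_iff empty_subsetI finite_lin_indpt2 rev_finite_subset)
  then have "card S \<le> card (set (cols A))" by (simp add: card_mono maximal_def)
  then show ?thesis using rank_card_indpt[OF A S] by simp
qed

lemma (in vec_space) rank_eq_iff_kernel_trivial:
  assumes A: "A \<in> carrier_mat n nc"
  shows "rank A = nc \<longleftrightarrow> (\<forall>v\<in>carrier_vec nc. A *\<^sub>v v = 0\<^sub>v n \<longrightarrow> v = 0\<^sub>v nc)"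
proof
  assume r: "rank A = nc"
  have "distinct (cols A)"
    using rank_le_card_cols[OF A] r A card_distinct[of "cols A"] card_length[of "cols A"]
    by (simp add: le_antisym)
  with full_rank_lin_indpt[OF A r] lin_depI[OF A]
  show "\<forall>v\<in>carrier_vec nc. A *\<^sub>v v = 0\<^sub>v n \<longrightarrow> v = 0\<^sub>v nc" by blast
next
  assume inj: "\<forall>v\<in>carrier_vec nc. A *\<^sub>v v = 0\<^sub>v n \<longrightarrow> v = 0\<^sub>v nc"
  have dist: "distinct (cols A)"
  proof (rule ccontr)
    assume "\<not> distinct (cols A)"
    then obtain i j where ij: "i \<noteq> j" "cols A ! i = cols A ! j" "i < length (cols A)" "j < length (cols A)"
      using distinct_conv_nth by blast
    then have c: "col A i = col A j" "i < nc" "j < nc" using A by auto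
    let ?v = "Matrix.unit_vec nc i - Matrix.unit_vec nc j :: 'a Matrix.vec"
    have "A *\<^sub>v ?v = A *\<^sub>v Matrix.unit_vec nc i - A *\<^sub>v Matrix.unit_vec nc j"
      using A by (intro mult_minus_distrib_mat_vec) auto
    also have "\<dots> = 0\<^sub>v n"
    proof -
      have "A *\<^sub>v Matrix.unit_vec nc k = col A k" if "k < nc" for k
        by (rule eq_vecI) (use A that in auto)
      then show ?thesis using c A by simp
    qed
    finally have "?v = 0\<^sub>v nc" using inj by simp
    then have "Matrix.vec_index ?v i = 0" using c by simp
    then show False using c ij(1) by simp
  qed
  have "lin_indpt (set (cols A))"
    using lin_depE[OF A _ dist] inj by blast
  then show "rank A = nc" by (rule lin_indpt_full_rank[OF A dist])
qed

definition gram :: "complex Matrix.mat \<Rightarrow> complex Matrix.mat" where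
  "gram A = mat_adjoint A * A"

lemma mat_adjoint_carrier: "A \<in> carrier_mat n r \<Longrightarrow> mat_adjoint A \<in> carrier_mat r n"
  by (auto simp: mat_adjoint_def)

lemma gram_carrier: "A \<in> carrier_mat n r \<Longrightarrow> gram A \<in> carrier_mat r r"
  unfolding gram_def using mat_adjoint_carrier[of A n r] by auto

lemma mat_adjoint_index:
  "A \<in> carrier_mat n r \<Longrightarrow> i < r \<Longrightarrow> j < n \<Longrightarrow> mat_adjoint A $$ (i, j) = cnj (A $$ (j, i))"
  by (simp add: mat_adjoint_def mat_of_rows_index)

lemma gram_index:
  assumes "A \<in> carrier_mat n r" "a < r" "b < r"
  shows "gram A $$ (a, b) = (\<Sum>j<n. cnj (A $$ (j, a)) * A $$ (j, b))"
  using assms mat_adjoint_carrier[OF assms(1)] mat_adjoint_index[OF assms(1)]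
  by (simp add: gram_def scalar_prod_def lessThan_atLeast0)

lemma gram_quadratic:
  assumes A: "A \<in> carrier_mat n r"
  shows "(\<Sum>a<r. cnj (w a) * (\<Sum>b<r. gram A $$ (a, b) * v b))
    = (\<Sum>j<n. cnj (\<Sum>a<r. A $$ (j, a) * w a) * (\<Sum>b<r. A $$ (j, b) * v b))"
proof -
  have "(\<Sum>a<r. cnj (w a) * (\<Sum>b<r. gram A $$ (a, b) * v b))
      = (\<Sum>a<r. \<Sum>b<r. \<Sum>j<n. cnj (w a) * (cnj (A $$ (j, a)) * A $$ (j, b) * v b))"
    by (simp add: gram_index[OF A] sum_distrib_left sum_distrib_right)
  also have "\<dots> = (\<Sum>a<r. \<Sum>j<n. \<Sum>b<r. cnj (w a) * (cnj (A $$ (j, a)) * A $$ (j, b) * v b))"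
    by (intro sum.cong refl sum.swap)
  also have "\<dots> = (\<Sum>j<n. \<Sum>a<r. \<Sum>b<r. cnj (w a) * (cnj (A $$ (j, a)) * A $$ (j, b) * v b))"
    by (rule sum.swap)
  also have "\<dots> = (\<Sum>j<n. cnj (\<Sum>a<r. A $$ (j, a) * w a) * (\<Sum>b<r. A $$ (j, b) * v b))"
    by (simp only: cnj_sum complex_cnj_mult sum_product) (simp add: mult_ac)
  finally show ?thesis .
qed

lemma mult_mat_vec_index:
  "A \<in> carrier_mat n r \<Longrightarrow> v \<in> carrier_vec r \<Longrightarrow> j < n \<Longrightarrow>
    Matrix.vec_index (A *\<^sub>v v) j = (\<Sum>b<r. A $$ (j, b) * Matrix.vec_index v b)"
  by (simp add: scalar_prod_def lessThan_atLeast0)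

text \<open>
  The Gram matrix and \<open>A\<close> have the same kernel, because \<open>\<langle>A\<^sup>*A v, v\<rangle> = \<parallel>A v\<parallel>\<^sup>2\<close>.
\<close>

lemma full_column_rank_iff_gram:
  assumes A: "A \<in> carrier_mat n r"
  shows "full_column_rank A \<longleftrightarrow> Determinant.det (gram A) \<noteq> 0"
proof -
  have G: "gram A \<in> carrier_mat r r" by (rule gram_carrier[OF A])
  have ker: "gram A *\<^sub>v v = 0\<^sub>v r \<longleftrightarrow> A *\<^sub>v v = 0\<^sub>v n" if v: "v \<in> carrier_vec r" for v
  proof
    assume Gv: "gram A *\<^sub>v v = 0\<^sub>v r"
    let ?v = "Matrix.vec_index v"
    have "(\<Sum>b<r. gram A $$ (a, b) * ?v b) = 0" if "a < r" for a
      using mult_mat_vec_index[OF G v that] Gv that by simp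
    then have "(\<Sum>j<n. cnj (\<Sum>a<r. A $$ (j, a) * ?v a) * (\<Sum>b<r. A $$ (j, b) * ?v b)) = 0"
      using gram_quadratic[OF A, of ?v ?v] by simp
    then have "complex_of_real (\<Sum>j<n. (cmod (\<Sum>b<r. A $$ (j, b) * ?v b))\<^sup>2) = 0"
      by (simp only: mult.commute[of "cnj _"] mult_cnj_self of_real_sum)
    then have "(\<Sum>j<n. (cmod (\<Sum>b<r. A $$ (j, b) * ?v b))\<^sup>2) = 0"
      by (simp only: of_real_eq_0_iff)
    then have "\<forall>j<n. (\<Sum>b<r. A $$ (j, b) * ?v b) = 0"
      by (subst (asm) sum_nonneg_eq_0_iff) auto
    then show "A *\<^sub>v v = 0\<^sub>v n"
      using mult_mat_vec_index[OF A v] A by (intro eq_vecI) auto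
  next
    assume Av: "A *\<^sub>v v = 0\<^sub>v n"
    have "gram A *\<^sub>v v = mat_adjoint A *\<^sub>v (A *\<^sub>v v)"
      unfolding gram_def using A mat_adjoint_carrier[OF A] v by (intro assoc_mult_mat_vec) auto
    also have "\<dots> = 0\<^sub>v r"
      unfolding Av using mat_adjoint_carrier[OF A] by (intro eq_vecI) (auto simp: scalar_prod_def)
    finally show "gram A *\<^sub>v v = 0\<^sub>v r" .
  qed
  have "full_column_rank A \<longleftrightarrow> (\<forall>v\<in>carrier_vec r. A *\<^sub>v v = 0\<^sub>v n \<longrightarrow> v = 0\<^sub>v r)"
    using vec_space.rank_eq_iff_kernel_trivial[OF A] A by (simp add: full_column_rank_def)
  also have "\<dots> \<longleftrightarrow> Determinant.det (gram A) \<noteq> 0"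
    using det_0_iff_vec_prod_zero_field[OF G] ker by blast
  finally show ?thesis .
qed

lemma full_column_rank_if_bounded_below:
  assumes A: "A \<in> carrier_mat n r" and c: "0 < c"
    and low: "\<And>v. c * (\<Sum>b<r. (cmod (v b))\<^sup>2) \<le> (\<Sum>j<n. (cmod (\<Sum>b<r. A $$ (j, b) * v b))\<^sup>2)"
  shows "full_column_rank A"
proof -
  have "v = 0\<^sub>v r" if v: "v \<in> carrier_vec r" and z: "A *\<^sub>v v = 0\<^sub>v n" for v
  proof -
    have "(\<Sum>b<r. A $$ (j, b) * Matrix.vec_index v b) = 0" if "j < n" for j
      using mult_mat_vec_index[OF A v that] z that by simp
    then have "c * (\<Sum>b<r. (cmod (Matrix.vec_index v b))\<^sup>2) \<le> 0"
      using low[of "Matrix.vec_index v"] by simp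
    then have "(\<Sum>b<r. (cmod (Matrix.vec_index v b))\<^sup>2) \<le> 0"
      using c by (simp add: mult_le_0_iff)
    moreover have "0 \<le> (\<Sum>b<r. (cmod (Matrix.vec_index v b))\<^sup>2)" by (rule sum_nonneg) simp
    ultimately have "(\<Sum>b<r. (cmod (Matrix.vec_index v b))\<^sup>2) = 0" by (rule antisym)
    then have "\<forall>b<r. Matrix.vec_index v b = 0" by (subst (asm) sum_nonneg_eq_0_iff) auto
    then show ?thesis using v by (intro eq_vecI) auto
  qed
  then show ?thesis
    using vec_space.rank_eq_iff_kernel_trivial[OF A] A by (simp add: full_column_rank_def)
qed

lemma mat_inverse_gram:
  assumes A: "A \<in> carrier_mat n r" and d: "Determinant.det (gram A) \<noteq> 0"
  obtains W where "mat_inverse (gram A) = Some W" "W \<in> carrier_mat r r"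
    "gram A * W = 1\<^sub>m r" "W * gram A = 1\<^sub>m r"
proof (cases "mat_inverse (gram A)")
  case None
  then show ?thesis
    using mat_inverse(1)[OF gram_carrier[OF A] None, of "()"]
      det_non_zero_imp_unit[OF gram_carrier[OF A] d, of "()"] by blast
next
  case (Some W)
  then show ?thesis using mat_inverse(2)[OF gram_carrier[OF A] Some] that by blast
qed

text \<open>
  Cramer's rule; its purpose is to make the weights visibly measurable in the nodes.
\<close>

lemma mat_inverse_gram_index:
  assumes A: "A \<in> carrier_mat n r" and d: "Determinant.det (gram A) \<noteq> 0"
    and kl: "k < r" "l < r"
  shows "the (mat_inverse (gram A)) $$ (k, l) = adj_mat (gram A) $$ (k, l) / Determinant.det (gram A)"
proof -
  obtain W where W: "mat_inverse (gram A) = Some W" "W \<in> carrier_mat r r"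
    "gram A * W = 1\<^sub>m r" "W * gram A = 1\<^sub>m r" by (rule mat_inverse_gram[OF A d])
  note G = gram_carrier[OF A]
  note adj = adj_mat[OF G]
  have "adj_mat (gram A) = adj_mat (gram A) * (gram A * W)"
    using adj(1) by (simp add: W(3))
  also have "\<dots> = (adj_mat (gram A) * gram A) * W"
    using adj(1) G W(2) by (intro assoc_mult_mat[symmetric]) auto
  also have "\<dots> = Determinant.det (gram A) \<cdot>\<^sub>m W"
    unfolding adj(3) using W(2) by (subst mult_smult_assoc_mat[of _ r r _ r]) auto
  finally have "adj_mat (gram A) $$ (k, l) = Determinant.det (gram A) * W $$ (k, l)"
    using W(2) kl by simp
  then show ?thesis using d by (simp add: W(1))
qed

section \<open>The cubature rule integrates the least squares fit\<close>

lemma L_mat_carrier: "L_mat lam e m n X \<in> carrier_mat n (m - 1)"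
  by (simp add: L_mat_def)

lemma L_mat_index: "j < n \<Longrightarrow> k < m - 1 \<Longrightarrow> L_mat lam e m n X $$ (j, k) = eta lam e (k + 1) (X j)"
  by (simp add: L_mat_def)

definition cubature_coeff :: "(nat \<Rightarrow> real) \<Rightarrow> (nat \<Rightarrow> 'a \<Rightarrow> complex) \<Rightarrow> nat \<Rightarrow> nat \<Rightarrow> (nat \<Rightarrow> 'a) \<Rightarrow>
    nat \<Rightarrow> nat \<Rightarrow> complex" where
  "cubature_coeff lam e m n X j k =
    (\<Sum>l<m - 1. cnj (eta lam e (l + 1) (X j)) * cnj (the (mat_inverse (gram (L_mat lam e m n X))) $$ (l, k)))"

lemma cubature_eq:
  assumes full: "full_column_rank (L_mat lam e m n X)"
  shows "cubature \<mu> lam e m n X f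
    = (\<Sum>j<n. (\<Sum>k<m - 1. cubature_coeff lam e m n X j k * (\<integral>x. eta lam e (k + 1) x \<partial>\<mu>)) * f (X j))"
proof -
  let ?L = "L_mat lam e m n X"
  let ?r = "m - 1"
  obtain W where W: "mat_inverse (gram ?L) = Some W" "W \<in> carrier_mat ?r ?r"
    using mat_inverse_gram[OF L_mat_carrier] full full_column_rank_iff_gram[OF L_mat_carrier] by metis
  have dims: "dim_row ?L = n" "dim_col ?L = ?r" by (simp_all add: L_mat_def)
  have "Matrix.vec_index (cubature_weights \<mu> lam e m n X) j
      = (\<Sum>k<?r. cubature_coeff lam e m n X j k * (\<integral>x. eta lam e (k + 1) x \<partial>\<mu>))" if j: "j < n" for j
  proof -
    have W': "the (mat_inverse (mat_adjoint ?L * ?L)) = W" using W(1) by (simp add: gram_def)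
    have "Matrix.vec_index (cubature_weights \<mu> lam e m n X) j
        = (\<Sum>k<?r. (map_mat cnj ?L * map_mat cnj W) $$ (j, k) * (\<integral>x. eta lam e (k + 1) x \<partial>\<mu>))"
      unfolding cubature_weights_def Let_def W'
      by (subst mult_mat_vec_index[where n = n and r = ?r]) (use W(2) j dims in auto)
    also have "\<dots> = (\<Sum>k<?r. cubature_coeff lam e m n X j k * (\<integral>x. eta lam e (k + 1) x \<partial>\<mu>))"
    proof (intro sum.cong refl arg_cong2[where f = "(*)"])
      fix k assume k: "k \<in> {..<?r}"
      show "(map_mat cnj ?L * map_mat cnj W) $$ (j, k) = cubature_coeff lam e m n X j k"
        using k j W dims
        by (simp add: scalar_prod_def cubature_coeff_def lessThan_atLeast0 L_mat_index)
    qed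
    finally show ?thesis .
  qed
  then show ?thesis by (simp add: cubature_def)
qed

text \<open>
  The coefficients \<open>c\<close> of the least squares fit solve the normal equations, and the weights are defined by
  the transposed system. Conjugation disappears since the Gram matrix is Hermitian.
\<close>

lemma cubature_least_squares:
  assumes full: "full_column_rank (L_mat lam e m n X)"
  obtains c where
    "\<And>a. a < m - 1 \<Longrightarrow> (\<Sum>b<m - 1. gram (L_mat lam e m n X) $$ (a, b) * c b)
      = (\<Sum>j<n. cnj (eta lam e (a + 1) (X j)) * f (X j))"
    "cubature \<mu> lam e m n X f = (\<Sum>k<m - 1. c k * (\<integral>x. eta lam e (k + 1) x \<partial>\<mu>))"
proof -
  let ?L = "L_mat lam e m n X"
  let ?r = "m - 1"
  define G where "G = gram ?L"
  have L: "?L \<in> carrier_mat n ?r" by (rule L_mat_carrier)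
  have GC: "G \<in> carrier_mat ?r ?r" unfolding G_def by (rule gram_carrier[OF L])
  obtain W where W: "mat_inverse G = Some W" "W \<in> carrier_mat ?r ?r" "G * W = 1\<^sub>m ?r"
    using mat_inverse_gram[OF L] full full_column_rank_iff_gram[OF L] unfolding G_def by metis
  have GW: "(\<Sum>b<?r. G $$ (a, b) * W $$ (b, k)) = (if a = k then 1 else 0)" if "a < ?r" "k < ?r" for a k
    using arg_cong[OF W(3), of "\<lambda>M. M $$ (a, k)"] that GC W(2)
    by (simp add: scalar_prod_def lessThan_atLeast0)
  have herm: "cnj (G $$ (a, b)) = G $$ (b, a)" if "a < ?r" "b < ?r" for a b
    using that by (simp add: G_def gram_index[OF L] mult.commute)
  define y where "y = (\<lambda>a. \<Sum>j<n. cnj (eta lam e (a + 1) (X j)) * f (X j))"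
  define b where "b = (\<lambda>k. \<integral>x. eta lam e (k + 1) x \<partial>\<mu>)"
  define c where "c = (\<lambda>l. \<Sum>k<?r. W $$ (l, k) * y k)"
  define d where "d = (\<lambda>l. \<Sum>k<?r. cnj (W $$ (l, k)) * b k)"
  have normal: "(\<Sum>l<?r. G $$ (a, l) * c l) = y a" if a: "a < ?r" for a
  proof -
    have "(\<Sum>l<?r. G $$ (a, l) * c l) = (\<Sum>l<?r. \<Sum>k<?r. G $$ (a, l) * W $$ (l, k) * y k)"
      by (simp add: c_def sum_distrib_left mult.assoc)
    also have "\<dots> = (\<Sum>k<?r. \<Sum>l<?r. G $$ (a, l) * W $$ (l, k) * y k)" by (rule sum.swap)
    also have "\<dots> = (\<Sum>k<?r. (if a = k then 1 else 0) * y k)"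
      using a by (intro sum.cong refl) (simp only: sum_distrib_right[symmetric] GW lessThan_iff)
    also have "\<dots> = (\<Sum>k<?r. if a = k then y k else 0)" by (intro sum.cong) auto
    also have "\<dots> = y a" using a by simp
    finally show ?thesis .
  qed
  have dual: "(\<Sum>l<?r. G $$ (l, a) * d l) = b a" if a: "a < ?r" for a
  proof -
    have "(\<Sum>l<?r. G $$ (l, a) * d l) = (\<Sum>l<?r. \<Sum>k<?r. G $$ (l, a) * cnj (W $$ (l, k)) * b k)"
      by (simp add: d_def sum_distrib_left mult.assoc)
    also have "\<dots> = (\<Sum>k<?r. \<Sum>l<?r. G $$ (l, a) * cnj (W $$ (l, k)) * b k)" by (rule sum.swap)
    also have "\<dots> = (\<Sum>k<?r. cnj (\<Sum>l<?r. G $$ (a, l) * W $$ (l, k)) * b k)"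
      using a by (intro sum.cong refl) (simp add: herm sum_distrib_right)
    also have "\<dots> = (\<Sum>k<?r. if a = k then b k else 0)"
      using a by (intro sum.cong refl) (simp add: GW)
    also have "\<dots> = b a" using a by simp
    finally show ?thesis .
  qed
  have "cubature \<mu> lam e m n X f
      = (\<Sum>j<n. (\<Sum>l<?r. cnj (eta lam e (l + 1) (X j)) * d l) * f (X j))"
  proof -
    have "(\<Sum>k<?r. cubature_coeff lam e m n X j k * b k)
        = (\<Sum>l<?r. cnj (eta lam e (l + 1) (X j)) * d l)" for j
    proof -
      have "(\<Sum>k<?r. cubature_coeff lam e m n X j k * b k)
          = (\<Sum>k<?r. \<Sum>l<?r. cnj (eta lam e (l + 1) (X j)) * cnj (W $$ (l, k)) * b k)"
        by (simp add: cubature_coeff_def W(1)[unfolded G_def] sum_distrib_right)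
      also have "\<dots> = (\<Sum>l<?r. \<Sum>k<?r. cnj (eta lam e (l + 1) (X j)) * cnj (W $$ (l, k)) * b k)"
        by (rule sum.swap)
      finally show ?thesis by (simp add: d_def sum_distrib_left mult.assoc)
    qed
    then show ?thesis unfolding cubature_eq[OF full] b_def by simp
  qed
  also have "\<dots> = (\<Sum>j<n. \<Sum>l<?r. d l * (cnj (eta lam e (l + 1) (X j)) * f (X j)))"
    by (simp add: sum_distrib_right sum_distrib_left mult_ac)
  also have "\<dots> = (\<Sum>l<?r. \<Sum>j<n. d l * (cnj (eta lam e (l + 1) (X j)) * f (X j)))" by (rule sum.swap)
  also have "\<dots> = (\<Sum>l<?r. d l * (\<Sum>k<?r. G $$ (l, k) * c k))"
    by (intro sum.cong refl) (simp add: normal y_def sum_distrib_left)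
  also have "\<dots> = (\<Sum>l<?r. \<Sum>k<?r. c k * (G $$ (l, k) * d l))"
    by (simp add: sum_distrib_left mult_ac)
  also have "\<dots> = (\<Sum>k<?r. \<Sum>l<?r. c k * (G $$ (l, k) * d l))" by (rule sum.swap)
  also have "\<dots> = (\<Sum>k<?r. c k * b k)"
    by (intro sum.cong refl) (simp add: dual flip: sum_distrib_left)
  finally have "cubature \<mu> lam e m n X f = (\<Sum>k<?r. c k * b k)" .
  then show ?thesis using that[of c] normal by (simp add: G_def y_def b_def)
qed

section \<open>Measurability\<close>

lemma measurable_det:
  assumes "\<And>\<omega>. A \<omega> \<in> carrier_mat r r"
    and [measurable]: "\<And>i j. i < r \<Longrightarrow> j < r \<Longrightarrow> (\<lambda>\<omega>. A \<omega> $$ (i, j)) \<in> borel_measurable N"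
  shows "(\<lambda>\<omega>. Determinant.det (A \<omega> :: complex Matrix.mat)) \<in> borel_measurable N"
proof -
  have "(\<lambda>\<omega>. \<Sum>p\<in>{p. p permutes {0..<r}}. signof p * (\<Prod>i = 0..<r. A \<omega> $$ (i, p i)))
      \<in> borel_measurable N"
  proof (intro borel_measurable_sum borel_measurable_times borel_measurable_prod borel_measurable_const)
    fix p i assume "p \<in> {p. p permutes {0..<r}}" "i \<in> {0..<r}"
    then have "i < r" "p i < r" using permutes_in_image[of p "{0..<r}" i] by auto
    then show "(\<lambda>\<omega>. A \<omega> $$ (i, p i)) \<in> borel_measurable N" by (rule assms(2))
  qed
  then show ?thesis by (simp add: det_def'[OF assms(1)])
qed

lemma measurable_adj_mat:
  assumes A: "\<And>\<omega>. A \<omega> \<in> carrier_mat r r"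
    and meas: "\<And>i j. i < r \<Longrightarrow> j < r \<Longrightarrow> (\<lambda>\<omega>. A \<omega> $$ (i, j)) \<in> borel_measurable N"
    and kl: "k < r" "l < r"
  shows "(\<lambda>\<omega>. adj_mat (A \<omega> :: complex Matrix.mat) $$ (k, l)) \<in> borel_measurable N"
proof -
  have dims: "dim_row (A \<omega>) = r" "dim_col (A \<omega>) = r" for \<omega> using A[of \<omega>] by auto
  have "(\<lambda>\<omega>. Determinant.det (mat_delete (A \<omega>) l k)) \<in> borel_measurable N"
  proof (rule measurable_det)
    show "mat_delete (A \<omega>) l k \<in> carrier_mat (r - 1) (r - 1)" for \<omega>
      using mat_delete_carrier[OF A] by simp
    fix i j assume ij: "i < r - 1" "j < r - 1"
    have "(\<lambda>\<omega>. A \<omega> $$ (if i < l then i else Suc i, if j < k then j else Suc j)) \<in> borel_measurable N"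
      using ij by (intro meas) auto
    then show "(\<lambda>\<omega>. mat_delete (A \<omega>) l k $$ (i, j)) \<in> borel_measurable N"
      using ij by (simp add: mat_delete_def dims)
  qed
  then show ?thesis using kl by (simp add: adj_mat_def cofactor_def dims)
qed

section \<open>The error of the cubature rule\<close>

locale cubature_setting = rkhs_L2 D K H ip \<rho> B lam e
  for D :: "'a set" and K H ip and \<rho> :: "'a measure" and B lam e +
  fixes \<mu> :: "'a measure"
  assumes embeds: "L1_embeds \<rho> \<mu>"
begin

abbreviation C :: real where "C \<equiv> L1_embedding_norm \<rho> \<mu>"

lemma C_nonneg: "0 \<le> C"
  and L1_bound: "integrable \<rho> f \<Longrightarrow> (\<integral>x. cmod (f x) \<partial>\<mu>) \<le> C * (\<integral>x. cmod (f x) \<partial>\<rho>)"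
  for f :: "'a \<Rightarrow> complex"
proof -
  obtain C0 where C0: "\<And>f :: 'a \<Rightarrow> complex. integrable \<rho> f \<Longrightarrow>
      (\<integral>x. cmod (f x) \<partial>\<mu>) \<le> C0 * (\<integral>x. cmod (f x) \<partial>\<rho>)"
    using embeds unfolding L1_embeds_def by blast
  let ?A = "{f :: 'a \<Rightarrow> complex. integrable \<rho> f \<and> (\<integral>x. cmod (f x) \<partial>\<rho>) \<le> 1}"
  have bdd: "bdd_above ((\<lambda>f. \<integral>x. cmod (f x) \<partial>\<mu>) ` ?A)"
  proof (rule bdd_aboveI2)
    fix f :: "'a \<Rightarrow> complex" assume "f \<in> ?A"
    then have i: "integrable \<rho> f" and le: "(\<integral>x. cmod (f x) \<partial>\<rho>) \<le> 1" by auto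
    have "(\<integral>x. cmod (f x) \<partial>\<mu>) \<le> C0 * (\<integral>x. cmod (f x) \<partial>\<rho>)" by (rule C0[OF i])
    also have "\<dots> \<le> \<bar>C0\<bar> * (\<integral>x. cmod (f x) \<partial>\<rho>)" by (intro mult_right_mono) auto
    also have "\<dots> \<le> \<bar>C0\<bar> * 1" using le by (intro mult_left_mono) auto
    finally show "(\<integral>x. cmod (f x) \<partial>\<mu>) \<le> \<bar>C0\<bar>" by simp
  qed
  have up: "(\<integral>x. cmod (g x) \<partial>\<mu>) \<le> C" if "g \<in> ?A" for g :: "'a \<Rightarrow> complex"
    unfolding L1_embedding_norm_def by (rule cSUP_upper[OF that bdd])
  show "0 \<le> C" using up[of "\<lambda>_. 0"] by simp
  assume f: "integrable \<rho> f"
  define s where "s = (\<integral>x. cmod (f x) \<partial>\<rho>)"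
  have s0: "0 \<le> s" by (simp add: s_def)
  have "(\<integral>x. cmod (f x) \<partial>\<mu>) \<le> C * s"
  proof (cases "s = 0")
    case True
    then show ?thesis using C0[OF f] by (simp add: s_def[symmetric])
  next
    case False
    then have pos: "s > 0" using s0 by simp
    have eq: "cmod (of_real (1 / s) * f x) = 1 / s * cmod (f x)" for x
      using pos by (simp only: norm_mult norm_of_real) simp
    have "(\<lambda>x. of_real (1 / s) * f x) \<in> ?A"
    proof -
      have "integrable \<rho> (\<lambda>x. of_real (1 / s) * f x)" by (rule integrable_mult_right[OF f])
      moreover have "(\<integral>x. cmod (of_real (1 / s) * f x) \<partial>\<rho>) = 1"
        unfolding eq integral_mult_right_zero s_def[symmetric] using pos by simp
      ultimately show ?thesis by simp
    qed
    from up[OF this] have "1 / s * (\<integral>x. cmod (f x) \<partial>\<mu>) \<le> C"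
      unfolding eq integral_mult_right_zero .
    then show ?thesis using pos by (simp add: field_simps)
  qed
  then show "(\<integral>x. cmod (f x) \<partial>\<mu>) \<le> C * (\<integral>x. cmod (f x) \<partial>\<rho>)" by (simp add: s_def)
qed

lemma integrable_H: "f \<in> H \<Longrightarrow> integrable \<rho> f"
proof (rule integrable_const_bound)
  assume f: "f \<in> H"
  show "f \<in> borel_measurable \<rho>" by (rule meas_H[OF f])
  show "AE x in \<rho>. cmod (f x) \<le> sqrt (B * sq f)"
    using eval_bound[OF f] by (intro AE_I2 real_le_rsqrt) (simp add: space_rho)
qed

lemma integrable_mu: "f \<in> H \<Longrightarrow> integrable \<mu> f"
  using embeds integrable_H unfolding L1_embeds_def by blast

text \<open>
  The embedding of \<open>L\<^sub>1\<close> spaces followed by \<open>L\<^sub>1 \<le> L\<^sub>2\<close> for the probability measure \<open>\<rho>\<close>.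
\<close>

lemma integral_mu_le:
  assumes f: "f \<in> H"
  shows "(cmod (\<integral>x. f x \<partial>\<mu>))\<^sup>2 \<le> C\<^sup>2 * L2.sq f"
proof -
  have "cmod (\<integral>x. f x \<partial>\<mu>) \<le> (\<integral>x. cmod (f x) \<partial>\<mu>)" by (rule integral_norm_bound)
  also have "\<dots> \<le> C * (\<integral>x. cmod (f x) \<partial>\<rho>)" by (rule L1_bound[OF integrable_H[OF f]])
  finally have "(cmod (\<integral>x. f x \<partial>\<mu>))\<^sup>2 \<le> (C * (\<integral>x. cmod (f x) \<partial>\<rho>))\<^sup>2" by (rule power_mono) simp
  also have "\<dots> = C\<^sup>2 * (\<integral>x. cmod (f x) \<partial>\<rho>)\<^sup>2" by (rule power_mult_distrib)
  also have "\<dots> \<le> C\<^sup>2 * L2.sq f"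
  proof (rule mult_left_mono)
    have "0 \<le> variance (\<lambda>x. cmod (f x))" by (rule variance_positive)
    also have "\<dots> = (\<integral>x. (cmod (f x))\<^sup>2 \<partial>\<rho>) - (\<integral>x. cmod (f x) \<partial>\<rho>)\<^sup>2"
      by (rule variance_eq) (use integrable_H[OF f] integrable_sq[OF f] in auto)
    finally show "(\<integral>x. cmod (f x) \<partial>\<rho>)\<^sup>2 \<le> L2.sq f" by (simp add: L2_sq)
  qed simp
  finally show ?thesis .
qed

text \<open>
  The error is a continuous linear functional of \<open>f\<close>, so a bound on the unit ball is a homogeneous
  condition that only has to be tested on a dense set.
\<close>

lemma worst_case_sq_error_le_iff:
  fixes q :: "nat \<Rightarrow> complex"
  assumes x: "\<And>j. j < n \<Longrightarrow> x j \<in> D" and c: "0 \<le> c"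
    and S: "S \<subseteq> H" "\<And>f \<epsilon>. f \<in> H \<Longrightarrow> \<epsilon> > 0 \<Longrightarrow> \<exists>g\<in>S. hnorm ip (f - g) < \<epsilon>"
  shows "worst_case_sq_error H ip \<mu> (\<lambda>f. \<Sum>j<n. q j * f (x j)) \<le> c
    \<longleftrightarrow> (\<forall>f\<in>S. (cmod ((\<integral>y. f y \<partial>\<mu>) - (\<Sum>j<n. q j * f (x j))))\<^sup>2 \<le> c * sq f)"
proof -
  define \<psi> where "\<psi> = (\<lambda>f. (\<integral>y. f y \<partial>\<mu>) - (\<Sum>j<n. q j * f (x j)))"
  define k where "k = C * sqrt B + (\<Sum>j<n. cmod (q j) * sqrt B)"
  have k0: "0 \<le> k"
    unfolding k_def using C_nonneg B_nonneg
    by (intro add_nonneg_nonneg sum_nonneg) auto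
  have bound: "cmod (\<psi> f) \<le> k * sqrt (sq f)" if f: "f \<in> H" for f
  proof -
    have "(cmod (\<integral>y. f y \<partial>\<mu>))\<^sup>2 \<le> C\<^sup>2 * (B * sq f)"
      by (rule order_trans[OF integral_mu_le[OF f]]) (intro mult_left_mono L2_le f, simp)
    then have "cmod (\<integral>y. f y \<partial>\<mu>) \<le> sqrt (C\<^sup>2 * (B * sq f))" by (rule real_le_rsqrt)
    also have "\<dots> = C * sqrt B * sqrt (sq f)"
      using C_nonneg by (simp add: real_sqrt_mult)
    finally have 1: "cmod (\<integral>y. f y \<partial>\<mu>) \<le> C * sqrt B * sqrt (sq f)" .
    have "cmod (\<Sum>j<n. q j * f (x j)) \<le> (\<Sum>j<n. cmod (q j) * sqrt B * sqrt (sq f))"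
    proof (rule order_trans[OF norm_sum], rule sum_mono)
      fix j assume "j \<in> {..<n}"
      then have "cmod (f (x j)) \<le> sqrt (B * sq f)" using eval_bound[OF f x] by (intro real_le_rsqrt) simp
      then show "cmod (q j * f (x j)) \<le> cmod (q j) * sqrt B * sqrt (sq f)"
        by (simp add: norm_mult real_sqrt_mult mult.assoc mult_left_mono)
    qed
    then show ?thesis
      using 1 norm_triangle_ineq4[of "\<integral>y. f y \<partial>\<mu>" "\<Sum>j<n. q j * f (x j)"]
      by (simp add: \<psi>_def k_def distrib_right sum_distrib_right)
  qed
  have diff: "\<psi> (f - g) = \<psi> f - \<psi> g" if "f \<in> H" "g \<in> H" for f g
  proof -
    have "(\<integral>y. (f - g) y \<partial>\<mu>) = (\<integral>y. f y - g y \<partial>\<mu>)" by (simp only: minus_apply)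
    also have "\<dots> = (\<integral>y. f y \<partial>\<mu>) - (\<integral>y. g y \<partial>\<mu>)"
      by (rule Bochner_Integration.integral_diff[OF integrable_mu[OF that(1)] integrable_mu[OF that(2)]])
    finally show ?thesis by (simp only: \<psi>_def) (simp add: sum_subtractf right_diff_distrib)
  qed
  have scale: "\<psi> (cscale a f) = a * \<psi> f" for a f
    by (simp add: \<psi>_def cscale_def sum_distrib_left right_diff_distrib mult_ac)
  let ?U = "{f \<in> H. hnorm ip f \<le> 1}"
  have wce: "worst_case_sq_error H ip \<mu> (\<lambda>f. \<Sum>j<n. q j * f (x j)) = (SUP f\<in>?U. (cmod (\<psi> f))\<^sup>2)"
    by (simp add: worst_case_sq_error_def \<psi>_def)
  have bdd: "bdd_above ((\<lambda>f. (cmod (\<psi> f))\<^sup>2) ` ?U)"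
  proof (rule bdd_aboveI2)
    fix f assume f: "f \<in> ?U"
    then have "cmod (\<psi> f) \<le> k * sqrt (sq f)" by (intro bound) simp
    also have "\<dots> \<le> k * 1" using f k0 by (intro mult_left_mono) (auto simp: hnorm_eq)
    finally show "(cmod (\<psi> f))\<^sup>2 \<le> k\<^sup>2" by (intro power_mono) auto
  qed
  have "(SUP f\<in>?U. (cmod (\<psi> f))\<^sup>2) \<le> c \<longleftrightarrow> (\<forall>f\<in>S. (cmod (\<psi> f))\<^sup>2 \<le> c * sq f)"
  proof
    assume le: "(SUP f\<in>?U. (cmod (\<psi> f))\<^sup>2) \<le> c"
    show "\<forall>f\<in>S. (cmod (\<psi> f))\<^sup>2 \<le> c * sq f"
    proof
      fix f assume "f \<in> S"
      then have f: "f \<in> H" using S by auto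
      show "(cmod (\<psi> f))\<^sup>2 \<le> c * sq f"
      proof (cases "sq f = 0")
        case True
        then show ?thesis using bound[OF f] by simp
      next
        case False
        then have pos: "sq f > 0" using nonneg[OF f] by simp
        define s where "s = complex_of_real (1 / sqrt (sq f))"
        have s2: "(cmod s)\<^sup>2 = 1 / sq f" using pos by (simp add: s_def norm_divide power_divide)
        have "sq (cscale s f) = 1" using sq_scale[OF f, of s] pos by (simp add: s2)
        then have "cscale s f \<in> ?U" using f by (simp add: hnorm_eq)
        from cSUP_upper[OF this bdd] le have "(cmod (\<psi> (cscale s f)))\<^sup>2 \<le> c" by linarith
        then have "1 / sq f * (cmod (\<psi> f))\<^sup>2 \<le> c"
          unfolding scale norm_mult power_mult_distrib s2 .
        then show ?thesis using pos by (simp add: field_simps)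
      qed
    qed
  next
    assume le: "\<forall>f\<in>S. (cmod (\<psi> f))\<^sup>2 \<le> c * sq f"
    have "(cmod (\<psi> f))\<^sup>2 \<le> c" if f: "f \<in> ?U" for f
    proof -
      have fH: "f \<in> H" and f1: "sqrt (sq f) \<le> 1" using f by (auto simp: hnorm_eq)
      have "cmod (\<psi> f) \<le> sqrt c"
      proof (rule field_le_epsilon)
        fix \<epsilon> :: real assume eps: "\<epsilon> > 0"
        define s where "s = \<epsilon> / (sqrt c + k + 1)"
        have den: "0 < sqrt c + k + 1" using k0 c by (simp add: add_nonneg_pos)
        have s: "s > 0" using den eps by (simp add: s_def)
        have s_eps: "(sqrt c + k + 1) * s = \<epsilon>" using den by (simp add: s_def)
        obtain g where g: "g \<in> S" "sqrt (sq (f - g)) < s" using S(2)[OF fH s] by (auto simp: hnorm_eq)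
        have gH: "g \<in> H" using g S by auto
        have fg: "f - g \<in> H" by (rule diff_mem[OF fH gH])
        have "sqrt (sq g) \<le> sqrt (sq (f - g)) + sqrt (sq f)"
          using norm_triangle[OF diff_mem[OF gH fH] fH]
          by (simp only: diff_add_cancel sq_diff_commute[OF gH fH])
        then have g1: "sqrt (sq g) \<le> s + 1" using g(2) f1 by linarith
        have "cmod (\<psi> g) \<le> sqrt (c * sq g)" using le g(1) by (intro real_le_rsqrt) auto
        also have "\<dots> = sqrt c * sqrt (sq g)" by (rule real_sqrt_mult)
        also have "\<dots> \<le> sqrt c * (s + 1)" using g1 c by (intro mult_left_mono) auto
        finally have 1: "cmod (\<psi> g) \<le> sqrt c * (s + 1)" .
        have "cmod (\<psi> f - \<psi> g) \<le> k * sqrt (sq (f - g))" unfolding diff[OF fH gH, symmetric] by (rule bound[OF fg])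
        also have "\<dots> \<le> k * s" using g(2) k0 by (intro mult_left_mono) auto
        finally have 2: "cmod (\<psi> f - \<psi> g) \<le> k * s" .
        have "cmod (\<psi> f) \<le> cmod (\<psi> g) + cmod (\<psi> f - \<psi> g)"
          using norm_triangle_ineq[of "\<psi> g" "\<psi> f - \<psi> g"] by simp
        also have "\<dots> \<le> sqrt c * (s + 1) + k * s" using 1 2 by linarith
        also have "\<dots> \<le> sqrt c + (sqrt c + k + 1) * s" using s by (simp add: algebra_simps)
        finally show "cmod (\<psi> f) \<le> sqrt c + \<epsilon>" unfolding s_eps .
      qed
      then have "(cmod (\<psi> f))\<^sup>2 \<le> (sqrt c)\<^sup>2" by (intro power_mono) auto
      then show ?thesis using c by simp
    qed
    moreover have "?U \<noteq> {}"
    proof -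
      have "sq 0 = 0" using zero_left[OF zero_mem] by (simp only: zero_complex.sel)
      then have "0 \<in> ?U" using zero_mem by (simp only: hnorm_eq mem_Collect_eq) simp
      then show ?thesis by blast
    qed
    ultimately show "(SUP f\<in>?U. (cmod (\<psi> f))\<^sup>2) \<le> c" by (intro cSUP_least)
  qed
  then show ?thesis unfolding wce by (simp add: \<psi>_def)
qed

lemma sum_shift: "(\<Sum>k\<in>{1..<m}. F k) = (\<Sum>a<m - 1. F (a + 1))" for F :: "nat \<Rightarrow> 'b :: comm_monoid_add"
  by (rule sum.reindex_bij_witness[of _ "\<lambda>a. a + 1" "\<lambda>k. k - 1"]) auto

lemma eta_integrable_mu: "integrable \<mu> (\<lambda>y. eta lam e (a + 1) y)"
  unfolding eta_eq[OF le_add2] by (intro integrable_mult_right integrable_mu e_mem le_add2)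

text \<open>
  Write \<open>\<gamma>\<close> for the coefficients of the fit minus those of the projection of \<open>f\<close>. The normal equations say
  that \<open>\<gamma>\<close> fits the remainder \<open>f2\<close>, so the node values of the fitted function are bounded by those of
  \<open>f2\<close>, and \<open>low\<close> converts them into \<open>\<bar>\<gamma>\<bar>\<^sup>2\<close>. The constant is \<open>1 + 2 \<cdot> 14 = 29\<close>.
\<close>

lemma cubature_error:
  assumes n: "1 \<le> n" and m: "2 \<le> m" and \<delta>: "0 < \<delta>" "\<delta> < 1" and M: "lam m \<le> M"
    and low: "\<And>u. real n / 2 * sqn {..<m - 1} u
      \<le> (\<Sum>j<n. (cmod (cip {..<m - 1} u (\<lambda>a. eta lam e (a + 1) (x j))))\<^sup>2)"
    and up: "\<And>p u. (\<Sum>j<n. (cmod (cip {m..<p} u (\<lambda>k. e k (x j))))\<^sup>2)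
      \<le> 14 * real n * M / \<delta> * sqn {m..<p} u"
    and exp: "\<And>j f. j < n \<Longrightarrow> f \<in> H \<Longrightarrow> (\<lambda>M. proj f M (x j)) \<longlonglongrightarrow> f (x j)"
  shows full: "full_column_rank (L_mat lam e m n x)"
    and "f \<in> H \<Longrightarrow> (cmod ((\<integral>y. f y \<partial>\<mu>) - cubature \<mu> lam e m n x f))\<^sup>2 \<le> 29 * C\<^sup>2 / \<delta> * M * sq f"
proof -
  let ?r = "m - 1"
  let ?L = "L_mat lam e m n x"
  define L where "L = (\<lambda>v j. \<Sum>b<?r. eta lam e (b + 1) (x j) * v b)"
  have L_eq: "(\<Sum>b<?r. ?L $$ (j, b) * v b) = L v j" if "j < n" for v j
    unfolding L_def using that by (intro sum.cong refl) (simp add: L_mat_index)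
  have low': "real n / 2 * (\<Sum>b<?r. (cmod (v b))\<^sup>2) \<le> (\<Sum>j<n. (cmod (L v j))\<^sup>2)" for v
  proof -
    have "cip {..<?r} (\<lambda>b. cnj (v b)) (\<lambda>a. eta lam e (a + 1) (x j)) = cnj (L v j)" for j
      by (simp add: cip_def L_def mult.commute)
    then show ?thesis using low[of "\<lambda>b. cnj (v b)"] by (simp add: sqn_def)
  qed
  show full: "full_column_rank ?L"
  proof (rule full_column_rank_if_bounded_below[OF L_mat_carrier])
    show "0 < real n / 2" using n by simp
    show "real n / 2 * (\<Sum>b<?r. (cmod (v b))\<^sup>2) \<le> (\<Sum>j<n. (cmod (\<Sum>b<?r. ?L $$ (j, b) * v b))\<^sup>2)" for v
      using low'[of v] by (simp add: L_eq)
  qed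
  assume f: "f \<in> H"
  have m1: "1 \<le> m" using m by simp
  have lm: "0 < lam m" by (rule lam_pos[OF m1])
  then have M0: "0 < M" using M by simp
  define f2 where "f2 = f - proj f m"
  have f2H: "f2 \<in> H" unfolding f2_def by (rule diff_mem[OF f proj_mem])
  have orth: "ip f2 (e k) = 0" if "k \<in> {1..<m}" for k
    unfolding f2_def using that by (intro ip_minus_proj f) auto
  have sq_f2: "sq f2 \<le> sq f"
    unfolding f2_def sq_minus_proj[OF f] by (simp add: sum_nonneg)
  have nodes: "(\<Sum>j<n. (cmod (f2 (x j)))\<^sup>2) \<le> 14 * real n * M / \<delta> * sq f"
  proof (rule LIMSEQ_le_const2)
    show "(\<lambda>p. \<Sum>j<n. (cmod (proj f p (x j) - proj f m (x j)))\<^sup>2) \<longlonglongrightarrow> (\<Sum>j<n. (cmod (f2 (x j)))\<^sup>2)"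
      unfolding f2_def by (intro tendsto_sum tendsto_power tendsto_norm) (simp, intro tendsto_diff exp f tendsto_const, simp)
    show "\<exists>N. \<forall>p\<ge>N. (\<Sum>j<n. (cmod (proj f p (x j) - proj f m (x j)))\<^sup>2) \<le> 14 * real n * M / \<delta> * sq f"
    proof (intro exI allI impI)
      fix p assume p: "m \<le> p"
      define u where "u = (\<lambda>k. cnj (ip f (e k)))"
      have "proj f p y - proj f m y = cnj (cip {m..<p} u (\<lambda>k. e k y))" for y
      proof -
        have "proj f p y = proj f m y + (\<Sum>k\<in>{m..<p}. ip f (e k) * e k y)"
          unfolding proj_apply using p m1 by (simp add: sum.atLeastLessThan_concat)
        then show ?thesis by (simp add: cip_def u_def)
      qed
      then have "(\<Sum>j<n. (cmod (proj f p (x j) - proj f m (x j)))\<^sup>2)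
          = (\<Sum>j<n. (cmod (cip {m..<p} u (\<lambda>k. e k (x j))))\<^sup>2)" by simp
      also have "\<dots> \<le> 14 * real n * M / \<delta> * sqn {m..<p} u" by (rule up)
      also have "\<dots> \<le> 14 * real n * M / \<delta> * sq f"
      proof (rule mult_left_mono)
        show "sqn {m..<p} u \<le> sq f"
        proof -
          have "(\<Sum>k\<in>{m..<p}. (cmod (ip f (e k)))\<^sup>2) \<le> sq f" using m1 by (intro bessel[OF f]) auto
          then show ?thesis by (simp add: sqn_def u_def)
        qed
        show "0 \<le> 14 * real n * M / \<delta>" using M0 \<delta> by simp
      qed
      finally show "(\<Sum>j<n. (cmod (proj f p (x j) - proj f m (x j)))\<^sup>2) \<le> 14 * real n * M / \<delta> * sq f" .
    qed
  qed
  from cubature_least_squares[OF full, where f = f and \<mu> = \<mu>]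
  obtain c where c: "\<And>a. a < ?r \<Longrightarrow> (\<Sum>b<?r. gram ?L $$ (a, b) * c b)
        = (\<Sum>j<n. cnj (eta lam e (a + 1) (x j)) * f (x j))"
    and Q: "cubature \<mu> lam e m n x f = (\<Sum>k<?r. c k * (\<integral>y. eta lam e (k + 1) y \<partial>\<mu>))" by blast
  define \<beta> where "\<beta> = (\<lambda>a. ip f (e (a + 1)) * of_real (sqrt (lam (a + 1))))"
  define \<gamma> where "\<gamma> = (\<lambda>a. c a - \<beta> a)"
  have lam1: "0 < lam (a + 1)" for a by (rule lam_pos) simp
  have proj_eta: "proj f m y = (\<Sum>a<?r. eta lam e (a + 1) y * \<beta> a)" for y
    unfolding proj_apply sum_shift
  proof (intro sum.cong refl)
    fix a
    have "eta lam e (a + 1) y * \<beta> a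
        = of_real (inverse (sqrt (lam (a + 1))) * sqrt (lam (a + 1))) * (ip f (e (a + 1)) * e (a + 1) y)"
      by (simp only: eta_eq[OF le_add2] \<beta>_def of_real_mult mult_ac)
    also have "inverse (sqrt (lam (a + 1))) * sqrt (lam (a + 1)) = 1" using lam1[of a] by simp
    finally show "ip f (e (a + 1)) * e (a + 1) y = eta lam e (a + 1) y * \<beta> a" by simp
  qed
  have f2_eq: "f2 (x j) = f (x j) - L \<beta> j" for j
    by (simp add: f2_def proj_eta L_def)
  have normal: "(\<Sum>b<?r. gram ?L $$ (a, b) * \<gamma> b) = (\<Sum>j<n. cnj (eta lam e (a + 1) (x j)) * f2 (x j))"
    if a: "a < ?r" for a
  proof -
    have "(\<Sum>b<?r. gram ?L $$ (a, b) * \<beta> b)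
        = (\<Sum>b<?r. \<Sum>j<n. cnj (eta lam e (a + 1) (x j)) * (eta lam e (b + 1) (x j) * \<beta> b))"
      using a by (intro sum.cong refl)
        (simp add: gram_index[OF L_mat_carrier] L_mat_index sum_distrib_right mult.assoc)
    also have "\<dots> = (\<Sum>j<n. \<Sum>b<?r. cnj (eta lam e (a + 1) (x j)) * (eta lam e (b + 1) (x j) * \<beta> b))"
      by (rule sum.swap)
    also have "\<dots> = (\<Sum>j<n. cnj (eta lam e (a + 1) (x j)) * L \<beta> j)"
      by (simp add: L_def sum_distrib_left)
    finally show ?thesis
      using c[OF a] by (simp add: \<gamma>_def f2_eq right_diff_distrib sum_subtractf)
  qed
  have gamma_le: "(\<Sum>a<?r. (cmod (\<gamma> a))\<^sup>2) \<le> 28 * M / \<delta> * sq f"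
  proof -
    define s where "s = (\<Sum>j<n. (cmod (L \<gamma> j))\<^sup>2)"
    have s0: "0 \<le> s" unfolding s_def by (rule sum_nonneg) simp
    have "of_real s = (\<Sum>j<n. cnj (L \<gamma> j) * L \<gamma> j)"
      by (simp only: s_def of_real_sum mult.commute[of "cnj _"] mult_cnj_self)
    also have "\<dots> = (\<Sum>a<?r. cnj (\<gamma> a) * (\<Sum>b<?r. gram ?L $$ (a, b) * \<gamma> b))"
      unfolding gram_quadratic[OF L_mat_carrier] by (intro sum.cong refl) (simp add: L_eq)
    also have "\<dots> = (\<Sum>a<?r. \<Sum>j<n. cnj (eta lam e (a + 1) (x j) * \<gamma> a) * f2 (x j))"
      by (intro sum.cong refl) (simp only: lessThan_iff normal, simp add: sum_distrib_left mult_ac)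
    also have "\<dots> = (\<Sum>j<n. \<Sum>a<?r. cnj (eta lam e (a + 1) (x j) * \<gamma> a) * f2 (x j))" by (rule sum.swap)
    also have "\<dots> = cip {..<n} (\<lambda>j. f2 (x j)) (L \<gamma>)"
      by (simp add: cip_def L_def sum_distrib_left mult_ac)
    finally have eq: "of_real s = cip {..<n} (\<lambda>j. f2 (x j)) (L \<gamma>)" .
    have "s\<^sup>2 = (cmod (of_real s))\<^sup>2" using s0 by simp
    also have "\<dots> \<le> sqn {..<n} (\<lambda>j. f2 (x j)) * sqn {..<n} (L \<gamma>)" unfolding eq by (rule cmod_cip_le)
    also have "\<dots> = (\<Sum>j<n. (cmod (f2 (x j)))\<^sup>2) * s" by (simp add: sqn_def s_def)
    finally have "s * s \<le> (\<Sum>j<n. (cmod (f2 (x j)))\<^sup>2) * s" by (simp add: power2_eq_square)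
    then have "s \<le> (\<Sum>j<n. (cmod (f2 (x j)))\<^sup>2)"
    proof (cases "s = 0")
      case True
      then show ?thesis by (simp add: sum_nonneg)
    next
      case False
      then have "0 < s" using s0 by simp
      then show ?thesis using \<open>s * s \<le> _\<close> by (rule mult_right_le_imp_le[rotated])
    qed
    then have "real n / 2 * (\<Sum>a<?r. (cmod (\<gamma> a))\<^sup>2) \<le> 14 * real n * M / \<delta> * sq f"
      using low'[of \<gamma>] nodes by (simp add: s_def)
    also have "\<dots> = real n / 2 * (28 * M / \<delta> * sq f)" by simp
    finally show ?thesis by (rule mult_left_le_imp_le) (use n in simp)
  qed
  define w where "w = (\<Sum>k\<in>{1..<m}. cscale (of_real (inverse (sqrt (lam k))) * \<gamma> (k - 1)) (e k))"
  have wH: "w \<in> H" unfolding w_def by (rule comb_mem) auto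
  have w_eta: "w y = (\<Sum>a<?r. eta lam e (a + 1) y * \<gamma> a)" for y
    unfolding w_def sum_fun_apply sum_shift cscale_def
    by (intro sum.cong refl) (simp add: eta_eq[OF le_add2] mult_ac)
  have L2_w: "L2.sq w = (\<Sum>a<?r. (cmod (\<gamma> a))\<^sup>2)"
  proof -
    have "L2.sq w = (\<Sum>k\<in>{1..<m}. lam k * (cmod (of_real (inverse (sqrt (lam k))) * \<gamma> (k - 1)))\<^sup>2)"
      unfolding w_def by (rule sq_comb(2)) auto
    also have "\<dots> = (\<Sum>a<?r. lam (a + 1) * (cmod (of_real (inverse (sqrt (lam (a + 1)))) * \<gamma> a))\<^sup>2)"
      unfolding sum_shift by simp
    also have "\<dots> = (\<Sum>a<?r. (cmod (\<gamma> a))\<^sup>2)"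
    proof (intro sum.cong refl)
      fix a
      have "(cmod (complex_of_real (inverse (sqrt (lam (a + 1))))))\<^sup>2 = inverse (lam (a + 1))"
        using lam1[of a] by (simp only: norm_of_real power2_abs power_inverse) simp
      then show "lam (a + 1) * (cmod (of_real (inverse (sqrt (lam (a + 1)))) * \<gamma> a))\<^sup>2 = (cmod (\<gamma> a))\<^sup>2"
        unfolding norm_mult power_mult_distrib using lam1[of a] by simp
    qed
    finally show ?thesis .
  qed
  have L2_orth: "L2_inner \<rho> w f2 = 0"
  proof -
    have "L2_inner \<rho> w f2 = (\<Sum>k\<in>{1..<m}. L2_inner \<rho> (cscale (of_real (inverse (sqrt (lam k))) * \<gamma> (k - 1)) (e k)) f2)"
      unfolding w_def by (rule L2.sum_left[OF _ f2H]) (auto intro!: scale_mem e_mem)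
    also have "\<dots> = 0"
    proof (intro sum.neutral ballI)
      fix k assume k: "k \<in> {1..<m}"
      then have ek: "e k \<in> H" by (intro e_mem) simp
      have "L2_inner \<rho> (e k) f2 = cnj (L2_inner \<rho> f2 (e k))" by (rule L2.commute[OF f2H ek])
      also have "\<dots> = 0" using L2_e[OF f2H, of k] orth[OF k] k by simp
      finally show "L2_inner \<rho> (cscale (of_real (inverse (sqrt (lam k))) * \<gamma> (k - 1)) (e k)) f2 = 0"
        unfolding L2.scale_left[OF ek f2H] by simp
    qed
    finally show ?thesis .
  qed
  have hH: "f2 - w \<in> H" by (rule diff_mem[OF f2H wH])
  have "L2.sq (f2 - w) = L2.sq f2 + L2.sq w"
  proof -
    have "L2_inner \<rho> f2 w = 0" unfolding L2.commute[OF wH f2H] L2_orth by simp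
    then show ?thesis
      unfolding L2.diff_left[OF f2H wH hH] L2.diff_right[OF f2H wH f2H] L2.diff_right[OF f2H wH wH] L2_orth
      by simp
  qed
  also have "\<dots> \<le> M * sq f + 28 * M / \<delta> * sq f"
  proof (rule add_mono)
    have "L2.sq f2 \<le> lam m * sq f2" by (rule L2_sq_le_lam[OF f2H orth m1])
    also have "\<dots> \<le> M * sq f" using M sq_f2 lm nonneg[OF f2H] M0 by (intro mult_mono) auto
    finally show "L2.sq f2 \<le> M * sq f" .
    show "L2.sq w \<le> 28 * M / \<delta> * sq f" unfolding L2_w by (rule gamma_le)
  qed
  also have "\<dots> \<le> M / \<delta> * sq f + 28 * M / \<delta> * sq f"
    using M0 \<delta> nonneg[OF f] by (intro add_right_mono mult_right_mono) (auto simp: field_simps)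
  also have "\<dots> = 29 / \<delta> * M * sq f" by (simp add: algebra_simps add_divide_distrib[symmetric])
  finally have L2_h: "L2.sq (f2 - w) \<le> 29 / \<delta> * M * sq f" .
  have pointwise: "(f2 - w) y = f y - (\<Sum>a<?r. c a * eta lam e (a + 1) y)" for y
    unfolding f2_def minus_apply proj_eta w_eta
    by (simp add: \<gamma>_def right_diff_distrib left_diff_distrib sum_subtractf mult.commute)
  have "(\<integral>y. (f2 - w) y \<partial>\<mu>) = (\<integral>y. f y \<partial>\<mu>) - cubature \<mu> lam e m n x f"
  proof -
    have int: "integrable \<mu> (\<lambda>y. c a * eta lam e (a + 1) y)" for a
      by (rule integrable_mult_right[OF eta_integrable_mu])
    have "(\<integral>y. (f2 - w) y \<partial>\<mu>) = (\<integral>y. f y \<partial>\<mu>) - (\<integral>y. (\<Sum>a<?r. c a * eta lam e (a + 1) y) \<partial>\<mu>)"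
      unfolding pointwise
      by (rule Bochner_Integration.integral_diff[OF integrable_mu[OF f] Bochner_Integration.integrable_sum[OF int]])
    also have "(\<integral>y. (\<Sum>a<?r. c a * eta lam e (a + 1) y) \<partial>\<mu>) = (\<Sum>a<?r. \<integral>y. c a * eta lam e (a + 1) y \<partial>\<mu>)"
      by (rule Bochner_Integration.integral_sum[OF int])
    also have "\<dots> = cubature \<mu> lam e m n x f" unfolding Q integral_mult_right_zero ..
    finally show ?thesis .
  qed
  then have "(cmod ((\<integral>y. f y \<partial>\<mu>) - cubature \<mu> lam e m n x f))\<^sup>2 \<le> C\<^sup>2 * L2.sq (f2 - w)"
    using integral_mu_le[OF hH] by simp
  also have "\<dots> \<le> C\<^sup>2 * (29 / \<delta> * M * sq f)" by (intro mult_left_mono L2_h) simp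
  finally show "(cmod ((\<integral>y. f y \<partial>\<mu>) - cubature \<mu> lam e m n x f))\<^sup>2 \<le> 29 * C\<^sup>2 / \<delta> * M * sq f"
    by (simp add: mult_ac)
qed

end

section \<open>Probability of the good nodes\<close>

text \<open>
  Conditions that become stronger with \<open>p\<close>, each of which holds with probability at least \<open>c\<close>, hold
  simultaneously with probability at least \<open>c\<close>. The sets \<open>G p\<close> themselves need not decrease.
\<close>

lemma decreasing_sets_Inter:
  assumes "prob_space N" and G: "\<And>p :: nat. G p \<in> sets N" "\<And>p. c \<le> measure N (G p)"
    and good: "\<And>p r x. p \<le> r \<Longrightarrow> P r x \<Longrightarrow> P p x" "\<And>p x. x \<in> G p \<Longrightarrow> P p x"
  shows "\<exists>A\<in>sets N. c \<le> measure N A \<and> (\<forall>x\<in>A. \<forall>p. P p x)"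
proof -
  interpret prob_space N by fact
  \<comment> \<open>Every point of \<open>G r\<close> with \<open>r \<ge> p\<close> is good for \<open>p\<close>, so these sets are good and decrease.\<close>
  define U where "U = (\<lambda>p. \<Union>r\<in>{p..}. G r)"
  have U: "U p \<in> sets N" for p using G(1) by (auto simp: U_def)
  have dec: "decseq U" unfolding U_def by (intro decseq_SucI UN_mono) auto
  have "(\<lambda>p. measure N (U p)) \<longlonglongrightarrow> measure N (\<Inter>p. U p)"
    using U dec by (intro finite_Lim_measure_decseq) auto
  moreover have "c \<le> measure N (U p)" for p
    using G(2)[of p] by (rule order_trans) (intro finite_measure_mono U, auto simp: U_def)
  ultimately have "c \<le> measure N (\<Inter>p. U p)" by (intro LIMSEQ_le_const) auto
  moreover have "(\<Inter>p. U p) \<in> sets N" using U by auto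
  moreover have "P p x" if "x \<in> (\<Inter>p. U p)" for x p
    using that good by (fastforce simp: U_def)
  ultimately show ?thesis by blast
qed

lemma cip_restrict:
  assumes "p \<le> (r :: nat)"
  shows "cip {m..<r} (\<lambda>k. if k < p then u k else 0) v = cip {m..<p} u v"
    and "sqn {m..<r} (\<lambda>k. if k < p then u k else 0) = sqn {m..<p} u"
  unfolding cip_def sqn_def using assms by (auto intro!: sum.mono_neutral_cong_right split: if_splits)

theorem theorem7p1:
  fixes D :: "(real ^ 'd) set"
    and K :: "real ^ 'd \<Rightarrow> real ^ 'd \<Rightarrow> complex"
    and H :: "(real ^ 'd \<Rightarrow> complex) set"
    and ip :: "(real ^ 'd \<Rightarrow> complex) \<Rightarrow> (real ^ 'd \<Rightarrow> complex) \<Rightarrow> complex"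
    and \<rho> \<mu> :: "(real ^ 'd) measure"
    and lam :: "nat \<Rightarrow> real"
    and e :: "nat \<Rightarrow> real ^ 'd \<Rightarrow> complex"
    and \<delta> :: real
    and m n :: nat
    and M :: "'w measure"
    and X :: "nat \<Rightarrow> 'w \<Rightarrow> real ^ 'd"
  assumes "psd_kernel D K"
    and "rkhs D K H ip"
    and "hseparable H ip"
    and "infinite_dimensional H"
    and "bdd_above ((\<lambda>x. Re (K x x)) ` D)"
    and "prob_space \<rho>" and "space \<rho> = D"
    and "\<And>f. f \<in> H \<Longrightarrow> f \<in> borel_measurable \<rho>"
    and "eigensystem \<rho> H ip lam e"
    and "sets \<mu> = sets \<rho>"
    and "L1_embeds \<rho> \<mu>"
    and "0 < \<delta>" and "\<delta> < 1"
    and "2 \<le> m" and "1 \<le> n"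
    and "spectral_N D lam e m \<le> real n / (48 * (sqrt 2 * ln (2 * real n) - ln \<delta>))"
    and "prob_space M"
    and "prob_space.indep_vars M (\<lambda>_. \<rho>) X {..<n}"
    and "\<And>j. j < n \<Longrightarrow> distr M \<rho> (X j) = \<rho>"
  shows "measure M {\<omega> \<in> space M.
      full_column_rank (L_mat lam e m n (\<lambda>j. X j \<omega>)) \<and>
      worst_case_sq_error H ip \<mu> (cubature \<mu> lam e m n (\<lambda>j. X j \<omega>))
        \<le> 29 * (L1_embedding_norm \<rho> \<mu>)\<^sup>2 / \<delta> *
          max ((sqrt (lam m))\<^sup>2) (ln (8 * real n) / real n * spectral_T D e m)}
    \<ge> 1 - 3 * \<delta>"
proof -
  obtain B where B: "\<And>x. x \<in> D \<Longrightarrow> Re (K x x) \<le> B" using assms(5) by (auto simp: bdd_above_def)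
  interpret rkhs D K H ip by fact
  interpret R: prob_space \<rho> by fact
  interpret cubature_setting D K H ip \<rho> B lam e \<mu>
    by unfold_locales (fact assms B)+
  interpret P: prob_space M by fact
  note n = \<open>1 \<le> n\<close> and m = \<open>2 \<le> m\<close> and \<delta> = \<open>0 < \<delta>\<close> \<open>\<delta> < 1\<close>
  have m1: "1 \<le> m" using m by simp
  have X: "X j \<in> measurable M \<rho>" if "j < n" for j
    using assms(18) that by (auto simp: P.indep_vars_def)
  have XD: "X j \<omega> \<in> D" if "j < n" "\<omega> \<in> space M" for j \<omega>
    using measurable_space[OF X[OF that(1)] that(2)] by (simp add: space_rho)
  let ?P = "PiM {..<n} (\<lambda>_. \<rho>)"
  define XX where "XX = (\<lambda>\<omega>. \<lambda>i\<in>{..<n}. X i \<omega>)"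
  have XX: "XX \<in> measurable M ?P"
    unfolding XX_def by (intro measurable_restrict X) simp
  have distr_XX: "distr M ?P XX = ?P"
  proof -
    have "distr M ?P XX = PiM {..<n} (\<lambda>i. distr M \<rho> (X i))"
      unfolding XX_def using P.indep_vars_iff_distr_eq_PiM'[where I = "{..<n}" and M' = "\<lambda>_. \<rho>" and X = X] assms(18) X n
      by (simp add: lessThan_empty_iff)
    also have "\<dots> = ?P" by (intro PiM_cong) (use assms(19) in auto)
    finally show ?thesis .
  qed
  have pull: "measure M (XX -` A \<inter> space M) = measure ?P A" if "A \<in> sets ?P" for A
    using measure_distr[OF XX that] by (simp add: distr_XX)
  have XXi: "XX \<omega> j = X j \<omega>" if "j < n" for \<omega> j using that by (simp add: XX_def)
  define Mx where "Mx = max (lam m) (ln (8 * real n) / real n * spectral_T D e m)"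
  have Mx: "lam m \<le> Mx" "ln (8 * real n) / real n * spectral_T D e m \<le> Mx" by (auto simp: Mx_def)
  have lm: "0 < lam m" by (rule lam_pos[OF m1])
  have Mx0: "0 < Mx" using Mx lm by simp

  interpret Head: random_vector \<rho> "{..<m - 1}" "\<lambda>x k. eta lam e (k + 1) x" "spectral_N D lam e m" "\<lambda>_. 1"
    by (rule random_vector_eta[OF m])
  have N1: "1 \<le> spectral_N D lam e m" using spectral_N_ge[of m] m by simp
  obtain G1 where G1: "G1 \<in> sets ?P"
    "measure ?P G1 \<ge> 1 - real (card {..<m - 1}) * exp (- real n / (48 * spectral_N D lam e m))"
    "\<And>x u. x \<in> G1 \<Longrightarrow> real n / 2 * sqn {..<m - 1} u
        \<le> (\<Sum>k<n. (cmod (cip {..<m - 1} u (\<lambda>i. eta lam e (i + 1) (x k))))\<^sup>2)"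
    using Head.lower_tail[OF n N1] by auto
  \<comment> \<open>The dimension \<open>m - 1\<close> is the mean of the function whose supremum is \<open>spectral_N\<close>. Hence it is at most \<open>n\<close>, and the logarithm in the hypothesis pays for it.\<close>
  have small: "real (card {..<m - 1}) * exp (- real n / (48 * spectral_N D lam e m)) \<le> \<delta>"
  proof -
    define t where "t = sqrt 2 * ln (2 * real n) - ln \<delta>"
    have ln2: "2 / 3 \<le> ln (2 * real n)"
    proof -
      have "2 / 3 \<le> ln (2 :: real)" by (rule ln2_ge_two_thirds)
      also have "\<dots> \<le> ln (2 * real n)" using n by simp
      finally show ?thesis .
    qed
    have "ln (2 * real n) \<le> sqrt 2 * ln (2 * real n)"
      using ln2 by (intro mult_le_cancel_right1[THEN iffD2]) auto
    then have t1: "ln (2 * real n) - ln \<delta> \<le> t" by (simp add: t_def)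
    have "ln \<delta> < 0" using \<delta> by simp
    then have t: "1 \<le> 48 * t" "0 < t" using t1 ln2 by linarith+
    have Nt: "spectral_N D lam e m \<le> real n / (48 * t)" using assms(16) by (simp add: t_def)
    have "real (m - 1) \<le> real n / (48 * t)" using spectral_N_ge[of m] Nt by simp
    also have "\<dots> \<le> real n" using t by (simp add: divide_le_eq mult_le_cancel_left1)
    finally have mn: "real (m - 1) \<le> real n" .
    have "t \<le> real n / (48 * spectral_N D lam e m)" using Nt t N1 by (simp add: field_simps)
    then have "exp (- real n / (48 * spectral_N D lam e m)) \<le> exp (- (ln (2 * real n) - ln \<delta>))"
      using t1 by simp
    also have "\<dots> = \<delta> / (2 * real n)" using n \<delta> by (simp add: exp_diff)
    finally have "real (card {..<m - 1}) * exp (- real n / (48 * spectral_N D lam e m)) \<le> real n * (\<delta> / (2 * real n))"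
      using mn by (intro mult_mono) auto
    also have "\<dots> \<le> \<delta>" using n \<delta> by simp
    finally show ?thesis .
  qed

  let ?good = "\<lambda>p x. \<forall>u. (\<Sum>k<n. (cmod (cip {m..<p} u (\<lambda>i. e i (x k))))\<^sup>2)
      \<le> 14 * real n * Mx / \<delta> * sqn {m..<p} u"
  have "\<exists>G. G \<in> sets ?P \<and> 1 - \<delta> \<le> measure ?P G \<and> (\<forall>x\<in>G. ?good p x)" for p
  proof -
    interpret Tail: random_vector \<rho> "{m..<p}" "\<lambda>x k. e k x" "spectral_T D e m" lam
      by (rule random_vector_e[OF m1])
    have le: "lam i \<le> Mx" if "i \<in> {m..<p}" for i
      using lam_antimono[OF m1, of i] that Mx(1) by simp
    obtain G where "G \<in> sets ?P" "measure ?P G \<ge> 1 - \<delta>"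
      "\<And>x u. x \<in> G \<Longrightarrow> (\<Sum>k<n. (cmod (cip {m..<p} u (\<lambda>i. e i (x k))))\<^sup>2)
        \<le> 14 * real n * Mx / \<delta> * sqn {m..<p} u"
      using Tail.upper_tail[OF n \<delta> Mx0 le Mx(2)] by auto
    then show ?thesis by blast
  qed
  then obtain G where G: "\<And>p. G p \<in> sets ?P" "\<And>p. 1 - \<delta> \<le> measure ?P (G p)" "\<And>p x. x \<in> G p \<Longrightarrow> ?good p x"
    by metis
  have mono: "?good p x" if "p \<le> r" "?good r x" for p r x
  proof
    fix u
    show "(\<Sum>k<n. (cmod (cip {m..<p} u (\<lambda>i. e i (x k))))\<^sup>2) \<le> 14 * real n * Mx / \<delta> * sqn {m..<p} u"
      \<comment> \<open>Extending \<open>u\<close> by zero turns a condition for \<open>r\<close> into one for \<open>p \<le> r\<close>.\<close>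
      using that(2)[rule_format, of "\<lambda>k. if k < p then u k else 0"] unfolding cip_restrict[OF that(1)] .
  qed
  have "\<exists>A\<in>sets ?P. 1 - \<delta> \<le> measure ?P A \<and> (\<forall>x\<in>A. \<forall>p. ?good p x)"
    by (rule decreasing_sets_Inter[where G = G and P = ?good, OF prob_space_PiM[OF assms(6)] G(1,2) mono G(3)])
  then obtain G2 where G2: "G2 \<in> sets ?P" "1 - \<delta> \<le> measure ?P G2" "\<And>x p. x \<in> G2 \<Longrightarrow> ?good p x"
    by blast

  obtain S where S: "countable S" "S \<subseteq> H" "\<And>f \<epsilon>. f \<in> H \<Longrightarrow> \<epsilon> > 0 \<Longrightarrow> \<exists>g\<in>S. hnorm ip (f - g) < \<epsilon>"
    using separable unfolding hseparable_def by blast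
  define c where "c = 29 * C\<^sup>2 / \<delta> * Mx"
  have c0: "0 \<le> c" using \<delta> Mx0 by (simp add: c_def)
  let ?L = "\<lambda>\<omega>. L_mat lam e m n (\<lambda>j. X j \<omega>)"
  let ?Q = "\<lambda>\<omega>. cubature \<mu> lam e m n (\<lambda>j. X j \<omega>)"
  define E where "E = {\<omega> \<in> space M. full_column_rank (?L \<omega>) \<and> worst_case_sq_error H ip \<mu> (?Q \<omega>) \<le> c}"
  define b where "b = (\<lambda>k. \<integral>x. eta lam e (k + 1) x \<partial>\<mu>)"
  have wce: "worst_case_sq_error H ip \<mu> (?Q \<omega>) \<le> c
      \<longleftrightarrow> (\<forall>f\<in>S. (cmod ((\<integral>y. f y \<partial>\<mu>) - ?Q \<omega> f))\<^sup>2 \<le> c * sq f)"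
    if "\<omega> \<in> space M" "full_column_rank (?L \<omega>)" for \<omega>
  proof -
    let ?q = "\<lambda>j. \<Sum>k<m - 1. cubature_coeff lam e m n (\<lambda>j. X j \<omega>) j k * b k"
    have Q: "?Q \<omega> = (\<lambda>f. \<Sum>j<n. ?q j * f (X j \<omega>))"
      unfolding cubature_eq[OF that(2), abs_def] b_def ..
    show ?thesis
      unfolding Q by (rule worst_case_sq_error_le_iff[where x = "\<lambda>j. X j \<omega>", OF XD[OF _ that(1)] c0 S(2,3)])
  qed
  have E_sets: "E \<in> sets M"
  proof -
    define dt where "dt = (\<lambda>\<omega>. Determinant.det (gram (?L \<omega>)))"
    define q where "q = (\<lambda>\<omega> j. \<Sum>k<m - 1. (\<Sum>l<m - 1. cnj (eta lam e (l + 1) (X j \<omega>))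
        * cnj (adj_mat (gram (?L \<omega>)) $$ (l, k) / dt \<omega>)) * b k)"
    have eta_X [measurable]: "(\<lambda>\<omega>. eta lam e (a + 1) (X j \<omega>)) \<in> borel_measurable M" if "j < n" for a j
      by (rule measurable_compose[OF X[OF that] eta_measurable]) simp
    have gram_meas: "(\<lambda>\<omega>. gram (?L \<omega>) $$ (i, j)) \<in> borel_measurable M" if "i < m - 1" "j < m - 1" for i j
    proof -
      have "gram (?L \<omega>) $$ (i, j)
          = (\<Sum>l<n. cnj (eta lam e (i + 1) (X l \<omega>)) * eta lam e (j + 1) (X l \<omega>))" for \<omega>
        using that by (simp add: gram_index[OF L_mat_carrier] L_mat_index)
      then show ?thesis
        by (simp only:) (intro borel_measurable_sum borel_measurable_times borel_measurable_cnj eta_X, auto)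
    qed
    have dt_meas [measurable]: "dt \<in> borel_measurable M"
      unfolding dt_def by (rule measurable_det[where r = "m - 1"]) (auto intro: gram_carrier L_mat_carrier gram_meas)
    have adj_meas: "(\<lambda>\<omega>. adj_mat (gram (?L \<omega>)) $$ (l, k)) \<in> borel_measurable M" if "l < m - 1" "k < m - 1" for l k
      by (rule measurable_adj_mat[where r = "m - 1", OF gram_carrier[OF L_mat_carrier] gram_meas that])
    have q_meas: "(\<lambda>\<omega>. q \<omega> j) \<in> borel_measurable M" if "j < n" for j
      unfolding q_def using that
      by (intro borel_measurable_sum borel_measurable_times borel_measurable_cnj borel_measurable_divide
          eta_X adj_meas dt_meas borel_measurable_const) auto
    have Q_eq: "?Q \<omega> f = (\<Sum>j<n. q \<omega> j * f (X j \<omega>))" if "full_column_rank (?L \<omega>)" for \<omega> f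
    proof -
      have d: "Determinant.det (gram (?L \<omega>)) \<noteq> 0" using that full_column_rank_iff_gram[OF L_mat_carrier] by blast
      show ?thesis
        unfolding cubature_eq[OF that] q_def b_def cubature_coeff_def dt_def
        by (intro sum.cong refl arg_cong2[where f = "(*)"] arg_cong[where f = cnj]
            mat_inverse_gram_index[OF L_mat_carrier d]) auto
    qed
    have fcr: "full_column_rank (?L \<omega>) \<longleftrightarrow> dt \<omega> \<noteq> 0" for \<omega>
      unfolding dt_def by (rule full_column_rank_iff_gram[OF L_mat_carrier])
    have "(full_column_rank (?L \<omega>) \<and> worst_case_sq_error H ip \<mu> (?Q \<omega>) \<le> c) \<longleftrightarrow> (dt \<omega> \<noteq> 0 \<and>
        (\<forall>f\<in>S. (cmod ((\<integral>y. f y \<partial>\<mu>) - (\<Sum>j<n. q \<omega> j * f (X j \<omega>))))\<^sup>2 \<le> c * sq f))"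
      if "\<omega> \<in> space M" for \<omega>
    proof (cases "full_column_rank (?L \<omega>)")
      case True
      then show ?thesis unfolding wce[OF that True] Q_eq[OF True] using fcr[of \<omega>] by blast
    next
      case False
      then show ?thesis using fcr[of \<omega>] by blast
    qed
    then have "E = {\<omega> \<in> space M. dt \<omega> \<noteq> 0 \<and>
        (\<forall>f\<in>S. (cmod ((\<integral>y. f y \<partial>\<mu>) - (\<Sum>j<n. q \<omega> j * f (X j \<omega>))))\<^sup>2 \<le> c * sq f)}"
      unfolding E_def by (rule Collect_cong[OF conj_cong[OF refl]])
    also have "\<dots> = {\<omega> \<in> space M. dt \<omega> \<noteq> 0} \<inter> {\<omega> \<in> space M.
        \<forall>f\<in>S. (cmod ((\<integral>y. f y \<partial>\<mu>) - (\<Sum>j<n. q \<omega> j * f (X j \<omega>))))\<^sup>2 \<le> c * sq f}"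
      by auto
    also have "\<dots> \<in> sets M"
    proof (rule sets.Int)
      show "{\<omega> \<in> space M. dt \<omega> \<noteq> 0} \<in> sets M" by measurable
      show "{\<omega> \<in> space M. \<forall>f\<in>S. (cmod ((\<integral>y. f y \<partial>\<mu>) - (\<Sum>j<n. q \<omega> j * f (X j \<omega>))))\<^sup>2 \<le> c * sq f} \<in> sets M"
      proof (rule sets.sets_Collect_countable_All'[OF _ S(1)])
        fix f assume "f \<in> S"
        then have f: "f \<in> H" using S(2) by auto
        have fX: "(\<lambda>\<omega>. f (X j \<omega>)) \<in> borel_measurable M" if "j < n" for j
          by (rule measurable_compose[OF X[OF that] meas_H[OF f]])
        have [measurable]: "(\<lambda>\<omega>. \<Sum>j<n. q \<omega> j * f (X j \<omega>)) \<in> borel_measurable M"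
          by (intro borel_measurable_sum borel_measurable_times q_meas fX) auto
        show "{\<omega> \<in> space M. (cmod ((\<integral>y. f y \<partial>\<mu>) - (\<Sum>j<n. q \<omega> j * f (X j \<omega>))))\<^sup>2 \<le> c * sq f} \<in> sets M"
          by measurable
      qed
    qed
    finally show ?thesis .
  qed

  have AE_exp: "AE \<omega> in M. \<forall>j\<in>{..<n}. \<forall>f\<in>H. (\<lambda>N. proj f N (X j \<omega>)) \<longlonglongrightarrow> f (X j \<omega>)"
  proof (rule AE_finite_allI)
    fix j assume "j \<in> {..<n}"
    then have j: "j < n" by simp
    have "AE x in distr M \<rho> (X j). \<forall>f\<in>H. (\<lambda>N. proj f N x) \<longlonglongrightarrow> f x"
      unfolding assms(19)[OF j] by (rule AE_expansion)
    then show "AE \<omega> in M. \<forall>f\<in>H. (\<lambda>N. proj f N (X j \<omega>)) \<longlonglongrightarrow> f (X j \<omega>)"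
      by (rule AE_distrD[OF X[OF j]])
  qed simp
  define A where "A = (XX -` G1 \<inter> space M) \<inter> (XX -` G2 \<inter> space M)"
  have A1: "XX -` G1 \<inter> space M \<in> sets M" and A2: "XX -` G2 \<inter> space M \<in> sets M"
    using measurable_sets[OF XX] G1(1) G2(1) by auto
  have sub: "AE \<omega> in M. \<omega> \<in> A \<longrightarrow> \<omega> \<in> E"
    using AE_exp
  proof (rule AE_mp, intro AE_I2 impI)
    fix \<omega> assume \<omega>: "\<omega> \<in> space M" "\<forall>j\<in>{..<n}. \<forall>f\<in>H. (\<lambda>N. proj f N (X j \<omega>)) \<longlonglongrightarrow> f (X j \<omega>)" "\<omega> \<in> A"
    have low: "real n / 2 * sqn {..<m - 1} u
        \<le> (\<Sum>j<n. (cmod (cip {..<m - 1} u (\<lambda>a. eta lam e (a + 1) (X j \<omega>))))\<^sup>2)" for u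
      using G1(3)[of "XX \<omega>" u] \<omega>(3) by (simp add: A_def XXi)
    have up: "(\<Sum>j<n. (cmod (cip {m..<p} u (\<lambda>k. e k (X j \<omega>))))\<^sup>2) \<le> 14 * real n * Mx / \<delta> * sqn {m..<p} u" for p u
      using G2(3)[of "XX \<omega>" p] \<omega>(3) by (simp add: A_def XXi)
    have ex: "(\<lambda>N. proj f N (X j \<omega>)) \<longlonglongrightarrow> f (X j \<omega>)" if "j < n" "f \<in> H" for j f
      using \<omega>(2) that by simp
    have full: "full_column_rank (?L \<omega>)"
      by (rule cubature_error(1)[where x = "\<lambda>j. X j \<omega>", OF n m \<delta> Mx(1) low up]) (rule ex)
    have err: "(cmod ((\<integral>y. f y \<partial>\<mu>) - ?Q \<omega> f))\<^sup>2 \<le> c * sq f" if "f \<in> H" for f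
      unfolding c_def
      by (rule cubature_error(2)[where x = "\<lambda>j. X j \<omega>", OF n m \<delta> Mx(1) low up _ that]) (rule ex)
    have "worst_case_sq_error H ip \<mu> (?Q \<omega>) \<le> c"
      unfolding wce[OF \<omega>(1) full] using err S(2) by blast
    then show "\<omega> \<in> E" using full \<omega>(1) by (simp add: E_def)
  qed
  have "1 - 3 * \<delta> \<le> P.prob A"
  proof -
    have p1: "1 - \<delta> \<le> P.prob (XX -` G1 \<inter> space M)" unfolding pull[OF G1(1)] using G1(2) small by linarith
    have p2: "1 - \<delta> \<le> P.prob (XX -` G2 \<inter> space M)" unfolding pull[OF G2(1)] by (rule G2(2))
    have "P.prob (space M - A) \<le> P.prob (space M - (XX -` G1 \<inter> space M)) + P.prob (space M - (XX -` G2 \<inter> space M))"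
    proof -
      have "space M - A = (space M - (XX -` G1 \<inter> space M)) \<union> (space M - (XX -` G2 \<inter> space M))"
        by (auto simp: A_def)
      then show ?thesis using A1 A2 by (simp only:) (intro measure_Un_le sets.compl_sets)
    qed
    moreover have "A \<in> sets M" unfolding A_def by (rule sets.Int[OF A1 A2])
    ultimately show ?thesis using p1 p2 \<delta> A1 A2 by (simp add: P.prob_compl)
  qed
  also have "\<dots> \<le> P.prob E" by (rule P.finite_measure_mono_AE[OF sub E_sets])
  finally have "1 - 3 * \<delta> \<le> P.prob E" .
  moreover have "(sqrt (lam m))\<^sup>2 = lam m" using lm by simp
  ultimately show ?thesis unfolding E_def c_def Mx_def by simp
qed

end
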